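(* Let $P,\tilde P$ be probability measures on $\Xi=\Xi_{1:T}$, let $\mathcal S_1,\dots,\mathcal S_T$ be collections of distortion functions, and let $r\in[1,\infty)$ and $q\in(1,\infty]$ satisfy $\frac1r+\frac1q=1$. Suppose that the random variable $Y\colon\Xi\to\mathbb R$ is Hölder continuous with constant $L\ge 0$ and exponent $0<\beta\le1$, i.e., $|Y(x)-Y(y)|\le L\cdot d(x,y)^\beta$ for all $x,y\in\Xi$. Then the nested risk functional $\mathcal R_{\mathcal S_{1:T}}(Y)$ is continuous with respect to the nested distance; more precisely $$\left|\mathcal R_{\mathcal S_{1:T};P}(Y)-\mathcal R_{\mathcal S_{1:T};\tilde P}(Y)\right|\le \sup_{\sigma_t\in\mathcal S_t,\ t=1,\dots,T}\ \|\sigma_1\|_q\cdots\|\sigma_T\|_q\cdot L\cdot \mathsf{dI}_r(P,\tilde P)^\beta .$$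
   Context: Spaces: $T\ge1$; $(\Xi_t,d_t)$, $t=1,\dots,T$, are Polish metric spaces; $\Xi:=\Xi_{1:T}:=\Xi_1\times\dots\times\Xi_T$ carries a metric $d$ for which $(\Xi,d)$ is Polish (with the product topology), and $\Xi_{1:t}:=\Xi_1\times\dots\times\Xi_t$. Elements are written $x=x_{1:T}=(x_1,\dots,x_T)$, with $x_{1:t}=(x_1,\dots,x_t)$ and $x_{1:0}$ the empty tuple. For a Borel probability measure $P$ on $\Xi$, $P(\cdot\mid x_{1:t})$ denotes the regular conditional probability (disintegration) on $\Xi_{t+1}\times\dots\times\Xi_T$ given the first $t$ coordinates, and $P_{t+1}(\cdot\mid x_{1:t})$ its marginal on $\Xi_{t+1}$; for $t=0$ these are unconditional. Risk functionals: a distortion function is a nondecreasing $\sigma\colon[0,1)\to[0,\infty)$ with $\int_0^1\sigma(u)\,du=1$; $\|\sigma\|_q$ is its $L^q([0,1))$ norm. For a probability measure $P$ and $\alpha\in[0,1)$, $\mathsf{AV@R}_{\alpha;P}(Y):=\inf_{c\in\mathbb R}\{c+\frac1{1-\alpha}\mathbb E_P(Y-c)_+\}$. For a distortion function $\sigma$, $$\mathcal R_{\sigma;P}(Y):=\sup\Big\{\mathbb E_P Y\zeta:\ \zeta\ge0,\ \mathbb E_P\zeta=1,\ \mathsf{AV@R}_{\alpha;P}(\zeta)\le\tfrac1{1-\alpha}\int_\alpha^1\sigma(u)\,du\ \text{ for all }\alpha\in(0,1)\Big\}.$$ The conditional risk measure is $\mathcal R_{\mathcal S_{t+1};P}(Y\mid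 x_{1:t}):=\sup_{\sigma\in\mathcal S_{t+1}}\mathcal R_{\sigma;P(\cdot\mid x_{1:t})}(Y(x_{1:t},\cdot))$, and the nested risk functional is $$\mathcal R_{\mathcal S_{1:T};P}(Y):=\mathcal R_{\mathcal S_1;P}\bigl(\dots\mathcal R_{\mathcal S_{T-1};P}\bigl(\mathcal R_{\mathcal S_T;P}(Y\mid x_{1:T-1})\mid x_{1:T-2}\bigr)\dots\bigr).$$ All random variables are assumed to be such that the risk functionals are well defined and finite. Nested distance: for probability measures $\mu,\nu$ and a cost function $c$, $w_r(\mu,\nu;c):=\inf_\pi\left(\iint c(x,y)^r\,\pi(dx,dy)\right)^{1/r}$, the infimum being over all bivariate probability measures with marginals $\mu$ and $\nu$. Put $c_T:=d$ and, for $t=T,\dots,1$, $c_{t-1}(x_{1:t-1},y_{1:t-1}):=w_r\bigl(P_t(\cdot\mid x_{1:t-1}),\tilde P_t(\cdot\mid y_{1:t-1});\,c_t\bigr)$, where $c_t$ is regarded as a function of $(x_t,y_t)$ with $x_{1:t-1},y_{1:t-1}$ fixed. The nested distance of order $r$ is $\mathsf{dI}_r(P,\tilde P):=c_0$. *)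

theory Defs
  imports "HOL-Probability.Probability"
begin

definition polish_metric :: "'a metric \<Rightarrow> bool" where
  "polish_metric m \<longleftrightarrow> mcomplete_of m \<and> separable_space (mtopology_of m)"

definition borel_of :: "'a topology \<Rightarrow> 'a measure" where
  "borel_of X = sigma (topspace X) {U. openin X U}"

text \<open>
  The factors \<open>\<Xi> t\<close> are metric spaces with their own carriers inside a common type.  Points of
  a partial product over the index set \<open>I\<close> are extensional functions on \<open>I\<close>; in particular the
  empty tuple is \<open>\<lambda>_. undefined\<close>.
\<close>

definition path_topology :: "(nat \<Rightarrow> 'a metric) \<Rightarrow> nat set \<Rightarrow> (nat \<Rightarrow> 'a) topology" where
  "path_topology \<Xi> I = product_topology (\<lambda>t. mtopology_of (\<Xi> t)) I"

abbreviation path_borel :: "(nat \<Rightarrow> 'a metric) \<Rightarrow> nat set \<Rightarrow> (nat \<Rightarrow> 'a) measure" where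
  "path_borel \<Xi> I \<equiv> borel_of (path_topology \<Xi> I)"

definition initial_law ::
    "(nat \<Rightarrow> 'a metric) \<Rightarrow> (nat \<Rightarrow> 'a) measure \<Rightarrow> nat \<Rightarrow> (nat \<Rightarrow> 'a) measure" where
  "initial_law \<Xi> P t = distr P (path_borel \<Xi> {1..t}) (\<lambda>x. restrict x {1..t})"

text \<open>
  \<open>\<kappa> t x\<close> is a version of the regular conditional probability on the coordinates
  \<open>t+1, \<dots>, T\<close> given that the first \<open>t\<close> coordinates are \<open>x\<close>.  For \<open>t = 0\<close> the condition forces
  \<open>\<kappa> 0 (\<lambda>_. undefined) = P\<close>.
\<close>

definition disintegration ::
    "(nat \<Rightarrow> 'a metric) \<Rightarrow> nat \<Rightarrow> (nat \<Rightarrow> 'a) measure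
      \<Rightarrow> (nat \<Rightarrow> (nat \<Rightarrow> 'a) \<Rightarrow> (nat \<Rightarrow> 'a) measure) \<Rightarrow> bool" where
  "disintegration \<Xi> T P \<kappa> \<longleftrightarrow>
    (\<forall>t<T. \<kappa> t \<in> path_borel \<Xi> {1..t} \<rightarrow>\<^sub>M prob_algebra (path_borel \<Xi> {t+1..T}) \<and>
      (\<forall>A\<in>sets (path_borel \<Xi> {1..T}).
        emeasure P A =
          (\<integral>\<^sup>+x. emeasure (\<kappa> t x)
                 {z \<in> space (path_borel \<Xi> {t+1..T}). merge {1..t} {t+1..T} (x, z) \<in> A}
            \<partial>initial_law \<Xi> P t)))"

definition next_law ::
    "(nat \<Rightarrow> 'a metric) \<Rightarrow> (nat \<Rightarrow> (nat \<Rightarrow> 'a) \<Rightarrow> (nat \<Rightarrow> 'a) measure)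
      \<Rightarrow> nat \<Rightarrow> (nat \<Rightarrow> 'a) \<Rightarrow> 'a measure" where
  "next_law \<Xi> \<kappa> t x = distr (\<kappa> t x) (borel_of (mtopology_of (\<Xi> (t+1)))) (\<lambda>z. z (t+1))"

definition unit_leb :: "real measure" where
  "unit_leb = restrict_space lborel {0..<1}"

definition distortion :: "(real \<Rightarrow> real) \<Rightarrow> bool" where
  "distortion \<sigma> \<longleftrightarrow>
    (\<forall>u\<in>{0..<1}. 0 \<le> \<sigma> u) \<and> mono_on {0..<1} \<sigma> \<and> (\<integral>\<^sup>+u. ennreal (\<sigma> u) \<partial>unit_leb) = 1"

text \<open>Power with a strictly positive real exponent, so that \<open>\<infinity>\<close> is mapped to \<open>\<infinity>\<close>.\<close>

definition epowr :: "ennreal \<Rightarrow> real \<Rightarrow> ennreal" where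
  "epowr a p = (if a = \<infinity> then \<infinity> else ennreal (enn2real a powr p))"

definition Lq_norm :: "ennreal \<Rightarrow> (real \<Rightarrow> real) \<Rightarrow> ennreal" where
  "Lq_norm q \<sigma> =
    (if q = \<infinity> then esssup unit_leb (\<lambda>u. ennreal \<bar>\<sigma> u\<bar>)
     else epowr (\<integral>\<^sup>+u. epowr (ennreal \<bar>\<sigma> u\<bar>) (enn2real q) \<partial>unit_leb) (1 / enn2real q))"

text \<open>
  In \<^typ>\<open>ereal\<close> one has \<open>\<infinity> - \<infinity> = \<infinity>\<close>: an undefined expectation has the value \<open>\<infinity>\<close>.
\<close>

definition expect :: "'b measure \<Rightarrow> ('b \<Rightarrow> ereal) \<Rightarrow> ereal" where
  "expect M Z =
    enn2ereal (\<integral>\<^sup>+\<omega>. e2ennreal (Z \<omega>) \<partial>M) - enn2ereal (\<integral>\<^sup>+\<omega>. e2ennreal (- Z \<omega>) \<partial>M)"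

definition AVaR :: "real \<Rightarrow> 'b measure \<Rightarrow> ('b \<Rightarrow> real) \<Rightarrow> ereal" where
  "AVaR \<alpha> M Z =
    (INF c::real. ereal c + ereal (1 / (1 - \<alpha>)) * expect M (\<lambda>\<omega>. ereal (max (Z \<omega> - c) 0)))"

definition feasible :: "(real \<Rightarrow> real) \<Rightarrow> 'b measure \<Rightarrow> ('b \<Rightarrow> real) set" where
  "feasible \<sigma> M =
    {\<zeta> \<in> borel_measurable M.
      (\<forall>\<omega>\<in>space M. 0 \<le> \<zeta> \<omega>) \<and> expect M (\<lambda>\<omega>. ereal (\<zeta> \<omega>)) = 1 \<and>
      (\<forall>\<alpha>\<in>{0<..<1}. AVaR \<alpha> M \<zeta> \<le> ereal (1 / (1 - \<alpha>) * (LBINT u:{\<alpha>..<1}. \<sigma> u)))}"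

definition risk :: "(real \<Rightarrow> real) \<Rightarrow> 'b measure \<Rightarrow> ('b \<Rightarrow> ereal) \<Rightarrow> ereal" where
  "risk \<sigma> M Y = (SUP \<zeta>\<in>feasible \<sigma> M. expect M (\<lambda>\<omega>. Y \<omega> * ereal (\<zeta> \<omega>)))"

text \<open>
  \<open>stage_risk T S \<kappa> Y t\<close> is the random variable on the first \<open>t\<close> coordinates obtained by applying
  the conditional risk measures of the stages \<open>T, \<dots>, t+1\<close> to \<open>Y\<close>.
\<close>

function stage_risk ::
    "nat \<Rightarrow> (nat \<Rightarrow> (real \<Rightarrow> real) set) \<Rightarrow> (nat \<Rightarrow> (nat \<Rightarrow> 'a) \<Rightarrow> (nat \<Rightarrow> 'a) measure)
      \<Rightarrow> ((nat \<Rightarrow> 'a) \<Rightarrow> real) \<Rightarrow> nat \<Rightarrow> (nat \<Rightarrow> 'a) \<Rightarrow> ereal" where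
  "stage_risk T S \<kappa> Y t x =
    (if t < T
     then SUP \<sigma>\<in>S (t+1). risk \<sigma> (\<kappa> t x) (\<lambda>z. stage_risk T S \<kappa> Y (t+1) (x(t+1 := z (t+1))))
     else ereal (Y x))"
  by pat_completeness auto
termination
  by (relation "Wellfounded.measure (\<lambda>(T, S, \<kappa>, Y, t, x). T - t)") auto

declare stage_risk.simps [simp del]

definition nested_risk ::
    "nat \<Rightarrow> (nat \<Rightarrow> (real \<Rightarrow> real) set) \<Rightarrow> (nat \<Rightarrow> (nat \<Rightarrow> 'a) \<Rightarrow> (nat \<Rightarrow> 'a) measure)
      \<Rightarrow> ((nat \<Rightarrow> 'a) \<Rightarrow> real) \<Rightarrow> ereal" where
  "nested_risk T S \<kappa> Y = stage_risk T S \<kappa> Y 0 (\<lambda>_. undefined)"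

text \<open>
  Every conditional risk is a random variable that is almost surely finite.  Finiteness excludes
  undefined expectations in \<^const>\<open>risk\<close>, as these have the value \<open>\<infinity>\<close>, and, for \<open>t = 0\<close>, says
  that the nested risk itself is finite.
\<close>

definition risks_finite ::
    "(nat \<Rightarrow> 'a metric) \<Rightarrow> nat \<Rightarrow> (nat \<Rightarrow> (real \<Rightarrow> real) set) \<Rightarrow> (nat \<Rightarrow> 'a) measure
      \<Rightarrow> (nat \<Rightarrow> (nat \<Rightarrow> 'a) \<Rightarrow> (nat \<Rightarrow> 'a) measure) \<Rightarrow> ((nat \<Rightarrow> 'a) \<Rightarrow> real) \<Rightarrow> bool" where
  "risks_finite \<Xi> T S P \<kappa> Y \<longleftrightarrow>
    (\<forall>t<T. stage_risk T S \<kappa> Y t \<in> borel_measurable (path_borel \<Xi> {1..t}) \<and>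
      (AE x in initial_law \<Xi> P t. \<bar>stage_risk T S \<kappa> Y t x\<bar> \<noteq> \<infinity>))"

definition couplings :: "'b measure \<Rightarrow> 'c measure \<Rightarrow> ('b \<times> 'c) measure set" where
  "couplings \<mu> \<nu> =
    {\<pi>. sets \<pi> = sets (\<mu> \<Otimes>\<^sub>M \<nu>) \<and> distr \<pi> \<mu> fst = \<mu> \<and> distr \<pi> \<nu> snd = \<nu>}"

definition wasserstein ::
    "real \<Rightarrow> 'b measure \<Rightarrow> 'c measure \<Rightarrow> ('b \<Rightarrow> 'c \<Rightarrow> ennreal) \<Rightarrow> ennreal" where
  "wasserstein r \<mu> \<nu> c =
    (INF \<pi>\<in>couplings \<mu> \<nu>. epowr (\<integral>\<^sup>+z. epowr (c (fst z) (snd z)) r \<partial>\<pi>) (1 / r))"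

function stage_cost ::
    "real \<Rightarrow> (nat \<Rightarrow> 'a metric) \<Rightarrow> nat \<Rightarrow> (nat \<Rightarrow> 'a) metric
      \<Rightarrow> (nat \<Rightarrow> (nat \<Rightarrow> 'a) \<Rightarrow> (nat \<Rightarrow> 'a) measure)
      \<Rightarrow> (nat \<Rightarrow> (nat \<Rightarrow> 'a) \<Rightarrow> (nat \<Rightarrow> 'a) measure)
      \<Rightarrow> nat \<Rightarrow> (nat \<Rightarrow> 'a) \<Rightarrow> (nat \<Rightarrow> 'a) \<Rightarrow> ennreal" where
  "stage_cost r \<Xi> T d \<kappa> \<kappa>' t x y =
    (if t < T
     then wasserstein r (next_law \<Xi> \<kappa> t x) (next_law \<Xi> \<kappa>' t y)
            (\<lambda>u v. stage_cost r \<Xi> T d \<kappa> \<kappa>' (t+1) (x(t+1 := u)) (y(t+1 := v)))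
     else ennreal (mdist d x y))"
  by pat_completeness auto
termination
  by (relation "Wellfounded.measure (\<lambda>(r, \<Xi>, T, d, \<kappa>, \<kappa>', t, x, y). T - t)") auto

declare stage_cost.simps [simp del]

definition nested_dist ::
    "real \<Rightarrow> (nat \<Rightarrow> 'a metric) \<Rightarrow> nat \<Rightarrow> (nat \<Rightarrow> 'a) metric
      \<Rightarrow> (nat \<Rightarrow> (nat \<Rightarrow> 'a) \<Rightarrow> (nat \<Rightarrow> 'a) measure)
      \<Rightarrow> (nat \<Rightarrow> (nat \<Rightarrow> 'a) \<Rightarrow> (nat \<Rightarrow> 'a) measure) \<Rightarrow> ennreal" where
  "nested_dist r \<Xi> T d \<kappa> \<kappa>' =
    stage_cost r \<Xi> T d \<kappa> \<kappa>' 0 (\<lambda>_. undefined) (\<lambda>_. undefined)"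

end

theory Submission
  imports Defs
begin

text \<open>
  A feasible density \<open>\<zeta>\<close> of \<open>R\<^sub>\<sigma>\<close> is constrained through the average value-at-risk at all levels.
  These constraints say that \<open>\<zeta>\<close> is dominated by \<open>\<sigma>\<close>, under the uniform law, in the stop-loss order
  \<open>E (\<zeta> - c)\<^sub>+ \<le> \<integral> (\<sigma> - c)\<^sub>+\<close> (\<open>feasible_stop_loss\<close>).  The order is used in two ways.  It bounds the
  moments, \<open>\<parallel>\<zeta>\<parallel>\<^sub>q \<le> \<parallel>\<sigma>\<parallel>\<^sub>q\<close>, since \<open>x\<^sup>q\<close> is a mixture of the functions \<open>(x - c)\<^sub>+\<close>.  And it decreases
  under conditioning, by Jensen's inequality, so that conditioning preserves feasibility.

  Let \<open>\<pi>\<close> be a coupling of the conditional laws of the next coordinate of the two processes.  A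
  density that is feasible for the first law is transported along \<open>\<pi>\<close> by conditioning, and it
  remains feasible for the second law.  The two weighted expectations then differ by at most
  \<open>E\<^sub>\<pi> \<bar>F - F'\<bar> g\<close> for a density \<open>g\<close> dominated by \<open>\<sigma>\<close> (\<open>risk_coupling\<close>).  If the risks to go
  satisfy \<open>\<bar>F - F'\<bar> \<le> A c\<^sup>\<beta>\<close>, then the inequalities of Hoelder and Jensen bound this by
  \<open>\<parallel>\<sigma>\<parallel>\<^sub>q A (E\<^sub>\<pi> c\<^sup>r)\<^sup>\<beta>\<^sup>/\<^sup>r\<close>.  The infimum over \<open>\<pi>\<close> yields the next cost of the nested distance
  (\<open>one_stage_estimate\<close>), and backward induction over the stages, starting with the Hoelder
  continuity of \<open>Y\<close>, gives the theorem when the norms are finite (\<open>nested_risk_difference_le\<close>).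

  If the supremum of the products of norms is infinite and \<open>L > 0\<close>, then the right-hand side is
  infinite unless the nested distance is zero.  In this last case the right-hand side is zero, by
  the convention \<open>\<infinity> \<cdot> 0 = 0\<close>, and the two risks have to be equal.  The finite case, applied to
  bounded Lipschitz functions and the constant distortion function \<open>1\<close>, shows that the two laws
  coincide (\<open>nested_dist_eq_0_imp_eq\<close>).  The disintegrations are then almost surely equal, because
  the Borel sets of the path space are countably generated, and so are the conditional risks
  (\<open>nested_risk_version_independent\<close>).
\<close>

section \<open>Powers of extended nonnegative numbers\<close>

lemma epowr_ennreal [simp]: "0 \<le> a \<Longrightarrow> epowr (ennreal a) p = ennreal (a powr p)"
  by (simp add: epowr_def)

lemma epowr_top [simp]: "epowr \<infinity> p = \<infinity>" "epowr top p = top"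
  by (simp_all add: epowr_def)

lemma epowr_mono: "0 \<le> p \<Longrightarrow> a \<le> b \<Longrightarrow> epowr a p \<le> epowr b p"
  by (cases a; cases b) (auto simp: powr_mono2 top_unique)

lemma epowr_inverse: "0 < p \<Longrightarrow> epowr (epowr a p) (1 / p) = a"
  by (cases a) (auto simp: powr_powr)

lemma epowr_inverse': "0 < p \<Longrightarrow> epowr (epowr a (1 / p)) p = a"
  by (cases a) (auto simp: powr_powr)

lemma le_epowr_iff: "0 < p \<Longrightarrow> b \<le> epowr a p \<longleftrightarrow> epowr b (1 / p) \<le> a"
  using epowr_mono[of p "epowr b (1 / p)" a] epowr_mono[of "1 / p" b "epowr a p"]
  by (auto simp: epowr_inverse epowr_inverse')

lemma epowr_zero [simp]: "epowr 0 p = 0"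
  by (simp add: epowr_def)

lemma epowr_eq_0_iff: "epowr a p = 0 \<longleftrightarrow> a = 0"
  by (cases a) (auto simp: epowr_def)

section \<open>The average value-at-risk constraints and the stop-loss order\<close>

lemma prob_space_unit_leb: "prob_space unit_leb"
  by (rule prob_spaceI) (simp add: unit_leb_def emeasure_restrict_space)

lemma space_unit_leb [simp]: "space unit_leb = {0..<1}"
  by (simp add: unit_leb_def)

lemma distortion_measurable:
  assumes "distortion \<sigma>"
  shows "\<sigma> \<in> borel_measurable unit_leb"
proof -
  have "\<sigma> \<in> borel_measurable (restrict_space borel {0..<1})"
    using assms by (intro borel_measurable_mono_on_fnc) (auto simp: distortion_def)
  then show ?thesis
    unfolding unit_leb_def by (simp add: measurable_def sets_restrict_space space_restrict_space)
qed

lemma distortion_integral: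
  assumes "distortion \<sigma>"
  shows "integrable unit_leb \<sigma>" "(LINT u|unit_leb. \<sigma> u) = 1"
proof -
  have nn: "(\<integral>\<^sup>+u. ennreal (\<sigma> u) \<partial>unit_leb) = 1" and "\<And>u. u \<in> {0..<1} \<Longrightarrow> 0 \<le> \<sigma> u"
    using assms by (auto simp: distortion_def)
  then have ae: "AE u in unit_leb. 0 \<le> \<sigma> u"
    by (intro AE_I2) simp
  show "integrable unit_leb \<sigma>"
    using nn ae distortion_measurable[OF assms] by (intro integrableI_nonneg) auto
  show "(LINT u|unit_leb. \<sigma> u) = 1"
    using nn ae distortion_measurable[OF assms] by (subst integral_eq_nn_integral) auto
qed

lemma tail_integral_unit_leb:
  fixes \<sigma> :: "real \<Rightarrow> real"
  assumes "0 \<le> \<alpha>"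
  shows "(LBINT u:{\<alpha>..<1}. \<sigma> u) = (LINT u|unit_leb. indicator {\<alpha>..<1} u * \<sigma> u)"
proof -
  have "(LINT u|unit_leb. indicator {\<alpha>..<1} u * \<sigma> u)
      = (LINT u|lborel. indicator {0..<1} u *\<^sub>R (indicator {\<alpha>..<1} u * \<sigma> u))"
    unfolding unit_leb_def by (subst integral_restrict_space) auto
  also have "\<dots> = (LBINT u:{\<alpha>..<1}. \<sigma> u)"
    unfolding set_lebesgue_integral_def
    using assms by (intro Bochner_Integration.integral_cong) (auto simp: indicator_def)
  finally show ?thesis ..
qed

lemma expect_nonneg:
  assumes "\<And>\<omega>. \<omega> \<in> space M \<Longrightarrow> 0 \<le> Z \<omega>"
  shows "expect M Z = enn2ereal (\<integral>\<^sup>+\<omega>. e2ennreal (Z \<omega>) \<partial>M)"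
proof -
  have "(\<integral>\<^sup>+\<omega>. e2ennreal (- Z \<omega>) \<partial>M) = (\<integral>\<^sup>+\<omega>. 0 \<partial>M)"
    using assms by (intro nn_integral_cong) (simp add: e2ennreal_neg)
  then show ?thesis by (simp add: expect_def zero_ennreal.rep_eq)
qed

lemma expect_integrable_nonneg:
  assumes "integrable M f" "\<And>\<omega>. \<omega> \<in> space M \<Longrightarrow> 0 \<le> f \<omega>"
  shows "expect M (\<lambda>\<omega>. ereal (f \<omega>)) = ereal (LINT \<omega>|M. f \<omega>)"
proof -
  have "(\<integral>\<^sup>+\<omega>. e2ennreal (ereal (f \<omega>)) \<partial>M) = (\<integral>\<^sup>+\<omega>. ennreal (f \<omega>) \<partial>M)"
    by (simp add: ennreal.abs_eq e2ennreal_def ennreal_def)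
  also have "\<dots> = ennreal (LINT \<omega>|M. f \<omega>)"
    using assms by (intro nn_integral_eq_integral) (auto intro: AE_I2)
  finally show ?thesis
    using assms by (subst expect_nonneg) (auto simp: integral_nonneg)
qed

lemma feasibleD:
  assumes "\<zeta> \<in> feasible \<sigma> M"
  shows "\<zeta> \<in> borel_measurable M" "\<And>\<omega>. \<omega> \<in> space M \<Longrightarrow> 0 \<le> \<zeta> \<omega>"
    and "integrable M \<zeta>" "(LINT \<omega>|M. \<zeta> \<omega>) = 1" "(\<integral>\<^sup>+\<omega>. ennreal (\<zeta> \<omega>) \<partial>M) = 1"
    and "\<And>\<alpha>. \<alpha> \<in> {0<..<1} \<Longrightarrow> AVaR \<alpha> M \<zeta> \<le> ereal (1 / (1 - \<alpha>) * (LBINT u:{\<alpha>..<1}. \<sigma> u))"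
proof -
  show m: "\<zeta> \<in> borel_measurable M" and nonneg: "\<And>\<omega>. \<omega> \<in> space M \<Longrightarrow> 0 \<le> \<zeta> \<omega>"
    and "\<And>\<alpha>. \<alpha> \<in> {0<..<1} \<Longrightarrow> AVaR \<alpha> M \<zeta> \<le> ereal (1 / (1 - \<alpha>) * (LBINT u:{\<alpha>..<1}. \<sigma> u))"
    using assms by (auto simp: feasible_def)
  have "expect M (\<lambda>\<omega>. ereal (\<zeta> \<omega>)) = 1"
    using assms by (simp add: feasible_def)
  moreover have "expect M (\<lambda>\<omega>. ereal (\<zeta> \<omega>)) = enn2ereal (\<integral>\<^sup>+\<omega>. ennreal (\<zeta> \<omega>) \<partial>M)"
    using nonneg by (subst expect_nonneg) (auto simp: e2ennreal_def ennreal_def)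
  ultimately show nn: "(\<integral>\<^sup>+\<omega>. ennreal (\<zeta> \<omega>) \<partial>M) = 1"
    by (metis enn2ereal_inject one_ennreal.rep_eq)
  show "integrable M \<zeta>" "(LINT \<omega>|M. \<zeta> \<omega>) = 1"
    using nn m nonneg by (auto intro!: integrableI_nonneg AE_I2 simp: integral_eq_nn_integral)
qed

lemma AVaR_eq_INF_real:
  assumes "prob_space M" "integrable M f"
  shows "AVaR \<alpha> M f = (INF c::real. ereal (c + 1 / (1 - \<alpha>) * (LINT \<omega>|M. max (f \<omega> - c) 0)))"
proof -
  interpret prob_space M by fact
  have "expect M (\<lambda>\<omega>. ereal (max (f \<omega> - c) 0)) = ereal (LINT \<omega>|M. max (f \<omega> - c) 0)" for c
    using assms(2) by (intro expect_integrable_nonneg) auto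
  then show ?thesis by (simp add: AVaR_def)
qed

text \<open>
  The expectations \<open>E (f - c)\<^sub>+\<close>, as \<open>c\<close> varies, are the stop-loss transform of \<open>f\<close>; the pointwise
  order of the transforms is the stop-loss order of the distributions.  The infimum that defines
  the average value-at-risk is monotone in it.
\<close>

lemma AVaR_mono_stop_loss:
  assumes "prob_space M" "integrable M f" "prob_space N" "integrable N g" "\<alpha> < 1"
    and "\<And>c. (LINT \<omega>|M. max (f \<omega> - c) 0) \<le> (LINT \<omega>|N. max (g \<omega> - c) 0)"
  shows "AVaR \<alpha> M f \<le> AVaR \<alpha> N g"
  unfolding AVaR_eq_INF_real[OF assms(1,2)] AVaR_eq_INF_real[OF assms(3,4)]
  using assms(5,6) by (intro INF_mono') (auto intro!: divide_right_mono)

text \<open>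
  The average value-at-risk dominates the mean over any event of probability \<open>1 - \<alpha>\<close>: for every
  \<open>c\<close>, \<open>E (f - c)\<^sub>+ \<ge> E (f - c) 1\<^sub>A\<close>, and \<open>c (1 - \<alpha>) = E c 1\<^sub>A\<close>.
\<close>

lemma AVaR_upper_tail:
  assumes "prob_space M" "integrable M f" "A \<in> sets M" "measure M A = 1 - \<alpha>" "\<alpha> < 1"
    and "AVaR \<alpha> M f \<le> ereal (1 / (1 - \<alpha>) * b)"
  shows "(LINT \<omega>|M. indicator A \<omega> * f \<omega>) \<le> b"
proof -
  interpret prob_space M by fact
  have int: "integrable M (\<lambda>\<omega>. indicator A \<omega> * f \<omega>)"
    using integrable_mult_indicator[OF assms(3,2)] by simp
  have "ereal (1 / (1 - \<alpha>) * (LINT \<omega>|M. indicator A \<omega> * f \<omega>)) \<le> AVaR \<alpha> M f"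
    unfolding AVaR_eq_INF_real[OF assms(1,2)]
  proof (intro INF_greatest)
    fix c :: real
    have "(LINT \<omega>|M. indicator A \<omega> * f \<omega>) - c * (1 - \<alpha>)
        = (LINT \<omega>|M. indicator A \<omega> * f \<omega> - c * indicator A \<omega>)"
      using int assms(3,4) by (subst Bochner_Integration.integral_diff) (auto simp: emeasure_eq_measure)
    also have "\<dots> \<le> (LINT \<omega>|M. max (f \<omega> - c) 0)"
      using int assms(2,3)
      by (intro integral_mono) (auto simp: emeasure_eq_measure split: split_indicator)
    finally have "((LINT \<omega>|M. indicator A \<omega> * f \<omega>) - c * (1 - \<alpha>)) / (1 - \<alpha>)
        \<le> (LINT \<omega>|M. max (f \<omega> - c) 0) / (1 - \<alpha>)"
      using assms(5) by (intro divide_right_mono) auto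
    then show "ereal (1 / (1 - \<alpha>) * (LINT \<omega>|M. indicator A \<omega> * f \<omega>))
        \<le> ereal (c + 1 / (1 - \<alpha>) * (LINT \<omega>|M. max (f \<omega> - c) 0))"
      using assms(5) by (simp add: diff_divide_distrib)
  qed
  then have "1 / (1 - \<alpha>) * (LINT \<omega>|M. indicator A \<omega> * f \<omega>) \<le> 1 / (1 - \<alpha>) * b"
    using assms(6) by (meson ereal_less_eq(3) order_trans)
  then show ?thesis using assms(5) by (simp add: divide_le_cancel)
qed

text \<open>
  The constraints on a feasible density say that its distribution is below that of \<open>\<sigma>\<close> under the
  uniform law in the stop-loss order.  For given \<open>c\<close>, the constraint at the level \<open>\<alpha>\<close> with
  \<open>1 - \<alpha> = P (\<zeta> > c)\<close> bounds \<open>E \<zeta> 1\<^bsub>{\<zeta> > c}\<^esub>\<close> by \<open>\<integral>\<^sub>\<alpha>\<^sup>1 \<sigma>\<close>, and subtracting \<open>c (1 - \<alpha>)\<close> leaves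
  \<open>E (\<zeta> - c)\<^sub>+ \<le> \<integral>\<^sub>\<alpha>\<^sup>1 (\<sigma> - c)\<close>.
\<close>

lemma feasible_stop_loss:
  assumes "prob_space M" "distortion \<sigma>" "\<zeta> \<in> feasible \<sigma> M"
  shows "(LINT \<omega>|M. max (\<zeta> \<omega> - c) 0) \<le> (LINT u|unit_leb. max (\<sigma> u - c) 0)"
proof -
  interpret prob_space M by fact
  interpret U: prob_space unit_leb by (rule prob_space_unit_leb)
  note \<zeta> = feasibleD[OF assms(3)]
  note \<sigma> = distortion_integral[OF assms(2)]
  have [measurable]: "\<zeta> \<in> borel_measurable M" by (rule \<zeta>(1))
  define A where "A = {\<omega>\<in>space M. c < \<zeta> \<omega>}"
  define \<alpha> where "\<alpha> = 1 - prob A"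
  have A [measurable]: "A \<in> sets M" unfolding A_def by measurable
  have \<alpha>: "prob A = 1 - \<alpha>" "0 \<le> \<alpha>" "\<alpha> \<le> 1" by (auto simp: \<alpha>_def)
  have intA: "integrable M (\<lambda>\<omega>. indicator A \<omega> * \<zeta> \<omega>)"
    using integrable_mult_indicator[OF A \<zeta>(3)] by simp
  have U[measurable]: "{\<alpha>..<1} \<in> sets unit_leb"
    using \<alpha> by (auto simp: unit_leb_def sets_restrict_space image_iff intro!: bexI[of _ "{\<alpha>..<1}"])
  have U': "U.prob {\<alpha>..<1} = 1 - \<alpha>"
    using \<alpha> by (simp add: unit_leb_def measure_restrict_space)
  have intU: "integrable unit_leb (\<lambda>u. indicator {\<alpha>..<1} u * \<sigma> u)"
    using integrable_mult_indicator[OF U \<sigma>(1)] by simp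
  have tail: "(LINT \<omega>|M. indicator A \<omega> * \<zeta> \<omega>) \<le> (LINT u|unit_leb. indicator {\<alpha>..<1} u * \<sigma> u)"
  proof -
    consider "\<alpha> = 0" | "\<alpha> = 1" | "\<alpha> \<in> {0<..<1}" using \<alpha> by fastforce
    then show ?thesis
    proof cases
      case 1
      have "(LINT \<omega>|M. indicator A \<omega> * \<zeta> \<omega>) \<le> (LINT \<omega>|M. \<zeta> \<omega>)"
        using \<zeta> intA by (intro integral_mono) (auto simp: indicator_def)
      also have "\<dots> = (LINT u|unit_leb. \<sigma> u)" using \<zeta> \<sigma> by simp
      also have "\<dots> = (LINT u|unit_leb. indicator {\<alpha>..<1} u * \<sigma> u)"
        using 1 by (intro Bochner_Integration.integral_cong) auto
      finally show ?thesis .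
    next
      case 2
      then have "AE \<omega> in M. \<omega> \<notin> A" using \<alpha>(1) A by (simp add: prob_eq_0)
      then have "(LINT \<omega>|M. indicator A \<omega> * \<zeta> \<omega>) = 0"
        by (intro integral_eq_zero_AE) auto
      then show ?thesis using 2 by simp
    next
      case 3
      then show ?thesis
        using \<zeta>(6)[OF 3] \<zeta>(3) A \<alpha> assms(1)
        by (subst tail_integral_unit_leb[symmetric])
          (auto intro!: AVaR_upper_tail[where \<alpha>=\<alpha>])
    qed
  qed
  have "(LINT \<omega>|M. max (\<zeta> \<omega> - c) 0) = (LINT \<omega>|M. indicator A \<omega> * \<zeta> \<omega> - c * indicator A \<omega>)"
    by (intro Bochner_Integration.integral_cong) (auto simp: A_def indicator_def)
  also have "\<dots> = (LINT \<omega>|M. indicator A \<omega> * \<zeta> \<omega>) - c * (1 - \<alpha>)"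
    using intA \<alpha>(1) by (subst Bochner_Integration.integral_diff) (auto simp: emeasure_eq_measure)
  also have "\<dots> \<le> (LINT u|unit_leb. indicator {\<alpha>..<1} u * \<sigma> u) - c * (1 - \<alpha>)"
    using tail by simp
  also have "\<dots> = (LINT u|unit_leb. indicator {\<alpha>..<1} u * \<sigma> u - c * indicator {\<alpha>..<1} u)"
    using intU U' U
    by (subst Bochner_Integration.integral_diff) (auto simp: U.emeasure_eq_measure max_absorb1 \<alpha>)
  also have "\<dots> \<le> (LINT u|unit_leb. max (\<sigma> u - c) 0)"
    using intU \<sigma>(1) U by (intro integral_mono) (auto simp: U.emeasure_eq_measure split: split_indicator)
  finally show ?thesis .
qed

section \<open>Conditioning a density on a map\<close>

text \<open>
  The function \<open>g\<close> is a version of the conditional expectation of \<open>\<zeta>\<close> given \<open>f\<close>, read as a function of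
  the value of \<open>f\<close>.  It arises as the Radon-Nikodym derivative of the image of \<open>\<zeta> \<mu>\<close> with respect
  to the image of \<open>\<mu>\<close>.  The last property is the conditional Jensen inequality for the functions
  \<open>x \<mapsto> (x - c)\<^sub>+\<close>; it only needs the test set \<open>{g > c}\<close>.
\<close>

lemma pushforward_density:
  fixes \<zeta> :: "'b \<Rightarrow> real"
  assumes "prob_space \<mu>" and f [measurable]: "f \<in> \<mu> \<rightarrow>\<^sub>M X" and \<zeta> [measurable]: "\<zeta> \<in> borel_measurable \<mu>"
    and nonneg: "\<And>\<omega>. \<omega> \<in> space \<mu> \<Longrightarrow> 0 \<le> \<zeta> \<omega>" and one: "(\<integral>\<^sup>+\<omega>. ennreal (\<zeta> \<omega>) \<partial>\<mu>) = 1"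
  obtains g :: "'c \<Rightarrow> real" where "g \<in> borel_measurable X" "\<And>x. 0 \<le> g x"
    and "\<And>\<phi>. \<phi> \<in> borel_measurable X \<Longrightarrow>
      (\<integral>\<^sup>+x. \<phi> x * ennreal (g x) \<partial>distr \<mu> X f) = (\<integral>\<^sup>+\<omega>. \<phi> (f \<omega>) * ennreal (\<zeta> \<omega>) \<partial>\<mu>)"
    and "\<And>c. (LINT x|distr \<mu> X f. max (g x - c) 0) \<le> (LINT \<omega>|\<mu>. max (\<zeta> \<omega> - c) 0)"
proof -
  interpret prob_space \<mu> by fact
  define m where "m = distr \<mu> X f"
  define N where "N = distr (density \<mu> (\<lambda>\<omega>. ennreal (\<zeta> \<omega>))) X f"
  interpret m: prob_space m unfolding m_def by (rule prob_space_distr) fact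
  have sets_m [measurable_cong]: "sets m = sets X" by (simp add: m_def)
  have sets_N: "sets N = sets m" by (simp add: N_def m_def)
  have ac: "absolutely_continuous m N"
    unfolding absolutely_continuous_def
  proof
    fix A assume "A \<in> null_sets m"
    then have A [measurable]: "A \<in> sets X" and "f -` A \<inter> space \<mu> \<in> null_sets \<mu>"
      by (auto simp: m_def null_sets_def emeasure_distr)
    then have "f -` A \<inter> space \<mu> \<in> null_sets (density \<mu> (\<lambda>\<omega>. ennreal (\<zeta> \<omega>)))"
      using absolutely_continuousI_density[of "\<lambda>\<omega>. ennreal (\<zeta> \<omega>)" \<mu>]
      by (auto simp: absolutely_continuous_def)
    then show "A \<in> null_sets N"
      unfolding N_def null_sets_def by (auto simp: emeasure_distr)
  qed
  define h where "h = RN_deriv m N"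
  have h [measurable]: "h \<in> borel_measurable X" using borel_measurable_RN_deriv[of m N] by (simp add: h_def)
  have dens: "density m h = N"
    unfolding h_def by (rule m.density_RN_deriv[OF ac sets_N])
  have int_h: "(\<integral>\<^sup>+x. h x * \<phi> x \<partial>m) = (\<integral>\<^sup>+\<omega>. \<phi> (f \<omega>) * ennreal (\<zeta> \<omega>) \<partial>\<mu>)"
    if [measurable]: "\<phi> \<in> borel_measurable X" for \<phi>
  proof -
    have "(\<integral>\<^sup>+x. h x * \<phi> x \<partial>m) = (\<integral>\<^sup>+x. \<phi> x \<partial>N)"
      by (subst dens[symmetric], subst nn_integral_density) auto
    also have "\<dots> = (\<integral>\<^sup>+\<omega>. \<phi> (f \<omega>) * ennreal (\<zeta> \<omega>) \<partial>\<mu>)"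
      unfolding N_def by (subst nn_integral_distr, simp, simp, subst nn_integral_density) (auto simp: mult.commute)
    finally show ?thesis .
  qed
  have "AE x in m. h x \<noteq> \<infinity>"
    using int_h[of "\<lambda>_. 1"] one by (intro nn_integral_PInf_AE) (auto simp: h)
  then have hg: "AE x in m. h x = ennreal (enn2real (h x))"
    by eventually_elim (simp add: less_top)
  define g where "g x = enn2real (h x)" for x
  have g [measurable]: "g \<in> borel_measurable X" unfolding g_def by measurable
  have int_g: "(\<integral>\<^sup>+x. \<phi> x * ennreal (g x) \<partial>m) = (\<integral>\<^sup>+\<omega>. \<phi> (f \<omega>) * ennreal (\<zeta> \<omega>) \<partial>\<mu>)"
    if [measurable]: "\<phi> \<in> borel_measurable X" for \<phi>
    unfolding int_h[OF that, symmetric]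
    using hg by (intro nn_integral_cong_AE) (auto simp: g_def mult.commute)
  have intg_\<zeta>: "integrable \<mu> \<zeta>"
    using one nonneg by (intro integrableI_nonneg) auto
  have intg_g: "integrable m g"
    using int_g[of "\<lambda>_. 1"] one by (intro integrableI_nonneg) (auto simp: g_def)
  have "(LINT x|m. max (g x - c) 0) \<le> (LINT \<omega>|\<mu>. max (\<zeta> \<omega> - c) 0)" for c
  proof -
    define B where "B = {x\<in>space X. c < g x}"
    have B [measurable]: "B \<in> sets X" unfolding B_def by measurable
    have intB: "integrable m (\<lambda>x. indicator B x * g x)"
      using integrable_mult_indicator[OF _ intg_g, of B] by (simp add: sets_m)
    have intB': "integrable \<mu> (\<lambda>\<omega>. indicator B (f \<omega>) * \<zeta> \<omega>)"
      using integrable_mult_indicator[OF _ intg_\<zeta>, of "f -` B \<inter> space \<mu>"]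
      by (rule Bochner_Integration.integrable_cong[THEN iffD1, rotated -1]) (auto split: split_indicator)
    have "(LINT x|m. indicator B x * g x) = enn2real (\<integral>\<^sup>+x. indicator B x * ennreal (g x) \<partial>m)"
      by (subst integral_eq_nn_integral)
        (auto simp: g_def ennreal_mult' ennreal_indicator)
    also have "\<dots> = enn2real (\<integral>\<^sup>+\<omega>. indicator B (f \<omega>) * ennreal (\<zeta> \<omega>) \<partial>\<mu>)"
      by (subst int_g) auto
    also have "\<dots> = (LINT \<omega>|\<mu>. indicator B (f \<omega>) * \<zeta> \<omega>)"
      using nonneg by (subst integral_eq_nn_integral) (auto simp: ennreal_mult' ennreal_indicator)
    finally have eq: "(LINT x|m. indicator B x * g x) = (LINT \<omega>|\<mu>. indicator B (f \<omega>) * \<zeta> \<omega>)" .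
    have eq': "(LINT x|m. c * indicator B x) = (LINT \<omega>|\<mu>. c * indicator B (f \<omega>))"
      unfolding m_def by (subst integral_distr) auto
    have indf: "integrable \<mu> (\<lambda>\<omega>. c * indicator B (f \<omega>))"
      by (intro integrable_const_bound[where B="\<bar>c\<bar>"]) (auto split: split_indicator)
    have "(LINT x|m. max (g x - c) 0) = (LINT x|m. indicator B x * g x - c * indicator B x)"
      by (intro Bochner_Integration.integral_cong) (auto simp: B_def m_def split: split_indicator)
    also have "\<dots> = (LINT x|m. indicator B x * g x) - (LINT x|m. c * indicator B x)"
      using intB by (subst Bochner_Integration.integral_diff) (auto simp: m.emeasure_eq_measure sets_m)
    also have "\<dots> = (LINT \<omega>|\<mu>. indicator B (f \<omega>) * \<zeta> \<omega> - c * indicator B (f \<omega>))"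
      unfolding eq eq' using intB' indf by (subst Bochner_Integration.integral_diff) auto
    also have "\<dots> \<le> (LINT \<omega>|\<mu>. max (\<zeta> \<omega> - c) 0)"
      using intB' indf intg_\<zeta> by (intro integral_mono) (auto split: split_indicator)
    finally show ?thesis .
  qed
  with that[of g] g int_g show ?thesis by (auto simp: g_def m_def)
qed

section \<open>Moments of densities that are dominated by a distortion function\<close>

text \<open>
  Taylor's formula with integral remainder for \<open>x \<mapsto> x\<^sup>q\<close> at the point \<open>0\<close>: a power with exponent above
  one is a mixture of the functions \<open>x \<mapsto> (x - c)\<^sub>+\<close> with the nonnegative weight
  \<open>q (q - 1) c\<^sup>q\<^sup>-\<^sup>2\<close>.
\<close>

lemma powr_eq_stop_loss_integral:
  fixes a q :: real
  assumes "0 \<le> a" "1 < q"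
  shows "ennreal (a powr q) =
    (\<integral>\<^sup>+c. ennreal (max (a - c) 0) * (ennreal (q * (q - 1) * c powr (q - 2)) * indicator {0<..} c) \<partial>lborel)"
proof -
  \<comment> \<open>An antiderivative of the integrand on \<open>{0..a}\<close>; its derivative need not exist at \<open>0\<close> when \<open>q < 2\<close>.\<close>
  define G where "G c = q * a * c powr (q - 1) - (q - 1) * c powr q" for c :: real
  have "((\<lambda>c. (a - c) * (q * (q - 1) * c powr (q - 2))) has_integral (G a - G 0)) {0..a}"
  proof (rule fundamental_theorem_of_calculus_interior)
    show "continuous_on {0..a} G"
      unfolding G_def using assms by (auto intro!: continuous_intros continuous_on_powr')
    show "(G has_vector_derivative (a - c) * (q * (q - 1) * c powr (q - 2))) (at c)"
      if "c \<in> {0<..<a}" for c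
    proof -
      have c: "0 < c" using that by simp
      have "c powr (q - 1) = c * c powr (q - 2)"
        using c by (simp add: powr_mult_base algebra_simps)
      moreover have "c powr q = c * c * c powr (q - 2)"
        using c powr_add[of c 2 "q - 2"] by (simp add: power2_eq_square)
      moreover have "((\<lambda>c. c powr (q - 1)) has_real_derivative (q - 1) * c powr (q - 2)) (at c)"
        using has_real_derivative_powr[OF c, of "q - 1"] by simp
      then have "(G has_real_derivative q * a * ((q - 1) * c powr (q - 2)) - (q - 1) * (q * c powr (q - 1))) (at c)"
        unfolding G_def using has_real_derivative_powr[OF c, of q]
        by (intro DERIV_diff DERIV_cmult)
      ultimately show ?thesis
        unfolding has_real_derivative_iff_has_vector_derivative[symmetric]
        by (simp add: algebra_simps)
    qed
  qed (use assms in auto)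
  moreover have "G a - G 0 = a powr q"
    using assms by (cases "a = 0") (auto simp: G_def powr_mult_base algebra_simps)
  ultimately have "((\<lambda>c. (a - c) * (q * (q - 1) * c powr (q - 2))) has_integral a powr q) {0..a}"
    by simp
  then have "(\<integral>\<^sup>+c. ennreal (indicator {0..a} c * ((a - c) * (q * (q - 1) * c powr (q - 2)))) \<partial>lborel) = ennreal (a powr q)"
    using assms by (intro nn_integral_has_integral_lebesgue) auto
  moreover have "ennreal (indicator {0..a} c * ((a - c) * (q * (q - 1) * c powr (q - 2))))
      = ennreal (max (a - c) 0) * (ennreal (q * (q - 1) * c powr (q - 2)) * indicator {0<..} c)" for c
    using assms by (cases "c = 0") (auto simp: ennreal_mult'[symmetric] max_def split: split_indicator)
  ultimately show ?thesis by simp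
qed

lemma moment_eq_stop_loss_integral:
  assumes "prob_space m" and [measurable]: "g \<in> borel_measurable m" and "\<And>x. x \<in> space m \<Longrightarrow> 0 \<le> g x" "1 < q"
  shows "(\<integral>\<^sup>+x. ennreal (g x powr q) \<partial>m) =
    (\<integral>\<^sup>+c. (\<integral>\<^sup>+x. ennreal (max (g x - c) 0) \<partial>m) * (ennreal (q * (q - 1) * c powr (q - 2)) * indicator {0<..} c) \<partial>lborel)"
proof -
  interpret prob_space m by fact
  interpret pair_sigma_finite m lborel ..
  have "(\<integral>\<^sup>+x. ennreal (g x powr q) \<partial>m) =
      (\<integral>\<^sup>+x. \<integral>\<^sup>+c. ennreal (max (g x - c) 0) * (ennreal (q * (q - 1) * c powr (q - 2)) * indicator {0<..} c) \<partial>lborel \<partial>m)"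
    using assms by (intro nn_integral_cong powr_eq_stop_loss_integral) auto
  also have "\<dots> = (\<integral>\<^sup>+c. \<integral>\<^sup>+x. ennreal (max (g x - c) 0) * (ennreal (q * (q - 1) * c powr (q - 2)) * indicator {0<..} c) \<partial>m \<partial>lborel)"
    by (rule Fubini'[symmetric]) measurable
  also have "\<dots> = (\<integral>\<^sup>+c. (\<integral>\<^sup>+x. ennreal (max (g x - c) 0) \<partial>m) * (ennreal (q * (q - 1) * c powr (q - 2)) * indicator {0<..} c) \<partial>lborel)"
    by (intro nn_integral_cong nn_integral_multc) measurable
  finally show ?thesis .
qed

text \<open>
  Integrating the power representation and exchanging the integrals expresses the moment by the
  stop-loss transform, so that the stop-loss order is inherited by the moments.
\<close>

lemma moment_le_of_stop_loss:
  assumes "prob_space m" "integrable m g" "\<And>x. x \<in> space m \<Longrightarrow> 0 \<le> g x"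
    and "prob_space n" "integrable n h" "\<And>y. y \<in> space n \<Longrightarrow> 0 \<le> h y"
    and "\<And>c. (LINT x|m. max (g x - c) 0) \<le> (LINT y|n. max (h y - c) 0)" and "1 < q"
  shows "(\<integral>\<^sup>+x. ennreal (g x powr q) \<partial>m) \<le> (\<integral>\<^sup>+y. ennreal (h y powr q) \<partial>n)"
proof -
  interpret m: prob_space m by fact
  interpret n: prob_space n by fact
  have [measurable]: "g \<in> borel_measurable m" "h \<in> borel_measurable n" using assms by auto
  have "(\<integral>\<^sup>+x. ennreal (max (g x - c) 0) \<partial>m) \<le> (\<integral>\<^sup>+y. ennreal (max (h y - c) 0) \<partial>n)" for c
    using assms(7)[of c] assms(2,5)
    by (subst (1 2) nn_integral_eq_integral) (auto intro!: ennreal_leI)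
  then show ?thesis
    using assms by (subst (1 2) moment_eq_stop_loss_integral) (auto intro!: nn_integral_mono mult_right_mono)
qed

lemma distortion_nonneg: "distortion \<sigma> \<Longrightarrow> u \<in> {0..<1} \<Longrightarrow> 0 \<le> \<sigma> u"
  by (simp add: distortion_def)

lemma Lq_norm_infinity_AE:
  assumes "distortion \<sigma>" "Lq_norm \<infinity> \<sigma> \<noteq> \<infinity>"
  shows "AE u in unit_leb. \<sigma> u \<le> enn2real (Lq_norm \<infinity> \<sigma>)"
proof -
  have "AE u in unit_leb. ennreal \<bar>\<sigma> u\<bar> \<le> Lq_norm \<infinity> \<sigma>"
    unfolding Lq_norm_def by (simp add: esssup_AE)
  then show ?thesis
  proof eventually_elim
    case (elim u)
    then have "\<bar>\<sigma> u\<bar> \<le> enn2real (Lq_norm \<infinity> \<sigma>)"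
      using enn2real_mono[OF elim] assms(2) by (simp add: less_top)
    then show ?case by simp
  qed
qed

lemma Lq_norm_real:
  assumes "distortion \<sigma>" "0 < q"
  shows "Lq_norm (ennreal q) \<sigma> = epowr (\<integral>\<^sup>+u. ennreal (\<sigma> u powr q) \<partial>unit_leb) (1 / q)"
  using assms by (auto simp: Lq_norm_def distortion_nonneg intro!: arg_cong2[where f=epowr] nn_integral_cong)

lemma Lq_norm_pos:
  assumes "distortion \<sigma>" "0 < q"
  shows "0 < Lq_norm q \<sigma>"
proof (rule ccontr)
  have [measurable]: "\<sigma> \<in> borel_measurable unit_leb" by (rule distortion_measurable) fact
  assume "\<not> 0 < Lq_norm q \<sigma>"
  then have 0: "Lq_norm q \<sigma> = 0" by (simp add: zero_less_iff_neq_zero)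
  have "AE u in unit_leb. \<sigma> u \<le> 0"
  proof (cases "q = \<infinity>")
    case True
    then show ?thesis using Lq_norm_infinity_AE[OF assms(1)] 0 by simp
  next
    case False
    then obtain p where p: "q = ennreal p" "0 < p" using assms(2) by (cases q) auto
    then have "(\<integral>\<^sup>+u. ennreal (\<sigma> u powr p) \<partial>unit_leb) = 0"
      using 0 Lq_norm_real[OF assms(1) p(2)] by (simp add: epowr_eq_0_iff)
    then have "AE u in unit_leb. ennreal (\<sigma> u powr p) = 0"
      by (subst (asm) nn_integral_0_iff_AE) auto
    then show ?thesis by eventually_elim (auto simp: ennreal_eq_0_iff powr_def split: if_splits)
  qed
  then have "(\<integral>\<^sup>+u. ennreal (\<sigma> u) \<partial>unit_leb) = (\<integral>\<^sup>+u. 0 \<partial>unit_leb)"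
    by (intro nn_integral_cong_AE) (auto simp: ennreal_neg)
  then show False using assms(1) by (simp add: distortion_def)
qed

text \<open>
  This is the counterpart of the moment comparison for the exponent infinity: the stop-loss
  transform of \<open>\<sigma>\<close> vanishes at an essential upper bound.
\<close>

lemma bounded_of_stop_loss:
  assumes "prob_space m" "integrable m g" "distortion \<sigma>" "AE u in unit_leb. \<sigma> u \<le> s"
    and "\<And>c. (LINT x|m. max (g x - c) 0) \<le> (LINT u|unit_leb. max (\<sigma> u - c) 0)"
  shows "AE x in m. g x \<le> s"
proof -
  interpret prob_space m by fact
  have "(LINT u|unit_leb. max (\<sigma> u - s) 0) = 0"
    using assms(4) by (intro integral_eq_zero_AE) auto
  then have "(LINT x|m. max (g x - s) 0) = 0"
    using assms(5)[of s] by (intro antisym) (auto intro!: integral_nonneg)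
  then have "AE x in m. max (g x - s) 0 = 0"
    using assms(2) by (subst (asm) integral_nonneg_eq_0_iff_AE) auto
  then show ?thesis by eventually_elim (auto simp: max_def split: if_splits)
qed

section \<open>The inequalities of Hoelder and Jensen\<close>

text \<open>
  Bookkeeping for the next estimate: the integrals of \<open>x\<close> and \<open>y\<close> are inserted in a pointwise
  affine bound.
\<close>

lemma nn_integral_le_of_affine_bound:
  assumes "prob_space M" "0 \<le> k" "0 \<le> a" "0 \<le> b" "0 \<le> e" "0 \<le> X" "0 \<le> Y"
    and [measurable]: "x \<in> borel_measurable M" "y \<in> borel_measurable M"
    and "\<And>z. 0 \<le> x z" "\<And>z. 0 \<le> y z"
    and "AE z in M. f z \<le> k * (a * x z + b * y z + e)"
    and "(\<integral>\<^sup>+z. ennreal (x z) \<partial>M) \<le> ennreal X" "(\<integral>\<^sup>+z. ennreal (y z) \<partial>M) \<le> ennreal Y"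
  shows "(\<integral>\<^sup>+z. ennreal (f z) \<partial>M) \<le> ennreal (k * (a * X + b * Y + e))"
proof -
  interpret prob_space M by fact
  have "(\<integral>\<^sup>+z. ennreal (f z) \<partial>M)
      \<le> (\<integral>\<^sup>+z. ennreal k * (ennreal a * ennreal (x z) + ennreal b * ennreal (y z) + ennreal e) \<partial>M)"
    using assms(12) by (intro nn_integral_mono_AE, eventually_elim)
      (use assms in \<open>auto simp flip: ennreal_mult ennreal_plus intro!: ennreal_leI\<close>)
  also have "\<dots> = ennreal k * (ennreal a * (\<integral>\<^sup>+z. ennreal (x z) \<partial>M) + ennreal b * (\<integral>\<^sup>+z. ennreal (y z) \<partial>M) + ennreal e)"
    by (simp add: nn_integral_cmult nn_integral_add emeasure_space_1)
  also have "\<dots> \<le> ennreal k * (ennreal a * ennreal X + ennreal b * ennreal Y + ennreal e)"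
    using assms(13,14) by (intro mult_left_mono add_mono) auto
  also have "\<dots> = ennreal (k * (a * X + b * Y + e))"
    using assms by (simp flip: ennreal_mult ennreal_plus)
  finally show ?thesis .
qed

lemma powr_le_affine:
  fixes t \<beta> :: real
  assumes "0 \<le> t" "0 < \<beta>" "\<beta> \<le> 1"
  shows "t powr \<beta> \<le> \<beta> * t + (1 - \<beta>)"
  using Youngs_inequality_0[of \<beta> "1 - \<beta>" t 1] assms by (cases "t = 0") auto

text \<open>
  Hoelder's inequality for \<open>g\<close> and \<open>w\<^sup>\<beta>\<close>, combined with Jensen's inequality
  \<open>\<parallel>w\<^sup>\<beta>\<parallel>\<^sub>r \<le> \<parallel>w\<parallel>\<^sub>r\<^sup>\<beta>\<close>.  After normalising \<open>g\<close> by \<open>s\<close> and \<open>w\<close> by its norm, both follow from one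
  pointwise inequality: Young's inequality, with \<open>t\<^sup>\<beta> \<le> \<beta> t + (1 - \<beta>)\<close> applied to the power of
  \<open>w\<close>.
\<close>

lemma weighted_power_bound:
  fixes g w :: "'b \<Rightarrow> real"
  assumes "prob_space M" and [measurable]: "g \<in> borel_measurable M" "w \<in> borel_measurable M"
    and g: "\<And>z. z \<in> space M \<Longrightarrow> 0 \<le> g z" and w: "\<And>z. 0 \<le> w z"
    and "1 \<le> r" "0 < \<beta>" "\<beta> \<le> 1" "0 < s"
    and conj: "(r = 1 \<and> (AE z in M. g z \<le> s)) \<or>
      (1 < p \<and> 1 / r + 1 / p = 1 \<and> (\<integral>\<^sup>+z. ennreal (g z powr p) \<partial>M) \<le> ennreal (s powr p))"
  shows "(\<integral>\<^sup>+z. ennreal (g z * w z powr \<beta>) \<partial>M)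
    \<le> ennreal s * epowr (epowr (\<integral>\<^sup>+z. ennreal (w z powr r) \<partial>M) (1 / r)) \<beta>"
proof -
  interpret prob_space M by fact
  consider (inf) "(\<integral>\<^sup>+z. ennreal (w z powr r) \<partial>M) = \<infinity>" | (zero) "(\<integral>\<^sup>+z. ennreal (w z powr r) \<partial>M) = 0"
    | (pos) i where "0 < i" "(\<integral>\<^sup>+z. ennreal (w z powr r) \<partial>M) = ennreal i"
    by (cases "\<integral>\<^sup>+z. ennreal (w z powr r) \<partial>M") (auto simp: le_less)
  then show ?thesis
  proof cases
    case inf
    then show ?thesis using assms by (simp add: ennreal_mult_top)
  next
    case zero
    then have "AE z in M. ennreal (w z powr r) = 0"
      by (subst (asm) nn_integral_0_iff_AE) auto
    then have "AE z in M. ennreal (g z * w z powr \<beta>) = 0"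
      by eventually_elim (auto simp: ennreal_eq_0_iff powr_def split: if_splits)
    then have "(\<integral>\<^sup>+z. ennreal (g z * w z powr \<beta>) \<partial>M) = (\<integral>\<^sup>+z. 0 \<partial>M)"
      by (intro nn_integral_cong_AE)
    then show ?thesis by simp
  next
    case pos
    define W where "W = i powr (1 / r)"
    have W: "0 < W" "W powr r = i" using pos assms by (auto simp: W_def powr_powr)
    have w_eq: "w z powr \<beta> = W powr \<beta> * (w z / W) powr \<beta>" for z
      using W w[of z] by (simp add: powr_divide)
    have wr: "(w z / W) powr r = w z powr r / i" for z
      using W w[of z] by (simp add: powr_divide)
    have "(\<integral>\<^sup>+z. ennreal (g z * w z powr \<beta>) \<partial>M) \<le> ennreal (s * W powr \<beta>)"
      using conj
    proof (elim disjE conjE)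
      assume r: "r = 1" and bd: "AE z in M. g z \<le> s"
      have "AE z in M. g z * w z powr \<beta> \<le> s * W powr \<beta> * (0 * 0 + \<beta> / W * w z + (1 - \<beta>))"
        using bd AE_space
      proof eventually_elim
        case (elim z)
        have "g z * w z powr \<beta> \<le> s * (W powr \<beta> * (w z / W) powr \<beta>)"
          unfolding w_eq using elim by (intro mult_right_mono) auto
        also have "\<dots> \<le> s * (W powr \<beta> * (\<beta> * (w z / W) + (1 - \<beta>)))"
          using powr_le_affine[of "w z / W" \<beta>] assms W by (intro mult_left_mono) auto
        finally show ?case by (simp add: mult.assoc)
      qed
      from nn_integral_le_of_affine_bound[OF assms(1) _ _ _ _ _ _ _ _ _ _ this, of 0 i] pos r assms W
      show ?thesis by (simp add: mult.commute)
    next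
      assume p: "1 < p" "1 / r + 1 / p = 1" and gp: "(\<integral>\<^sup>+z. ennreal (g z powr p) \<partial>M) \<le> ennreal (s powr p)"
      have r: "1 < r" using p assms(6) by (cases "r = 1") auto
      have "AE z in M. g z * w z powr \<beta> \<le> s * W powr \<beta> * (1 / (p * s powr p) * g z powr p + \<beta> / (r * i) * w z powr r + (1 - \<beta>) / r)"
        using AE_space
      proof eventually_elim
        case (elim z)
        have "g z / s * (w z / W) powr \<beta> \<le> (g z / s) powr p / p + ((w z / W) powr \<beta>) powr r / r"
          using p r g[OF elim] assms by (intro Youngs_inequality) (auto simp: add.commute)
        also have "((w z / W) powr \<beta>) powr r = (w z powr r / i) powr \<beta>"
          unfolding wr[symmetric] by (simp add: powr_powr mult.commute)
        also have "\<dots> \<le> \<beta> * (w z powr r / i) + (1 - \<beta>)"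
          using assms pos by (intro powr_le_affine) auto
        finally have "s * W powr \<beta> * (g z / s * (w z / W) powr \<beta>)
            \<le> s * W powr \<beta> * ((g z / s) powr p / p + (\<beta> * (w z powr r / i) + (1 - \<beta>)) / r)"
          using assms W r by (intro mult_left_mono) (auto simp: divide_right_mono)
        also have "s * W powr \<beta> * (g z / s * (w z / W) powr \<beta>) = g z * w z powr \<beta>"
          unfolding w_eq using assms by simp
        also have "(g z / s) powr p / p + (\<beta> * (w z powr r / i) + (1 - \<beta>)) / r
            = 1 / (p * s powr p) * g z powr p + \<beta> / (r * i) * w z powr r + (1 - \<beta>) / r"
          using g[OF elim] assms by (simp add: powr_divide add_divide_distrib mult.commute)
        finally show ?case .
      qed
      from nn_integral_le_of_affine_bound[OF assms(1) _ _ _ _ _ _ _ _ _ _ this gp, of i]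
      have "(\<integral>\<^sup>+z. ennreal (g z * w z powr \<beta>) \<partial>M) \<le>
          ennreal (s * W powr \<beta> * (1 / (p * s powr p) * s powr p + \<beta> / (r * i) * i + (1 - \<beta>) / r))"
        using pos p r assms W by simp
      also have "1 / (p * s powr p) * s powr p + \<beta> / (r * i) * i + (1 - \<beta>) / r = 1"
        using pos p r assms by (simp add: diff_divide_distrib)
      finally show ?thesis by simp
    qed
    then show ?thesis
      using pos assms W by (simp add: W_def ennreal_mult)
  qed
qed

section \<open>Risk functionals of coupled laws\<close>

lemma e2ennreal_mult_ereal: "0 \<le> b \<Longrightarrow> e2ennreal (a * ereal b) = e2ennreal a * ennreal b"
proof (cases "0 \<le> a")
  case True
  assume "0 \<le> b"
  with True show ?thesis
    by (cases a; cases "b = 0") (auto simp: ennreal_mult ennreal_top_mult)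
next
  case False
  assume b: "0 \<le> b"
  with False have "a * ereal b \<le> 0" by (simp add: ereal_mult_le_0_iff)
  with False show ?thesis by (simp add: e2ennreal_neg)
qed

text \<open>
  The numbers \<open>a\<close>, \<open>a'\<close> and \<open>b\<close>, \<open>b'\<close> will be the integrals of the positive and negative parts of
  two random variables.  The negative parts may have infinite integrals.
\<close>

lemma ereal_diff_le_of_sum_le:
  assumes "a \<noteq> \<infinity>" "b \<noteq> \<infinity>" "a + b' \<le> b + a' + e"
  shows "enn2ereal a - enn2ereal a' \<le> enn2ereal b - enn2ereal b' + enn2ereal e"
proof (cases "e = \<infinity>")
  case True
  then show ?thesis using assms(1) by (cases b; cases b') auto
next
  case False
  then show ?thesis
    using assms by (cases a; cases b; cases a'; cases b'; cases e)
      (auto simp flip: ennreal_plus simp: top_unique enn2ereal_ennreal)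
qed

lemma expect_weighted:
  assumes "\<And>\<omega>. \<omega> \<in> space \<mu> \<Longrightarrow> 0 \<le> \<zeta> \<omega>"
  shows "expect \<mu> (\<lambda>\<omega>. Z \<omega> * ereal (\<zeta> \<omega>)) =
    enn2ereal (\<integral>\<^sup>+\<omega>. e2ennreal (Z \<omega>) * ennreal (\<zeta> \<omega>) \<partial>\<mu>) - enn2ereal (\<integral>\<^sup>+\<omega>. e2ennreal (- Z \<omega>) * ennreal (\<zeta> \<omega>) \<partial>\<mu>)"
proof -
  have "(\<integral>\<^sup>+\<omega>. e2ennreal (Z \<omega> * ereal (\<zeta> \<omega>)) \<partial>\<mu>) = (\<integral>\<^sup>+\<omega>. e2ennreal (Z \<omega>) * ennreal (\<zeta> \<omega>) \<partial>\<mu>)"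
    and "(\<integral>\<^sup>+\<omega>. e2ennreal (- (Z \<omega> * ereal (\<zeta> \<omega>))) \<partial>\<mu>) = (\<integral>\<^sup>+\<omega>. e2ennreal (- Z \<omega>) * ennreal (\<zeta> \<omega>) \<partial>\<mu>)"
    using assms e2ennreal_mult_ereal[of _ "- Z _"]
    by (auto intro!: nn_integral_cong simp: e2ennreal_mult_ereal simp flip: ereal_mult_minus_left)
  then show ?thesis by (simp add: expect_def)
qed

text \<open>
  Feasibility depends on the density only through its stop-loss transform, so a density with a
  smaller transform, even on another probability space, stays feasible.
\<close>

lemma feasible_of_stop_loss:
  assumes "prob_space N" "prob_space M" "\<zeta> \<in> feasible \<sigma> M"
    and "\<zeta>' \<in> borel_measurable N" "\<And>\<omega>. \<omega> \<in> space N \<Longrightarrow> 0 \<le> \<zeta>' \<omega>" "(\<integral>\<^sup>+\<omega>. ennreal (\<zeta>' \<omega>) \<partial>N) = 1"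
    and "\<And>c. (LINT \<omega>|N. max (\<zeta>' \<omega> - c) 0) \<le> (LINT \<omega>|M. max (\<zeta> \<omega> - c) 0)"
  shows "\<zeta>' \<in> feasible \<sigma> N"
proof -
  note \<zeta> = feasibleD[OF assms(3)]
  have int: "integrable N \<zeta>'" using assms by (intro integrableI_nonneg) auto
  have "expect N (\<lambda>\<omega>. ereal (\<zeta>' \<omega>)) = 1"
    using expect_integrable_nonneg[OF int assms(5)] assms(4-6) by (simp add: integral_eq_nn_integral)
  moreover have "AVaR \<alpha> N \<zeta>' \<le> ereal (1 / (1 - \<alpha>) * (LBINT u:{\<alpha>..<1}. \<sigma> u))" if "\<alpha> \<in> {0<..<1}" for \<alpha>
    using AVaR_mono_stop_loss[OF assms(1) int assms(2) \<zeta>(3) _ assms(7), of \<alpha>] \<zeta>(6)[OF that] that by force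
  ultimately show ?thesis using assms(4,5) by (auto simp: feasible_def)
qed

text \<open>
  A feasible density \<open>\<zeta>\<close> for \<open>\<mu>\<close> is carried over to \<open>\<nu>\<close> through the coupling \<open>\<pi>\<close>: it is first
  conditioned on \<open>p\<close>, which gives \<open>g\<close>, then \<open>g \<circ> U\<close> is conditioned on \<open>V\<close>, which gives \<open>h\<close>, and
  \<open>h \<circ> p'\<close> is a density for \<open>\<nu>\<close>.  Conditioning decreases the stop-loss transform, hence the new
  density is feasible.  The two weighted expectations are integrals of \<open>F \<circ> U\<close> and \<open>F' \<circ> V\<close> against
  the same measure \<open>(g \<circ> U) \<pi>\<close>, so they differ by at most the integral of \<open>\<bar>F \<circ> U - F' \<circ> V\<bar>\<close>.
  That neither risk is \<open>\<infinity>\<close> excludes undefined expectations, whose value is \<open>\<infinity>\<close> by convention.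
\<close>

lemma risk_coupling:
  fixes F :: "'b \<Rightarrow> ereal" and F' :: "'c \<Rightarrow> ereal"
  assumes "prob_space \<mu>" "prob_space \<nu>"
    and p [measurable]: "p \<in> \<mu> \<rightarrow>\<^sub>M X" "p' \<in> \<nu> \<rightarrow>\<^sub>M X'"
    and F [measurable]: "F \<in> borel_measurable X" "F' \<in> borel_measurable X'"
    and U [measurable]: "U \<in> \<pi> \<rightarrow>\<^sub>M X" "V \<in> \<pi> \<rightarrow>\<^sub>M X'"
    and marg: "distr \<pi> X U = distr \<mu> X p" "distr \<pi> X' V = distr \<nu> X' p'"
    and fin: "AE z in \<pi>. \<bar>F (U z)\<bar> \<noteq> \<infinity>" "AE z in \<pi>. \<bar>F' (V z)\<bar> \<noteq> \<infinity>"
    and "risk \<sigma> \<mu> (\<lambda>\<omega>. F (p \<omega>)) \<noteq> \<infinity>" "risk \<sigma> \<nu> (\<lambda>\<omega>. F' (p' \<omega>)) \<noteq> \<infinity>"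
    and "distortion \<sigma>"
    and \<delta>: "\<And>g. g \<in> borel_measurable X \<Longrightarrow> (\<And>x. 0 \<le> g x) \<Longrightarrow> integrable (distr \<mu> X p) g \<Longrightarrow>
      (\<And>c. (LINT x|distr \<mu> X p. max (g x - c) 0) \<le> (LINT u|unit_leb. max (\<sigma> u - c) 0)) \<Longrightarrow>
      (\<integral>\<^sup>+z. e2ennreal \<bar>F (U z) - F' (V z)\<bar> * ennreal (g (U z)) \<partial>\<pi>) \<le> \<delta>"
  shows "risk \<sigma> \<mu> (\<lambda>\<omega>. F (p \<omega>)) \<le> risk \<sigma> \<nu> (\<lambda>\<omega>. F' (p' \<omega>)) + enn2ereal \<delta>"
proof -
  interpret \<mu>: prob_space \<mu> by fact
  interpret \<nu>: prob_space \<nu> by fact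
  have "prob_space (distr \<pi> X U)" unfolding marg by (rule \<mu>.prob_space_distr) fact
  then have \<pi>: "prob_space \<pi>" by (rule prob_space_distrD[rotated]) fact
  have "expect \<mu> (\<lambda>\<omega>. F (p \<omega>) * ereal (\<zeta> \<omega>)) \<le> risk \<sigma> \<nu> (\<lambda>\<omega>. F' (p' \<omega>)) + enn2ereal \<delta>"
    if feas: "\<zeta> \<in> feasible \<sigma> \<mu>" for \<zeta>
  proof -
    note \<zeta> = feasibleD[OF feas]
    obtain g where g [measurable]: "g \<in> borel_measurable X" and g0: "\<And>x. 0 \<le> g x"
      and int_g: "\<And>\<phi>. \<phi> \<in> borel_measurable X \<Longrightarrow>
        (\<integral>\<^sup>+x. \<phi> x * ennreal (g x) \<partial>distr \<mu> X p) = (\<integral>\<^sup>+\<omega>. \<phi> (p \<omega>) * ennreal (\<zeta> \<omega>) \<partial>\<mu>)"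
      and sl_g: "\<And>c. (LINT x|distr \<mu> X p. max (g x - c) 0) \<le> (LINT \<omega>|\<mu>. max (\<zeta> \<omega> - c) 0)"
      using pushforward_density[OF assms(1) p(1) \<zeta>(1,2,5)] by blast
    have gU: "(\<integral>\<^sup>+z. ennreal (g (U z)) \<partial>\<pi>) = 1"
      using int_g[of "\<lambda>_. 1"] \<zeta>(5) by (simp add: marg(1)[symmetric] nn_integral_distr)
    have [measurable]: "(\<lambda>z. g (U z)) \<in> borel_measurable \<pi>" by measurable
    obtain h where h [measurable]: "h \<in> borel_measurable X'" and h0: "\<And>x. 0 \<le> h x"
      and int_h: "\<And>\<phi>. \<phi> \<in> borel_measurable X' \<Longrightarrow>
        (\<integral>\<^sup>+x. \<phi> x * ennreal (h x) \<partial>distr \<pi> X' V) = (\<integral>\<^sup>+z. \<phi> (V z) * ennreal (g (U z)) \<partial>\<pi>)"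
      and sl_h: "\<And>c. (LINT x|distr \<pi> X' V. max (h x - c) 0) \<le> (LINT z|\<pi>. max (g (U z) - c) 0)"
      using pushforward_density[OF \<pi> U(2) _ _ gU] g0 by auto
    have int_\<zeta>': "(\<integral>\<^sup>+\<omega>. \<phi> (p' \<omega>) * ennreal (h (p' \<omega>)) \<partial>\<nu>) = (\<integral>\<^sup>+z. \<phi> (V z) * ennreal (g (U z)) \<partial>\<pi>)"
      if [measurable]: "\<phi> \<in> borel_measurable X'" for \<phi>
      using int_h[OF that] by (simp add: marg(2) nn_integral_distr)
    have int_\<zeta>: "(\<integral>\<^sup>+\<omega>. \<phi> (p \<omega>) * ennreal (\<zeta> \<omega>) \<partial>\<mu>) = (\<integral>\<^sup>+z. \<phi> (U z) * ennreal (g (U z)) \<partial>\<pi>)"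
      if [measurable]: "\<phi> \<in> borel_measurable X" for \<phi>
      using int_g[OF that] by (simp add: marg(1)[symmetric] nn_integral_distr)
    have feas': "(\<lambda>\<omega>. h (p' \<omega>)) \<in> feasible \<sigma> \<nu>"
    proof (rule feasible_of_stop_loss[OF assms(2,1) feas])
      show "(\<integral>\<^sup>+\<omega>. ennreal (h (p' \<omega>)) \<partial>\<nu>) = 1"
        using int_\<zeta>'[of "\<lambda>_. 1"] gU by simp
      fix c
      have "(LINT \<omega>|\<nu>. max (h (p' \<omega>) - c) 0) = (LINT x|distr \<pi> X' V. max (h x - c) 0)"
        unfolding marg by (subst integral_distr) auto
      also have "\<dots> \<le> (LINT x|distr \<pi> X U. max (g x - c) 0)"
        using sl_h[of c] by (subst integral_distr) auto
      also have "\<dots> \<le> (LINT \<omega>|\<mu>. max (\<zeta> \<omega> - c) 0)"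
        unfolding marg by (rule sl_g)
      finally show "(LINT \<omega>|\<nu>. max (h (p' \<omega>) - c) 0) \<le> (LINT \<omega>|\<mu>. max (\<zeta> \<omega> - c) 0)" .
    qed (use h0 in auto)
    let ?a = "\<integral>\<^sup>+z. e2ennreal (F (U z)) * ennreal (g (U z)) \<partial>\<pi>"
    let ?a' = "\<integral>\<^sup>+z. e2ennreal (- F (U z)) * ennreal (g (U z)) \<partial>\<pi>"
    let ?b = "\<integral>\<^sup>+z. e2ennreal (F' (V z)) * ennreal (g (U z)) \<partial>\<pi>"
    let ?b' = "\<integral>\<^sup>+z. e2ennreal (- F' (V z)) * ennreal (g (U z)) \<partial>\<pi>"
    let ?d = "\<integral>\<^sup>+z. e2ennreal \<bar>F (U z) - F' (V z)\<bar> * ennreal (g (U z)) \<partial>\<pi>"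
    have E: "expect \<mu> (\<lambda>\<omega>. F (p \<omega>) * ereal (\<zeta> \<omega>)) = enn2ereal ?a - enn2ereal ?a'"
      using int_\<zeta>[of "\<lambda>x. e2ennreal (F x)"] int_\<zeta>[of "\<lambda>x. e2ennreal (- F x)"] \<zeta>(2)
      by (subst expect_weighted) auto
    have E': "expect \<nu> (\<lambda>\<omega>. F' (p' \<omega>) * ereal (h (p' \<omega>))) = enn2ereal ?b - enn2ereal ?b'"
      using int_\<zeta>'[of "\<lambda>x. e2ennreal (F' x)"] int_\<zeta>'[of "\<lambda>x. e2ennreal (- F' x)"] h0
      by (subst expect_weighted) auto
    have le: "enn2ereal ?a - enn2ereal ?a' \<le> risk \<sigma> \<mu> (\<lambda>\<omega>. F (p \<omega>))"
      unfolding E[symmetric] risk_def by (intro SUP_upper feas)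
    have le': "enn2ereal ?b - enn2ereal ?b' \<le> risk \<sigma> \<nu> (\<lambda>\<omega>. F' (p' \<omega>))"
      unfolding E'[symmetric] risk_def by (intro SUP_upper feas')
    have a: "?a \<noteq> \<infinity>" using le assms(13) by auto
    have b: "?b \<noteq> \<infinity>" using le' assms(14) by auto
    have "?a + ?b' = (\<integral>\<^sup>+z. (e2ennreal (F (U z)) + e2ennreal (- F' (V z))) * ennreal (g (U z)) \<partial>\<pi>)"
      by (subst nn_integral_add[symmetric]) (auto simp: distrib_right)
    also have "\<dots> \<le> (\<integral>\<^sup>+z. (e2ennreal (F' (V z)) + e2ennreal (- F (U z)) + e2ennreal \<bar>F (U z) - F' (V z)\<bar>) * ennreal (g (U z)) \<partial>\<pi>)"
      using fin
    proof (intro nn_integral_mono_AE, eventually_elim)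
      case (elim z)
      obtain x y where xy: "F (U z) = ereal x" "F' (V z) = ereal y" using elim by auto
      have "ennreal x + ennreal (- y) \<le> ennreal y + ennreal (- x) + ennreal \<bar>x - y\<bar>"
        by (cases "0 \<le> x"; cases "0 \<le> y") (auto simp: ennreal_neg simp flip: ennreal_plus intro!: ennreal_leI)
      then show ?case
        unfolding xy by (intro mult_right_mono) (auto simp flip: ennreal_def)
    qed
    also have "\<dots> = ?b + ?a' + ?d"
      by (subst nn_integral_add[symmetric], simp, simp)+ (simp add: distrib_right)
    finally have "?a + ?b' \<le> ?b + ?a' + ?d" .
    then have "enn2ereal ?a - enn2ereal ?a' \<le> enn2ereal ?b - enn2ereal ?b' + enn2ereal ?d"
      by (rule ereal_diff_le_of_sum_le[OF a b])
    also have "\<dots> \<le> risk \<sigma> \<nu> (\<lambda>\<omega>. F' (p' \<omega>)) + enn2ereal \<delta>"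
    proof (intro add_mono le')
      have "integrable (distr \<mu> X p) g"
        using int_g[of "\<lambda>_. 1"] \<zeta>(5) g0 by (intro integrableI_nonneg) auto
      moreover have "(LINT x|distr \<mu> X p. max (g x - c) 0) \<le> (LINT u|unit_leb. max (\<sigma> u - c) 0)" for c
        using sl_g feasible_stop_loss[OF assms(1,15) feas] by (rule order_trans)
      ultimately show "enn2ereal ?d \<le> enn2ereal \<delta>"
        using \<delta>[OF g g0] by (simp add: less_eq_ennreal.rep_eq)
    qed
    finally show ?thesis unfolding E .
  qed
  then show ?thesis
    unfolding risk_def[of \<sigma> \<mu>] by (intro SUP_least)
qed

lemma conjugate_exponent_cases:
  assumes "1 \<le> r" "1 < q" "1 / ennreal r + 1 / q = 1"
  obtains (infinity) "q = \<infinity>" "r = 1" | (real) p where "q = ennreal p" "1 < p" "1 / r + 1 / p = 1"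
proof (cases q)
  case (real p)
  then have p: "1 < p" using assms(2) ennreal_less_iff[of 1 p] by simp
  have "1 / ennreal r + 1 / q = ennreal (1 / r + 1 / p)"
    using real p assms(1) by (simp add: divide_ennreal flip: ennreal_1)
  then have "ennreal (1 / r + 1 / p) = 1" by (rule trans[OF sym assms(3)])
  then have "1 / r + 1 / p = 1" by (simp only: ennreal_eq_1)
  then show ?thesis using that(2)[of p] real p by simp
next
  case top
  then have "ennreal (1 / r) = 1" using assms by (simp add: divide_ennreal flip: ennreal_1)
  then show ?thesis using that(1) top assms by (simp add: ennreal_eq_1)
qed

text \<open>
  The stop-loss order gives \<open>\<parallel>g\<parallel>\<^sub>q \<le> \<parallel>\<sigma>\<parallel>\<^sub>q\<close>, for finite and for infinite \<open>q\<close>.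
\<close>

lemma Lq_weighted_power_bound:
  fixes g :: "'b \<Rightarrow> real"
  assumes \<pi>: "prob_space \<pi>" and U [measurable]: "U \<in> \<pi> \<rightarrow>\<^sub>M X" and g [measurable]: "g \<in> borel_measurable X"
    and w [measurable]: "w \<in> borel_measurable \<pi>" and "\<And>x. 0 \<le> g x" "\<And>z. 0 \<le> w z"
    and "integrable (distr \<pi> X U) g" "distortion \<sigma>"
    and sl: "\<And>c. (LINT x|distr \<pi> X U. max (g x - c) 0) \<le> (LINT u|unit_leb. max (\<sigma> u - c) 0)"
    and rq: "1 \<le> r" "1 < q" "1 / ennreal r + 1 / q = 1" and "0 < \<beta>" "\<beta> \<le> 1" and finite: "Lq_norm q \<sigma> \<noteq> \<infinity>"
  shows "(\<integral>\<^sup>+z. ennreal (g (U z) * w z powr \<beta>) \<partial>\<pi>)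
    \<le> Lq_norm q \<sigma> * epowr (epowr (\<integral>\<^sup>+z. ennreal (w z powr r) \<partial>\<pi>) (1 / r)) \<beta>"
proof -
  interpret \<pi>: prob_space \<pi> by fact
  have m: "prob_space (distr \<pi> X U)" by (rule \<pi>.prob_space_distr) fact
  define s where "s = enn2real (Lq_norm q \<sigma>)"
  have s: "Lq_norm q \<sigma> = ennreal s" "0 < s"
    using finite Lq_norm_pos[OF assms(8) order.strict_trans[OF zero_less_one rq(2)]] by (auto simp: s_def less_top enn2real_positive_iff)
  have "(r = 1 \<and> (AE z in \<pi>. g (U z) \<le> s)) \<or>
    (\<exists>p. 1 < p \<and> 1 / r + 1 / p = 1 \<and> (\<integral>\<^sup>+z. ennreal (g (U z) powr p) \<partial>\<pi>) \<le> ennreal (s powr p))"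
    using rq
  proof (cases rule: conjugate_exponent_cases)
    case infinity
    have "AE x in distr \<pi> X U. g x \<le> s"
      using Lq_norm_infinity_AE[OF assms(8)] finite infinity
      by (intro bounded_of_stop_loss[OF m assms(7,8) _ sl]) (simp add: s_def)
    then have "AE z in \<pi>. g (U z) \<le> s" by (subst (asm) AE_distr_iff) auto
    then show ?thesis using infinity by simp
  next
    case (real p)
    have "(\<integral>\<^sup>+z. ennreal (g (U z) powr p) \<partial>\<pi>) = (\<integral>\<^sup>+x. ennreal (g x powr p) \<partial>distr \<pi> X U)"
      by (subst nn_integral_distr) auto
    also have "\<dots> \<le> (\<integral>\<^sup>+u. ennreal (\<sigma> u powr p) \<partial>unit_leb)"
      using distortion_integral[OF assms(8)] distortion_nonneg[OF assms(8)] real(2)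
      by (intro moment_le_of_stop_loss[OF m assms(7,5) prob_space_unit_leb _ _ sl]) auto
    also have "\<dots> = epowr (Lq_norm q \<sigma>) p"
      using real by (simp add: Lq_norm_real[OF assms(8)] epowr_inverse')
    also have "\<dots> = ennreal (s powr p)" using s by simp
    finally show ?thesis using real by blast
  qed
  then show ?thesis
    unfolding s(1) using assms s(2)
    by (elim disjE exE) (rule weighted_power_bound; force)+
qed

text \<open>
  For a cost that is not measurable, the integral on the right is a lower integral.  It still
  dominates the integral of the measurable minorant \<open>w = (\<bar>F \<circ> U - F' \<circ> V\<bar> / a)\<^sup>1\<^sup>/\<^sup>\<beta>\<close> of the cost,
  to which the inequalities of Hoelder and Jensen are applied.
\<close>

lemma risk_coupling_Lq:
  fixes F :: "'b \<Rightarrow> ereal" and F' :: "'c \<Rightarrow> ereal" and c :: "'d \<Rightarrow> ennreal"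
  assumes "prob_space \<mu>" "prob_space \<nu>"
    and p [measurable]: "p \<in> \<mu> \<rightarrow>\<^sub>M X" "p' \<in> \<nu> \<rightarrow>\<^sub>M X'"
    and F [measurable]: "F \<in> borel_measurable X" "F' \<in> borel_measurable X'"
    and U [measurable]: "U \<in> \<pi> \<rightarrow>\<^sub>M X" "V \<in> \<pi> \<rightarrow>\<^sub>M X'"
    and marg: "distr \<pi> X U = distr \<mu> X p" "distr \<pi> X' V = distr \<nu> X' p'"
    and fin: "AE z in \<pi>. \<bar>F (U z)\<bar> \<noteq> \<infinity>" "AE z in \<pi>. \<bar>F' (V z)\<bar> \<noteq> \<infinity>"
    and risk_fin: "risk \<sigma> \<mu> (\<lambda>\<omega>. F (p \<omega>)) \<noteq> \<infinity>" "risk \<sigma> \<nu> (\<lambda>\<omega>. F' (p' \<omega>)) \<noteq> \<infinity>"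
    and "distortion \<sigma>"
    and rq: "1 \<le> r" "1 < q" "1 / ennreal r + 1 / q = 1" and \<beta>: "0 < \<beta>" "\<beta> \<le> 1"
    and A: "A \<noteq> \<infinity>" "A = 0 \<or> Lq_norm q \<sigma> \<noteq> \<infinity>"
    and bound: "AE z in \<pi>. \<bar>F (U z) - F' (V z)\<bar> \<le> enn2ereal (A * epowr (c z) \<beta>)"
  shows "risk \<sigma> \<mu> (\<lambda>\<omega>. F (p \<omega>)) \<le> risk \<sigma> \<nu> (\<lambda>\<omega>. F' (p' \<omega>))
    + enn2ereal (Lq_norm q \<sigma> * A * epowr (epowr (\<integral>\<^sup>+z. epowr (c z) r \<partial>\<pi>) (1 / r)) \<beta>)"
proof (rule risk_coupling[OF assms(1-15)])
  interpret \<mu>: prob_space \<mu> by fact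
  have "prob_space (distr \<pi> X U)" unfolding marg by (rule \<mu>.prob_space_distr) fact
  then have \<pi>: "prob_space \<pi>" by (rule prob_space_distrD[rotated]) fact
  fix g :: "'b \<Rightarrow> real"
  assume g [measurable]: "g \<in> borel_measurable X" and g0: "\<And>x. 0 \<le> g x" and int_g: "integrable (distr \<mu> X p) g"
    and sl: "\<And>c. (LINT x|distr \<mu> X p. max (g x - c) 0) \<le> (LINT u|unit_leb. max (\<sigma> u - c) 0)"
  define D where "D z = real_of_ereal \<bar>F (U z) - F' (V z)\<bar>" for z
  have D [measurable]: "D \<in> borel_measurable \<pi>" unfolding D_def by measurable
  have D0: "0 \<le> D z" for z by (simp add: D_def real_of_ereal_pos)
  have bd: "AE z in \<pi>. e2ennreal \<bar>F (U z) - F' (V z)\<bar> = ennreal (D z) \<and> ennreal (D z) \<le> A * epowr (c z) \<beta>"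
    using fin bound
  proof eventually_elim
    case (elim z)
    obtain x y where xy: "F (U z) = ereal x" "F' (V z) = ereal y" using elim by auto
    then have "e2ennreal \<bar>F (U z) - F' (V z)\<bar> = ennreal (D z)" by (simp add: D_def)
    moreover have "e2ennreal \<bar>F (U z) - F' (V z)\<bar> \<le> A * epowr (c z) \<beta>"
      using e2ennreal_mono[OF elim(3)] by simp
    ultimately show ?case by simp
  qed
  obtain a where a: "A = ennreal a" "0 \<le> a" using A by (cases A) auto
  show "(\<integral>\<^sup>+z. e2ennreal \<bar>F (U z) - F' (V z)\<bar> * ennreal (g (U z)) \<partial>\<pi>)
      \<le> Lq_norm q \<sigma> * A * epowr (epowr (\<integral>\<^sup>+z. epowr (c z) r \<partial>\<pi>) (1 / r)) \<beta>"
  proof (cases "a = 0")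
    case True
    have "(\<integral>\<^sup>+z. e2ennreal \<bar>F (U z) - F' (V z)\<bar> * ennreal (g (U z)) \<partial>\<pi>) = (\<integral>\<^sup>+z. 0 \<partial>\<pi>)"
      using bd by (intro nn_integral_cong_AE, eventually_elim) (use True a in auto)
    then show ?thesis by simp
  next
    case False
    then have a0: "0 < a" using a by simp
    have fin_q: "Lq_norm q \<sigma> \<noteq> \<infinity>" using A a a0 by auto
    \<comment> \<open>The exponent makes \<open>w\<close> a minorant of the cost.\<close>
    define w where "w z = (D z / a) powr (1 / \<beta>)" for z
    have w [measurable]: "w \<in> borel_measurable \<pi>" unfolding w_def by measurable
    have Dw: "D z = a * w z powr \<beta>" for z
      using a0 \<beta> D0 by (simp add: w_def powr_powr)
    have "(\<integral>\<^sup>+z. e2ennreal \<bar>F (U z) - F' (V z)\<bar> * ennreal (g (U z)) \<partial>\<pi>)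
        = (\<integral>\<^sup>+z. ennreal a * ennreal (g (U z) * w z powr \<beta>) \<partial>\<pi>)"
      using bd by (intro nn_integral_cong_AE, eventually_elim)
        (use a0 g0 in \<open>auto simp: Dw mult_ac simp flip: ennreal_mult\<close>)
    also have "\<dots> = ennreal a * (\<integral>\<^sup>+z. ennreal (g (U z) * w z powr \<beta>) \<partial>\<pi>)"
      by (rule nn_integral_cmult) measurable
    also have "\<dots> \<le> ennreal a * (Lq_norm q \<sigma> * epowr (epowr (\<integral>\<^sup>+z. ennreal (w z powr r) \<partial>\<pi>) (1 / r)) \<beta>)"
      using int_g sl unfolding marg(1)[symmetric]
      by (intro mult_left_mono Lq_weighted_power_bound[OF \<pi> U(1) g w g0 _ _ assms(15) _ rq \<beta> fin_q]) (auto simp: w_def)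
    also have "\<dots> \<le> ennreal a * (Lq_norm q \<sigma> * epowr (epowr (\<integral>\<^sup>+z. epowr (c z) r \<partial>\<pi>) (1 / r)) \<beta>)"
    proof -
      have "(\<integral>\<^sup>+z. ennreal (w z powr r) \<partial>\<pi>) \<le> (\<integral>\<^sup>+z. epowr (c z) r \<partial>\<pi>)"
        using bd
      proof (intro nn_integral_mono_AE, eventually_elim)
        case (elim z)
        then have "ennreal (D z / a) \<le> epowr (c z) \<beta>"
          using a a0 D0 by (cases "epowr (c z) \<beta>") (auto simp: field_simps simp flip: ennreal_mult)
        then have "ennreal (w z) \<le> c z"
          using a0 D0[of z] \<beta> by (simp add: le_epowr_iff w_def)
        then have "epowr (ennreal (w z)) r \<le> epowr (c z) r" using rq by (intro epowr_mono) auto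
        then show ?case by (simp add: w_def)
      qed
      then show ?thesis using rq \<beta> by (intro mult_left_mono epowr_mono) auto
    qed
    finally show ?thesis using a by (simp add: mult_ac)
  qed
qed

lemma product_coupling:
  assumes "prob_space \<mu>" "prob_space \<nu>"
  shows "\<mu> \<Otimes>\<^sub>M \<nu> \<in> couplings \<mu> \<nu>"
proof -
  interpret \<mu>: prob_space \<mu> by fact
  interpret \<nu>: prob_space \<nu> by fact
  interpret pair_prob_space \<mu> \<nu> ..
  have "distr (\<mu> \<Otimes>\<^sub>M \<nu>) \<mu> fst = \<mu>"
    by (rule \<nu>.distr_pair_fst)
  moreover have "distr (\<mu> \<Otimes>\<^sub>M \<nu>) \<nu> snd = \<nu>"
    by (subst distr_pair_swap) (simp add: distr_distr comp_def split_beta \<mu>.distr_pair_fst[of \<nu>])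
  ultimately show ?thesis by (simp add: couplings_def)
qed

lemma ennreal_le_mult_iff: "0 < b \<Longrightarrow> 0 \<le> x \<Longrightarrow> ennreal x \<le> ennreal b * e \<longleftrightarrow> ennreal (x / b) \<le> e"
  by (cases e) (auto simp: field_simps ennreal_mult_top simp flip: ennreal_mult)

text \<open>
  The inductive step of the theorem: a Hoelder bound, with respect to the cost \<open>c\<close>, on the
  difference of the risks to go turns into a Hoelder bound with respect to the Wasserstein
  transform of \<open>c\<close>, at the price of the factor \<open>\<parallel>\<sigma>\<parallel>\<^sub>q\<close>.  The passage to the infimum over the
  couplings is made only after the supremum over \<open>\<sigma>\<close>, because the risk for a single \<open>\<sigma>\<close> may be
  \<open>-\<infinity>\<close>.
\<close>

lemma one_stage_estimate:
  fixes F :: "'b \<Rightarrow> ereal" and F' :: "'c \<Rightarrow> ereal" and c :: "'b \<Rightarrow> 'c \<Rightarrow> ennreal"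
    and S :: "(real \<Rightarrow> real) set"
  defines "k q \<equiv> (SUP \<sigma>\<in>S. Lq_norm q \<sigma>)"
  assumes \<mu>: "prob_space \<mu>" and \<nu>: "prob_space \<nu>"
    and p [measurable]: "p \<in> \<mu> \<rightarrow>\<^sub>M X" and p' [measurable]: "p' \<in> \<nu> \<rightarrow>\<^sub>M X'"
    and F [measurable]: "F \<in> borel_measurable X" and F' [measurable]: "F' \<in> borel_measurable X'"
    and S: "\<And>\<sigma>. \<sigma> \<in> S \<Longrightarrow> distortion \<sigma>"
    and G: "AE u in distr \<mu> X p. u \<in> G" "AE v in distr \<nu> X' p'. v \<in> G'"
    and fin: "\<And>u. u \<in> G \<Longrightarrow> \<bar>F u\<bar> \<noteq> \<infinity>" "\<And>v. v \<in> G' \<Longrightarrow> \<bar>F' v\<bar> \<noteq> \<infinity>"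
    and rq: "1 \<le> r" "1 < q" "1 / ennreal r + 1 / q = 1" and \<beta>: "0 < \<beta>" "\<beta> \<le> 1"
    and A: "A \<noteq> \<infinity>" "A = 0 \<or> k q \<noteq> \<infinity>"
    and bound: "\<And>u v. u \<in> G \<Longrightarrow> v \<in> G' \<Longrightarrow> \<bar>F u - F' v\<bar> \<le> enn2ereal (A * epowr (c u v) \<beta>)"
    and R: "R = (SUP \<sigma>\<in>S. risk \<sigma> \<mu> (\<lambda>\<omega>. F (p \<omega>)))" "\<bar>R\<bar> \<noteq> \<infinity>"
    and R': "R' = (SUP \<sigma>\<in>S. risk \<sigma> \<nu> (\<lambda>\<omega>. F' (p' \<omega>)))" "\<bar>R'\<bar> \<noteq> \<infinity>"
  shows "\<bar>R - R'\<bar> \<le> enn2ereal (k q * A * epowr (wasserstein r (distr \<mu> X p) (distr \<nu> X' p') c) \<beta>)"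
proof -
  interpret \<mu>: prob_space \<mu> by fact
  interpret \<nu>: prob_space \<nu> by fact
  define m where "m = distr \<mu> X p"
  define n where "n = distr \<nu> X' p'"
  have m: "prob_space m" unfolding m_def by (rule \<mu>.prob_space_distr) fact
  have n: "prob_space n" unfolding n_def by (rule \<nu>.prob_space_distr) fact
  obtain x y where xy: "R = ereal x" "R' = ereal y" using R(2) R'(2) by auto
  define C where "C \<pi> = epowr (\<integral>\<^sup>+z. epowr (c (fst z) (snd z)) r \<partial>\<pi>) (1 / r)" for \<pi>
  have main: "ennreal \<bar>x - y\<bar> \<le> k q * A * epowr (C \<pi>) \<beta>" if \<pi>: "\<pi> \<in> couplings m n" for \<pi>
  proof -
    have sets_\<pi> [measurable_cong]: "sets \<pi> = sets (X \<Otimes>\<^sub>M X')"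
      using \<pi> by (auto simp: couplings_def m_def n_def cong: sets_pair_measure_cong)
    have U [measurable]: "fst \<in> \<pi> \<rightarrow>\<^sub>M X" and V [measurable]: "snd \<in> \<pi> \<rightarrow>\<^sub>M X'" by measurable
    have "distr \<pi> X fst = distr \<pi> m fst" "distr \<pi> X' snd = distr \<pi> n snd"
      by (auto intro!: distr_cong simp: m_def n_def)
    then have marg: "distr \<pi> X fst = distr \<mu> X p" "distr \<pi> X' snd = distr \<nu> X' p'"
      using \<pi> by (auto simp: couplings_def m_def n_def)
    have GU: "AE z in \<pi>. fst z \<in> G" using G(1) unfolding marg[symmetric] by (rule AE_distrD[OF U])
    have GV: "AE z in \<pi>. snd z \<in> G'" using G(2) unfolding marg[symmetric] by (rule AE_distrD[OF V])
    have finU: "AE z in \<pi>. \<bar>F (fst z)\<bar> \<noteq> \<infinity>" using GU by eventually_elim (rule fin)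
    have finV: "AE z in \<pi>. \<bar>F' (snd z)\<bar> \<noteq> \<infinity>" using GV by eventually_elim (rule fin)
    have bd: "AE z in \<pi>. \<bar>F (fst z) - F' (snd z)\<bar> \<le> enn2ereal (A * epowr (c (fst z) (snd z)) \<beta>)"
      using GU GV by eventually_elim (rule bound)
    have bd': "AE z in \<pi>. \<bar>F' (snd z) - F (fst z)\<bar> \<le> enn2ereal (A * epowr (c (fst z) (snd z)) \<beta>)"
      using bd finU finV
    proof eventually_elim
      case (elim z)
      then show ?case by (cases "F (fst z)"; cases "F' (snd z)") (auto simp: abs_minus_commute)
    qed
    have le_k: "Lq_norm q \<sigma> \<le> k q" if "\<sigma> \<in> S" for \<sigma>
      unfolding k_def using that by (rule SUP_upper)
    have step_le: "enn2ereal (Lq_norm q \<sigma> * A * epowr (C \<pi>) \<beta>) \<le> enn2ereal (k q * A * epowr (C \<pi>) \<beta>)" if "\<sigma> \<in> S" for \<sigma>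
      using le_k[OF that] by (auto simp flip: less_eq_ennreal.rep_eq intro!: mult_right_mono)
    have le_R: "risk \<sigma> \<mu> (\<lambda>\<omega>. F (p \<omega>)) \<le> R" "risk \<sigma> \<nu> (\<lambda>\<omega>. F' (p' \<omega>)) \<le> R'" if "\<sigma> \<in> S" for \<sigma>
      unfolding R(1) R'(1) using that by (auto intro: SUP_upper)
    have cond: "risk \<sigma> \<mu> (\<lambda>\<omega>. F (p \<omega>)) \<noteq> \<infinity>" "risk \<sigma> \<nu> (\<lambda>\<omega>. F' (p' \<omega>)) \<noteq> \<infinity>"
      "A = 0 \<or> Lq_norm q \<sigma> \<noteq> \<infinity>" if "\<sigma> \<in> S" for \<sigma>
      using le_R[OF that] le_k[OF that] A by (auto simp: xy top_unique)
    have "R \<le> R' + enn2ereal (k q * A * epowr (C \<pi>) \<beta>)"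
      unfolding R(1)
    proof (rule SUP_least)
      fix \<sigma> assume \<sigma>: "\<sigma> \<in> S"
      note risk_coupling_Lq[OF \<mu> \<nu> p p' F F' U V marg finU finV cond(1,2)[OF \<sigma>] S[OF \<sigma>] rq \<beta> A(1) cond(3)[OF \<sigma>] bd, folded C_def]
      also have "risk \<sigma> \<nu> (\<lambda>\<omega>. F' (p' \<omega>)) + enn2ereal (Lq_norm q \<sigma> * A * epowr (C \<pi>) \<beta>)
        \<le> R' + enn2ereal (k q * A * epowr (C \<pi>) \<beta>)"
        by (intro add_mono le_R step_le \<sigma>)
      finally show "risk \<sigma> \<mu> (\<lambda>\<omega>. F (p \<omega>)) \<le> R' + enn2ereal (k q * A * epowr (C \<pi>) \<beta>)" .
    qed
    moreover have "R' \<le> R + enn2ereal (k q * A * epowr (C \<pi>) \<beta>)"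
      unfolding R'(1)
    proof (rule SUP_least)
      fix \<sigma> assume \<sigma>: "\<sigma> \<in> S"
      note risk_coupling_Lq[OF \<nu> \<mu> p' p F' F V U marg(2,1) finV finU cond(2,1)[OF \<sigma>] S[OF \<sigma>] rq \<beta> A(1) cond(3)[OF \<sigma>] bd', folded C_def]
      also have "risk \<sigma> \<mu> (\<lambda>\<omega>. F (p \<omega>)) + enn2ereal (Lq_norm q \<sigma> * A * epowr (C \<pi>) \<beta>)
        \<le> R + enn2ereal (k q * A * epowr (C \<pi>) \<beta>)"
        by (intro add_mono le_R step_le \<sigma>)
      finally show "risk \<sigma> \<nu> (\<lambda>\<omega>. F' (p' \<omega>)) \<le> R + enn2ereal (k q * A * epowr (C \<pi>) \<beta>)" .
    qed
    ultimately show ?thesis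
      unfolding xy by (cases "k q * A * epowr (C \<pi>) \<beta>") (auto simp: abs_le_iff intro!: ennreal_leI)
  qed
  have "ennreal \<bar>x - y\<bar> \<le> k q * A * epowr (wasserstein r m n c) \<beta>"
  proof (cases "k q * A = 0")
    case True
    then show ?thesis using main[OF product_coupling[OF m n]] unfolding True by simp
  next
    case False
    then have "k q * A \<noteq> \<infinity>" using A by (auto simp: ennreal_mult_eq_top_iff)
    then obtain b where b: "k q * A = ennreal b" "0 < b"
      using False by (cases "k q * A") (auto simp: le_less)
    \<comment> \<open>The bound is solved for the transport cost, to which the infimum applies.\<close>
    have "epowr (ennreal (\<bar>x - y\<bar> / b)) (1 / \<beta>) \<le> wasserstein r m n c"
      unfolding wasserstein_def C_def[symmetric]
    proof (rule INF_greatest)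
      fix \<pi> assume "\<pi> \<in> couplings m n"
      from main[OF this] show "epowr (ennreal (\<bar>x - y\<bar> / b)) (1 / \<beta>) \<le> C \<pi>"
        unfolding b(1) by (simp only: ennreal_le_mult_iff[OF b(2) abs_ge_zero] le_epowr_iff[OF \<beta>(1)])
    qed
    then show ?thesis
      unfolding b(1) by (simp only: ennreal_le_mult_iff[OF b(2) abs_ge_zero] le_epowr_iff[OF \<beta>(1)])
  qed
  then show ?thesis
    unfolding xy m_def n_def by (simp add: less_eq_ennreal.rep_eq)
qed

section \<open>Borel sets of path spaces\<close>

lemma space_borel_of [simp]: "space (borel_of X) = topspace X"
  unfolding borel_of_def by (rule space_measure_of) (auto dest: openin_subset)

lemma sets_borel_of: "sets (borel_of X) = sigma_sets (topspace X) {U. openin X U}"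
  unfolding borel_of_def by (rule sets_measure_of) (auto dest: openin_subset)

lemma borel_of_open: "openin X U \<Longrightarrow> U \<in> sets (borel_of X)"
  by (auto simp: sets_borel_of)

lemma measurable_borel_of_continuous_map:
  assumes "continuous_map X Z f"
  shows "f \<in> borel_of X \<rightarrow>\<^sub>M borel_of Z"
proof (rule measurable_sigma_sets[OF sets_borel_of])
  show "f \<in> space (borel_of X) \<rightarrow> topspace Z"
    using assms by (auto simp: continuous_map_def)
  show "f -` U \<inter> space (borel_of X) \<in> sets (borel_of X)" if "U \<in> {U. openin Z U}" for U
  proof -
    have "f -` U \<inter> space (borel_of X) = {x \<in> topspace X. f x \<in> U}" by auto
    then show ?thesis using openin_continuous_map_preimage[OF assms] that by (auto intro: borel_of_open)
  qed
qed (auto dest: openin_subset)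

lemma polish_metric_second_countable:
  assumes "polish_metric m"
  shows "second_countable (mtopology_of m)"
proof -
  interpret Metric_space "mspace m" "mdist m" by simp
  obtain C where C: "countable C" "C \<subseteq> mspace m" "mtopology closure_of C = mspace m"
    using assms by (auto simp: polish_metric_def separable_space_def mtopology_of_def)
  define \<B> where "\<B> = (\<lambda>(a, n). mball a (1 / Suc n)) ` (C \<times> (UNIV :: nat set))"
  have "\<exists>V\<in>\<B>. x \<in> V \<and> V \<subseteq> U" if U: "openin mtopology U" "x \<in> U" for U x
  proof -
    obtain e where e: "0 < e" "mball x e \<subseteq> U" using U by (auto simp: openin_mtopology)
    obtain n where n: "1 / Suc n < e / 2"
      using reals_Archimedean[of "e / 2"] e by (auto simp: inverse_eq_divide)
    have x: "x \<in> mspace m" using U openin_subset by fastforce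
    then have "x \<in> mtopology closure_of C" using C by simp
    then have "\<forall>r>0. \<exists>y\<in>C. y \<in> mball x r"
      unfolding metric_closure_of by simp
    from this[rule_format, of "1 / Suc n"]
    obtain a where a: "a \<in> C" "a \<in> mball x (1 / Suc n)" by auto
    have "mball a (1 / Suc n) \<subseteq> mball x e"
    proof
      fix y assume "y \<in> mball a (1 / Suc n)"
      then show "y \<in> mball x e" using a n triangle[of x a y] by auto
    qed
    moreover have "x \<in> mball a (1 / Suc n)" using a by (auto simp: commute)
    ultimately show ?thesis using e a by (auto simp: \<B>_def intro!: bexI[of _ "mball a (1 / Suc n)"])
  qed
  moreover have "countable \<B>" unfolding \<B>_def using C by (intro countable_image countable_SIGMA) auto
  ultimately show ?thesis
    unfolding second_countable_def mtopology_of_def by (intro exI[of _ \<B>]) (auto simp: \<B>_def)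
qed

lemma product_topology_countable_box_base:
  assumes "finite I" "\<And>i. i \<in> I \<Longrightarrow> second_countable (X i)"
  obtains \<B> where "countable \<B>" "\<And>V. V \<in> \<B> \<Longrightarrow> \<exists>B. V = PiE I B \<and> (\<forall>i\<in>I. openin (X i) (B i))"
    and "\<And>U. openin (product_topology X I) U \<Longrightarrow> \<exists>\<U>\<subseteq>\<B>. U = \<Union>\<U>"
proof -
  have "\<forall>i\<in>I. \<exists>\<B>. countable \<B> \<and> (\<forall>V\<in>\<B>. openin (X i) V) \<and>
      (\<forall>U x. openin (X i) U \<and> x \<in> U \<longrightarrow> (\<exists>V\<in>\<B>. x \<in> V \<and> V \<subseteq> U))"
    using assms(2) by (auto simp: second_countable_def)
  then obtain b where b: "\<And>i. i \<in> I \<Longrightarrow> countable (b i)" "\<And>i V. i \<in> I \<Longrightarrow> V \<in> b i \<Longrightarrow> openin (X i) V"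
    "\<And>i U x. i \<in> I \<Longrightarrow> openin (X i) U \<Longrightarrow> x \<in> U \<Longrightarrow> \<exists>V\<in>b i. x \<in> V \<and> V \<subseteq> U"
    by metis
  define \<B> where "\<B> = (\<lambda>B. PiE I B) ` PiE I b"
  have base: "\<exists>\<U>\<subseteq>\<B>. U = \<Union>\<U>" if U: "openin (product_topology X I) U" for U
  proof -
    have "\<exists>V\<in>\<B>. x \<in> V \<and> V \<subseteq> U" if x: "x \<in> U" for x
    proof -
      obtain W where W: "x \<in> PiE I W" "\<And>i. openin (X i) (W i)" "PiE I W \<subseteq> U"
        using product_topology_open_contains_basis[OF U x] by auto
      have "\<forall>i\<in>I. \<exists>V\<in>b i. x i \<in> V \<and> V \<subseteq> W i" using W b(3) by (auto simp: PiE_iff)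
      then obtain B where B: "\<And>i. i \<in> I \<Longrightarrow> B i \<in> b i \<and> x i \<in> B i \<and> B i \<subseteq> W i" by metis
      have "PiE I (restrict B I) \<in> \<B>" unfolding \<B>_def using B by (intro imageI) auto
      moreover have "x \<in> PiE I (restrict B I)" using B W by (auto simp: PiE_iff)
      moreover have "PiE I (restrict B I) \<subseteq> U" using B W(3) by (auto simp: PiE_iff subset_eq)
      ultimately show ?thesis by blast
    qed
    then show ?thesis by (intro exI[of _ "{V\<in>\<B>. V \<subseteq> U}"]) blast
  qed
  have count: "countable \<B>" unfolding \<B>_def using assms b by (intro countable_image countable_PiE)
  have box: "\<exists>B. V = PiE I B \<and> (\<forall>i\<in>I. openin (X i) (B i))" if "V \<in> \<B>" for V
    using that b(2) unfolding \<B>_def by (auto dest: PiE_mem)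
  show ?thesis by (rule that[OF count box base])
qed

context
  fixes \<Xi> :: "nat \<Rightarrow> 'a metric" and I :: "nat set"
  assumes I: "finite I" and polish: "\<And>i. i \<in> I \<Longrightarrow> polish_metric (\<Xi> i)"
begin

lemma path_topology_countable_box_base:
  "\<exists>\<B>. countable \<B> \<and> (\<forall>V\<in>\<B>. \<exists>B. V = PiE I B \<and> (\<forall>i\<in>I. openin (mtopology_of (\<Xi> i)) (B i))) \<and>
    (\<forall>U. openin (path_topology \<Xi> I) U \<longrightarrow> (\<exists>\<U>\<subseteq>\<B>. U = \<Union>\<U>))"
proof (rule product_topology_countable_box_base[OF I])
  show "second_countable (mtopology_of (\<Xi> i))" if "i \<in> I" for i
    by (rule polish_metric_second_countable[OF polish[OF that]])
next
  fix \<B>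
  assume *: "countable \<B>" "\<And>V. V \<in> \<B> \<Longrightarrow> \<exists>B. V = PiE I B \<and> (\<forall>i\<in>I. openin (mtopology_of (\<Xi> i)) (B i))"
    "\<And>U. openin (product_topology (\<lambda>i. mtopology_of (\<Xi> i)) I) U \<Longrightarrow> \<exists>\<U>\<subseteq>\<B>. U = \<Union>\<U>"
  show "\<exists>\<B>. countable \<B> \<and> (\<forall>V\<in>\<B>. \<exists>B. V = PiE I B \<and> (\<forall>i\<in>I. openin (mtopology_of (\<Xi> i)) (B i))) \<and>
    (\<forall>U. openin (path_topology \<Xi> I) U \<longrightarrow> (\<exists>\<U>\<subseteq>\<B>. U = \<Union>\<U>))"
    unfolding path_topology_def by (intro exI[of _ \<B>] conjI ballI allI impI *)
qed

text \<open>
  Separability enters here: an open set of the product is a countable union of boxes, so that the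
  Borel sets of the product topology are the product of the Borel sets.
\<close>

lemma sets_path_borel:
  "sets (path_borel \<Xi> I) = sets (PiM I (\<lambda>i. borel_of (mtopology_of (\<Xi> i))))" (is "?l = ?r")
proof
  obtain \<B> where \<B>: "countable \<B>"
    "\<forall>V\<in>\<B>. \<exists>B. V = PiE I B \<and> (\<forall>i\<in>I. openin (mtopology_of (\<Xi> i)) (B i))"
    "\<forall>U. openin (path_topology \<Xi> I) U \<longrightarrow> (\<exists>\<U>\<subseteq>\<B>. U = \<Union>\<U>)"
    using path_topology_countable_box_base by (elim exE conjE) (rule that)
  have "V \<in> ?r" if "V \<in> \<B>" for V
    using bspec[OF \<B>(2) that] I by (auto intro!: sets_PiM_I_finite borel_of_open)
  then have "U \<in> ?r" if U: "openin (path_topology \<Xi> I) U" for U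
  proof -
    obtain \<U> where "\<U> \<subseteq> \<B>" "U = \<Union>\<U>" using \<B>(3)[rule_format, OF U] by auto
    then show ?thesis
      using \<open>\<And>V. V \<in> \<B> \<Longrightarrow> V \<in> ?r\<close> countable_subset[OF _ \<B>(1)] by (auto intro!: sets.countable_Union)
  qed
  then show "?l \<subseteq> ?r"
    unfolding sets_borel_of
    by (intro sets.sigma_sets_subset' ) (auto simp: path_topology_def space_PiM
        intro!: sets_PiM_I_finite I borel_of_open openin_topspace[of "mtopology_of _", simplified])
  have "(\<lambda>x. x) \<in> path_borel \<Xi> I \<rightarrow>\<^sub>M PiM I (\<lambda>i. borel_of (mtopology_of (\<Xi> i)))"
  proof (rule measurable_PiM_single')
    show "(\<lambda>x. x i) \<in> path_borel \<Xi> I \<rightarrow>\<^sub>M borel_of (mtopology_of (\<Xi> i))" if "i \<in> I" for i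
      unfolding path_topology_def
      by (intro measurable_borel_of_continuous_map continuous_map_product_projection that)
  qed (auto simp: path_topology_def)
  then show "?r \<subseteq> ?l"
  proof -
    assume id: "(\<lambda>x. x) \<in> path_borel \<Xi> I \<rightarrow>\<^sub>M PiM I (\<lambda>i. borel_of (mtopology_of (\<Xi> i)))"
    show "?r \<subseteq> ?l"
    proof
      fix A assume A: "A \<in> ?r"
      then have "A \<subseteq> space (path_borel \<Xi> I)"
        using sets.sets_into_space[OF A] by (simp add: path_topology_def space_PiM)
      then show "A \<in> ?l" using measurable_sets[OF id A] by (simp add: Int_absorb2)
    qed
  qed
qed

text \<open>
  A countable generator that is stable under intersections reduces the almost sure equality of two
  kernels to countably many almost sure equalities of real functions.
\<close>

lemma path_borel_countable_generator:
  obtains \<G> where "countable \<G>" "Int_stable \<G>" "\<G> \<subseteq> sets (path_borel \<Xi> I)"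
    and "sets (path_borel \<Xi> I) = sigma_sets (space (path_borel \<Xi> I)) \<G>" "\<Union>\<G> = space (path_borel \<Xi> I)"
proof -
  let ?X = "path_topology \<Xi> I"
  obtain \<B> where \<B>: "countable \<B>"
    "\<forall>V\<in>\<B>. \<exists>B. V = PiE I B \<and> (\<forall>i\<in>I. openin (mtopology_of (\<Xi> i)) (B i))"
    "\<forall>U. openin (path_topology \<Xi> I) U \<longrightarrow> (\<exists>\<U>\<subseteq>\<B>. U = \<Union>\<U>)"
    using path_topology_countable_box_base by (elim exE conjE) (rule that)
  have B_sets: "V \<in> sets (path_borel \<Xi> I)" if "V \<in> \<B>" for V
    unfolding sets_path_borel using bspec[OF \<B>(2) that] I by (auto intro!: sets_PiM_I_finite borel_of_open)
  define \<G> where "\<G> = Inter ` {\<F>. finite \<F> \<and> \<F> \<subseteq> \<B> \<and> \<F> \<noteq> {}}"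
  have count: "countable \<G>"
    unfolding \<G>_def using countable_Collect_finite_subset[OF \<B>(1)]
    by (intro countable_image) (auto elim: countable_subset[rotated])
  have stable: "Int_stable \<G>"
  proof (rule Int_stableI)
    fix a b assume "a \<in> \<G>" "b \<in> \<G>"
    then obtain \<F> \<F>' where "finite \<F>" "\<F> \<subseteq> \<B>" "\<F> \<noteq> {}" "a = \<Inter>\<F>" "finite \<F>'" "\<F>' \<subseteq> \<B>" "\<F>' \<noteq> {}" "b = \<Inter>\<F>'"
      by (auto simp: \<G>_def)
    then show "a \<inter> b \<in> \<G>"
      unfolding \<G>_def by (intro image_eqI[of _ _ "\<F> \<union> \<F>'"]) auto
  qed
  have G_sets: "\<G> \<subseteq> sets (path_borel \<Xi> I)"
    using B_sets by (auto simp: \<G>_def intro!: sets.finite_INT[where A="\<lambda>V. V", simplified])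
  have "\<B> \<subseteq> \<G>"
  proof
    fix V assume "V \<in> \<B>"
    then show "V \<in> \<G>" unfolding \<G>_def by (intro image_eqI[of _ _ "{V}"]) auto
  qed
  have gen: "sets (path_borel \<Xi> I) = sigma_sets (space (path_borel \<Xi> I)) \<G>"
  proof
    show "sigma_sets (space (path_borel \<Xi> I)) \<G> \<subseteq> sets (path_borel \<Xi> I)"
      using G_sets by (rule sets.sigma_sets_subset)
    interpret s: sigma_algebra "space (path_borel \<Xi> I)" "sigma_sets (space (path_borel \<Xi> I)) \<G>"
      using G_sets sets.sets_into_space by (intro sigma_algebra_sigma_sets) blast
    have "U \<in> sigma_sets (space (path_borel \<Xi> I)) \<G>" if U: "openin ?X U" for U
    proof -
      obtain \<U> where \<U>: "\<U> \<subseteq> \<B>" "U = \<Union>\<U>" using \<B>(3)[rule_format, OF U] by auto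
      show ?thesis
        unfolding \<U>(2)
        using \<U>(1) \<open>\<B> \<subseteq> \<G>\<close> countable_subset[OF \<U>(1) \<B>(1)]
        by (intro s.countable_Union) (auto intro: sigma_sets.Basic)
    qed
    then show "sets (path_borel \<Xi> I) \<subseteq> sigma_sets (space (path_borel \<Xi> I)) \<G>"
      unfolding sets_borel_of[of ?X] space_borel_of by (intro sigma_sets_mono) auto
  qed
  have "\<Union>\<G> = space (path_borel \<Xi> I)"
  proof
    show "\<Union>\<G> \<subseteq> space (path_borel \<Xi> I)"
      using G_sets by (intro Union_least sets.sets_into_space) (rule subsetD)
    obtain \<U> where \<U>: "\<U> \<subseteq> \<B>" "topspace ?X = \<Union>\<U>"
      using \<B>(3)[rule_format, OF openin_topspace] by (elim exE conjE)
    show "space (path_borel \<Xi> I) \<subseteq> \<Union>\<G>"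
      unfolding space_borel_of \<U>(2) using \<U>(1) \<open>\<B> \<subseteq> \<G>\<close> by (intro Union_mono) (rule subset_trans)
  qed
  then show ?thesis by (rule that[OF count stable G_sets gen])
qed

end

section \<open>Laws of processes and their disintegrations\<close>

locale disintegrated_law =
  fixes \<Xi> :: "nat \<Rightarrow> 'a metric" and T :: nat and P :: "(nat \<Rightarrow> 'a) measure"
    and \<kappa> :: "nat \<Rightarrow> (nat \<Rightarrow> 'a) \<Rightarrow> (nat \<Rightarrow> 'a) measure"
  assumes polish: "\<And>t. t \<in> {1..T} \<Longrightarrow> polish_metric (\<Xi> t)"
    and prob_P: "prob_space P" and sets_P: "sets P = sets (path_borel \<Xi> {1..T})"
    and disint: "disintegration \<Xi> T P \<kappa>"
begin

abbreviation coord :: "nat \<Rightarrow> 'a measure" where "coord t \<equiv> borel_of (mtopology_of (\<Xi> t))"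

lemma topspace_path: "topspace (path_topology \<Xi> I) = PiE I (\<lambda>t. mspace (\<Xi> t))"
  by (simp add: path_topology_def)

lemma sets_path: "I \<subseteq> {1..T} \<Longrightarrow> sets (path_borel \<Xi> I) = sets (PiM I coord)"
  using polish by (intro sets_path_borel) (auto intro: finite_subset)

lemma measurable_path_restrict:
  "J \<subseteq> I \<Longrightarrow> I \<subseteq> {1..T} \<Longrightarrow> (\<lambda>x. restrict x J) \<in> path_borel \<Xi> I \<rightarrow>\<^sub>M path_borel \<Xi> J"
  using measurable_restrict_subset[of J I coord]
  by (subst measurable_cong_sets[OF sets_path sets_path]) auto

lemma measurable_path_component:
  "i \<in> I \<Longrightarrow> I \<subseteq> {1..T} \<Longrightarrow> (\<lambda>x. x i) \<in> path_borel \<Xi> I \<rightarrow>\<^sub>M coord i"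
  using measurable_component_singleton[of i I coord]
  by (subst measurable_cong_sets[OF sets_path refl]) auto

lemma measurable_path_extend:
  assumes "t < T" and f: "f \<in> M \<rightarrow>\<^sub>M path_borel \<Xi> {1..t}" and g: "g \<in> M \<rightarrow>\<^sub>M coord (t + 1)"
  shows "(\<lambda>\<omega>. (f \<omega>)(t + 1 := g \<omega>)) \<in> M \<rightarrow>\<^sub>M path_borel \<Xi> {1..t + 1}"
proof -
  have f': "f \<in> M \<rightarrow>\<^sub>M PiM {1..t} coord"
    using f assms(1) by (subst (asm) measurable_cong_sets[OF refl sets_path]) auto
  have "(\<lambda>\<omega>. (f \<omega>)(t + 1 := g \<omega>)) \<in> M \<rightarrow>\<^sub>M PiM {1..t + 1} coord"
    by (rule measurable_fun_upd[OF _ f' g]) auto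
  then show ?thesis using assms(1) by (subst measurable_cong_sets[OF refl sets_path]) auto
qed

lemma measurable_path_update:
  assumes "t < T" "x \<in> space (path_borel \<Xi> {1..t})"
  shows "(\<lambda>u. x(t + 1 := u)) \<in> coord (t + 1) \<rightarrow>\<^sub>M path_borel \<Xi> {1..t + 1}"
  using assms by (intro measurable_path_extend) auto

lemma prob_initial_law:
  assumes "t \<le> T" shows "prob_space (initial_law \<Xi> P t)"
proof -
  interpret prob_space P by (rule prob_P)
  show ?thesis
    unfolding initial_law_def using measurable_path_restrict[of "{1..t}" "{1..T}"] assms
    by (intro prob_space_distr) (simp cong: measurable_cong_sets add: sets_P)
qed

lemma sets_initial_law [simp]: "sets (initial_law \<Xi> P t) = sets (path_borel \<Xi> {1..t})"
  by (simp add: initial_law_def)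

lemma space_initial_law [simp]: "space (initial_law \<Xi> P t) = space (path_borel \<Xi> {1..t})"
  by (rule sets_eq_imp_space_eq) simp

lemma initial_law_T: "initial_law \<Xi> P T = P"
proof -
  have "initial_law \<Xi> P T = distr P P (\<lambda>x. x)"
    unfolding initial_law_def
    by (rule distr_cong)
      (auto simp: sets_P sets_eq_imp_space_eq[OF sets_P] topspace_path PiE_restrict)
  then show ?thesis by simp
qed

text \<open>
  The path space over the empty index set is a single point, so that almost sure statements hold
  there.
\<close>

lemma AE_initial_law_0D:
  assumes "AE x in initial_law \<Xi> P 0. R x"
  shows "R (\<lambda>_. undefined)"
proof -
  interpret I: prob_space "initial_law \<Xi> P 0" by (rule prob_initial_law) simp
  have "AE x in initial_law \<Xi> P 0. R (\<lambda>_. undefined)"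
    using assms AE_space by eventually_elim (simp add: topspace_path)
  then show ?thesis by (simp only: I.AE_const)
qed

lemma kernel:
  assumes "t < T"
  shows "\<kappa> t \<in> path_borel \<Xi> {1..t} \<rightarrow>\<^sub>M prob_algebra (path_borel \<Xi> {t+1..T})"
  using disint assms by (simp add: disintegration_def)

lemma prob_kernel:
  assumes "t < T" "x \<in> space (path_borel \<Xi> {1..t})"
  shows "prob_space (\<kappa> t x)" "sets (\<kappa> t x) = sets (path_borel \<Xi> {t+1..T})"
  using measurable_space[OF kernel[OF assms(1)] assms(2)] by (auto simp: space_prob_algebra)

lemma next_component_measurable:
  assumes "t < T" "x \<in> space (path_borel \<Xi> {1..t})"
  shows "(\<lambda>z. z (t + 1)) \<in> \<kappa> t x \<rightarrow>\<^sub>M coord (t + 1)"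
  using measurable_path_component[of "t+1" "{t+1..T}"] assms(1) prob_kernel(2)[OF assms]
  by (simp cong: measurable_cong_sets)

definition step_kernel :: "nat \<Rightarrow> (nat \<Rightarrow> 'a) \<Rightarrow> (nat \<Rightarrow> 'a) measure" where
  "step_kernel t x = distr (\<kappa> t x) (path_borel \<Xi> {1..t+1}) (\<lambda>z. x(t+1 := z (t+1)))"

lemma step_kernel_measurable:
  assumes "t < T"
  shows "step_kernel t \<in> path_borel \<Xi> {1..t} \<rightarrow>\<^sub>M subprob_algebra (path_borel \<Xi> {1..t+1})"
  unfolding step_kernel_def
proof (rule measurable_distr2)
  show "(\<lambda>(x, z). x(t+1 := z (t+1))) \<in> path_borel \<Xi> {1..t} \<Otimes>\<^sub>M path_borel \<Xi> {t+1..T} \<rightarrow>\<^sub>M path_borel \<Xi> {1..t+1}"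
    unfolding split_beta using assms
    by (intro measurable_path_extend measurable_compose[OF measurable_snd measurable_path_component]) auto
qed (intro measurable_prob_algebraD kernel assms)

lemma path_extend_in_space:
  assumes "t < T" "x \<in> space (path_borel \<Xi> {1..t})" "z \<in> space (path_borel \<Xi> {t+1..T})"
  shows "merge {1..t} {t+1..T} (x, z) \<in> space (path_borel \<Xi> {1..T})"
    and "restrict (merge {1..t} {t+1..T} (x, z)) {1..t+1} = x(t+1 := z (t+1))"
    and "restrict (merge {1..t} {t+1..T} (x, z)) {1..t} = x"
    and "restrict (merge {1..t} {t+1..T} (x, z)) {t+1..T} = z"
  using assms
  by (auto simp: topspace_path merge_def PiE_iff extensional_def fun_eq_iff restrict_def)

text \<open>
  The law of the first \<open>t + 1\<close> coordinates is the law of the first \<open>t\<close> coordinates followed by one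
  step of the kernel.  This is how the separate disintegrations for the different \<open>t\<close> fit together.
\<close>

lemma initial_law_Suc:
  assumes "t < T"
  shows "initial_law \<Xi> P (t+1) = initial_law \<Xi> P t \<bind> step_kernel t"
proof (rule measure_eqI)
  interpret I: prob_space "initial_law \<Xi> P t" using assms by (intro prob_initial_law) auto
  have K: "step_kernel t \<in> initial_law \<Xi> P t \<rightarrow>\<^sub>M subprob_algebra (path_borel \<Xi> {1..t+1})"
    using step_kernel_measurable[OF assms] by (simp cong: measurable_cong_sets)
  show "sets (initial_law \<Xi> P (t+1)) = sets (initial_law \<Xi> P t \<bind> step_kernel t)"
    using I.not_empty by (subst sets_bind[of _ _ "path_borel \<Xi> {1..t+1}"]) (auto simp: step_kernel_def)
  fix B assume "B \<in> sets (initial_law \<Xi> P (t+1))"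
  then have B: "B \<in> sets (path_borel \<Xi> {1..t+1})" by simp
  have restr: "(\<lambda>x. restrict x {1..t+1}) \<in> P \<rightarrow>\<^sub>M path_borel \<Xi> {1..t+1}"
    using measurable_path_restrict[of "{1..t+1}" "{1..T}"] assms by (simp cong: measurable_cong_sets add: sets_P)
  define A where "A = (\<lambda>x. restrict x {1..t+1}) -` B \<inter> space P"
  have A: "A \<in> sets (path_borel \<Xi> {1..T})"
    using measurable_sets[OF restr B] by (simp add: A_def sets_P)
  have "emeasure (initial_law \<Xi> P (t+1)) B = emeasure P A"
    unfolding initial_law_def A_def by (rule emeasure_distr[OF restr B])
  also have "\<dots> = (\<integral>\<^sup>+x. emeasure (\<kappa> t x) {z \<in> space (path_borel \<Xi> {t+1..T}). merge {1..t} {t+1..T} (x, z) \<in> A} \<partial>initial_law \<Xi> P t)"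
    using disint assms A unfolding disintegration_def by blast
  also have "\<dots> = (\<integral>\<^sup>+x. emeasure (step_kernel t x) B \<partial>initial_law \<Xi> P t)"
  proof (rule nn_integral_cong)
    fix x assume "x \<in> space (initial_law \<Xi> P t)"
    then have x: "x \<in> space (path_borel \<Xi> {1..t})" by simp
    have sp: "space (\<kappa> t x) = space (path_borel \<Xi> {t+1..T})"
      by (rule sets_eq_imp_space_eq[OF prob_kernel(2)[OF assms x]])
    have "emeasure (step_kernel t x) B = emeasure (\<kappa> t x) ((\<lambda>z. x(t+1 := z (t+1))) -` B \<inter> space (\<kappa> t x))"
      unfolding step_kernel_def
      using measurable_compose[OF next_component_measurable[OF assms x] measurable_path_update[OF assms x]] B
      by (intro emeasure_distr)
    also have "(\<lambda>z. x(t+1 := z (t+1))) -` B \<inter> space (\<kappa> t x)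
        = {z \<in> space (path_borel \<Xi> {t+1..T}). merge {1..t} {t+1..T} (x, z) \<in> A}"
      using path_extend_in_space[OF assms x] sets_eq_imp_space_eq[OF sets_P]
      by (auto simp: A_def sp)
    finally show "emeasure (\<kappa> t x) {z \<in> space (path_borel \<Xi> {t+1..T}). merge {1..t} {t+1..T} (x, z) \<in> A}
        = emeasure (step_kernel t x) B" by simp
  qed
  also have "\<dots> = emeasure (initial_law \<Xi> P t \<bind> step_kernel t) B"
    using I.not_empty K B by (intro emeasure_bind[symmetric])
  finally show "emeasure (initial_law \<Xi> P (t+1)) B = emeasure (initial_law \<Xi> P t \<bind> step_kernel t) B" .
qed

text \<open>
  Here \<open>R\<close> may fail to be measurable, so the exceptional set is enlarged to a measurable null set
  before Fubini's argument is applied to it.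
\<close>

lemma AE_initial_law_Suc:
  assumes "t < T" "AE y in initial_law \<Xi> P (t+1). R y"
  shows "AE x in initial_law \<Xi> P t. AE z in \<kappa> t x. R (x(t+1 := z (t+1)))"
proof -
  obtain N where N: "N \<in> null_sets (initial_law \<Xi> P (t+1))" "{y \<in> space (initial_law \<Xi> P (t+1)). \<not> R y} \<subseteq> N"
    using assms(2) by (auto simp: eventually_ae_filter)
  have N_sets: "N \<in> sets (path_borel \<Xi> {1..t+1})" using N(1) by auto
  have K: "step_kernel t \<in> initial_law \<Xi> P t \<rightarrow>\<^sub>M subprob_algebra (path_borel \<Xi> {1..t+1})"
    using step_kernel_measurable[OF assms(1)] by (simp cong: measurable_cong_sets)
  have "AE y in initial_law \<Xi> P t \<bind> step_kernel t. y \<notin> N"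
    using N(1) unfolding initial_law_Suc[OF assms(1), symmetric] by (rule AE_not_in)
  then have "AE x in initial_law \<Xi> P t. AE y in step_kernel t x. y \<notin> N"
    using N_sets by (subst (asm) AE_bind[OF K]) auto
  then show ?thesis
    using AE_space
  proof eventually_elim
    case (elim x)
    then have x: "x \<in> space (path_borel \<Xi> {1..t})" by simp
    have m: "(\<lambda>z. x(t+1 := z (t+1))) \<in> \<kappa> t x \<rightarrow>\<^sub>M path_borel \<Xi> {1..t+1}"
      by (rule measurable_compose[OF next_component_measurable[OF assms(1) x] measurable_path_update[OF assms(1) x]])
    have "AE z in \<kappa> t x. x(t+1 := z (t+1)) \<notin> N"
      using elim(1) unfolding step_kernel_def by (rule AE_distrD[OF m])
    then show ?case
      using AE_space
    proof eventually_elim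
      case (elim z)
      then show ?case using N(2) measurable_space[OF m] by auto
    qed
  qed
qed

lemma AE_next_law:
  assumes "t < T" "AE y in initial_law \<Xi> P (t+1). R y"
  shows "AE x in initial_law \<Xi> P t. AE u in next_law \<Xi> \<kappa> t x. R (x(t+1 := u))"
proof -
  obtain N where N: "N \<in> null_sets (initial_law \<Xi> P (t+1))" "{y \<in> space (initial_law \<Xi> P (t+1)). \<not> R y} \<subseteq> N"
    using assms(2) by (auto simp: eventually_ae_filter)
  have N_sets: "N \<in> sets (path_borel \<Xi> {1..t+1})" using N(1) by auto
  have "AE x in initial_law \<Xi> P t. AE z in \<kappa> t x. x(t+1 := z (t+1)) \<notin> N"
    using N(1) by (intro AE_initial_law_Suc assms(1) AE_not_in)
  then show ?thesis
    using AE_space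
  proof eventually_elim
    case (elim x)
    then have x: "x \<in> space (path_borel \<Xi> {1..t})" by simp
    note upd = measurable_path_update[OF assms(1) x]
    have "{u \<in> space (coord (t+1)). x(t+1 := u) \<notin> N} = (\<lambda>u. x(t+1 := u)) -` (space (path_borel \<Xi> {1..t+1}) - N) \<inter> space (coord (t+1))"
      using measurable_space[OF upd] by auto
    then have "{u \<in> space (coord (t+1)). x(t+1 := u) \<notin> N} \<in> sets (coord (t+1))"
      using measurable_sets[OF upd] N_sets by (metis sets.compl_sets)
    then have "AE u in next_law \<Xi> \<kappa> t x. x(t+1 := u) \<notin> N"
      using elim(1) unfolding next_law_def
      by (subst AE_distr_iff[OF next_component_measurable[OF assms(1) x]]) auto
    then show ?case
      using AE_space
    proof eventually_elim
      case (elim u)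
      then show ?case using N(2) measurable_space[OF upd, of u] by (auto simp: next_law_def)
    qed
  qed
qed

lemma nn_integral_initial_law_Suc:
  assumes "t < T" and [measurable]: "f \<in> borel_measurable (path_borel \<Xi> {1..t+1})"
  shows "(\<integral>\<^sup>+y. f y \<partial>initial_law \<Xi> P (t+1)) = (\<integral>\<^sup>+x. \<integral>\<^sup>+z. f (x(t+1 := z (t+1))) \<partial>\<kappa> t x \<partial>initial_law \<Xi> P t)"
proof -
  have K: "step_kernel t \<in> initial_law \<Xi> P t \<rightarrow>\<^sub>M subprob_algebra (path_borel \<Xi> {1..t+1})"
    using step_kernel_measurable[OF assms(1)] by (simp cong: measurable_cong_sets)
  show ?thesis
    unfolding initial_law_Suc[OF assms(1)] nn_integral_bind[OF assms(2) K]
  proof (rule nn_integral_cong)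
    fix x assume "x \<in> space (initial_law \<Xi> P t)"
    then have x: "x \<in> space (path_borel \<Xi> {1..t})" by simp
    show "(\<integral>\<^sup>+y. f y \<partial>step_kernel t x) = (\<integral>\<^sup>+z. f (x(t+1 := z (t+1))) \<partial>\<kappa> t x)"
      unfolding step_kernel_def
      using measurable_compose[OF next_component_measurable[OF assms(1) x] measurable_path_update[OF assms(1) x]] assms(2)
      by (simp add: nn_integral_distr)
  qed
qed

end

section \<open>Backward induction over the stages\<close>

lemma Hoelder_borel_measurable:
  fixes Y :: "'b \<Rightarrow> real"
  assumes "0 \<le> L" "0 < \<beta>"
    and Y: "\<And>x y. x \<in> mspace d \<Longrightarrow> y \<in> mspace d \<Longrightarrow> \<bar>Y x - Y y\<bar> \<le> L * mdist d x y powr \<beta>"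
  shows "Y \<in> borel_measurable (borel_of (mtopology_of d))"
proof (rule borel_measurableI)
  interpret Metric_space "mspace d" "mdist d" by simp
  fix U :: "real set" assume U: "open U"
  have "openin mtopology (Y -` U \<inter> mspace d)"
    unfolding openin_mtopology
  proof (intro conjI allI impI)
    fix x assume x: "x \<in> Y -` U \<inter> mspace d"
    then obtain e where e: "0 < e" "\<And>y. \<bar>y - Y x\<bar> < e \<Longrightarrow> y \<in> U"
      using U by (auto simp: open_real abs_minus_commute)
    define \<delta> where "\<delta> = (e / (L + 1)) powr (1 / \<beta>)"
    have \<delta>: "0 < \<delta>" "\<delta> powr \<beta> = e / (L + 1)" using e assms by (auto simp: \<delta>_def powr_powr)
    have "y \<in> Y -` U" if "y \<in> mball x \<delta>" for y
    proof -
      have "\<bar>Y y - Y x\<bar> \<le> L * mdist d y x powr \<beta>" using that x by (intro Y) auto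
      also have "\<dots> \<le> L * (e / (L + 1))"
        unfolding \<delta>(2)[symmetric] using that assms by (intro mult_left_mono powr_mono2) (auto simp: commute)
      also have "\<dots> < e" using e assms by (simp add: field_simps)
      finally show ?thesis using e by simp
    qed
    then show "\<exists>r>0. mball x r \<subseteq> Y -` U \<inter> mspace d"
      using \<delta> by (intro exI[of _ \<delta>]) auto
  qed auto
  then show "Y -` U \<inter> space (borel_of (mtopology_of d)) \<in> sets (borel_of (mtopology_of d))"
    by (simp add: borel_of_open mtopology_of_def)
qed

lemma stage_risk_last: "stage_risk T S \<kappa> Y T x = ereal (Y x)"
  by (subst stage_risk.simps) simp

lemma stage_risk_step: "t < T \<Longrightarrow> stage_risk T S \<kappa> Y t x =
    (SUP \<sigma>\<in>S (t+1). risk \<sigma> (\<kappa> t x) (\<lambda>z. stage_risk T S \<kappa> Y (t+1) (x(t+1 := z (t+1)))))"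
  by (subst stage_risk.simps) simp

lemma stage_risk_measurable:
  assumes "risks_finite \<Xi> T S P \<kappa> Y" "Y \<in> borel_measurable (path_borel \<Xi> {1..T})" "t \<le> T"
  shows "stage_risk T S \<kappa> Y t \<in> borel_measurable (path_borel \<Xi> {1..t})"
proof (cases "t = T")
  case True
  have "stage_risk T S \<kappa> Y T = (\<lambda>x. ereal (Y x))" by (simp add: stage_risk_last fun_eq_iff)
  then show ?thesis using assms True by simp
qed (use assms in \<open>auto simp: risks_finite_def\<close>)

text \<open>
  Backward induction over the stages.  The conditional risks are finite only almost surely, so the
  bound is claimed on sets \<open>G\<close>, \<open>G'\<close> of full measure.  The sets for stage \<open>t\<close> consist of the paths
  with finite conditional risk from which the next path lies almost surely in the set for stage
  \<open>t + 1\<close>.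
\<close>

lemma stage_risk_difference_le:
  fixes L \<beta> r :: real and q :: ennreal
  defines "k s \<equiv> \<lambda>S. (SUP \<sigma>\<in>S s. Lq_norm q \<sigma>)"
  assumes law: "disintegrated_law \<Xi> T P \<kappa>" and law': "disintegrated_law \<Xi> T P' \<kappa>'"
    and d: "mtopology_of d = path_topology \<Xi> {1..T}"
    and S: "\<And>t \<sigma>. t \<in> {1..T} \<Longrightarrow> \<sigma> \<in> S t \<Longrightarrow> distortion \<sigma>"
    and rq: "1 \<le> r" "1 < q" "1 / ennreal r + 1 / q = 1"
    and L: "0 \<le> L" and \<beta>: "0 < \<beta>" "\<beta> \<le> 1"
    and Y: "\<And>x y. x \<in> mspace d \<Longrightarrow> y \<in> mspace d \<Longrightarrow> \<bar>Y x - Y y\<bar> \<le> L * mdist d x y powr \<beta>"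
    and fin: "risks_finite \<Xi> T S P \<kappa> Y" and fin': "risks_finite \<Xi> T S P' \<kappa>' Y"
    and k: "L = 0 \<or> (\<forall>s\<in>{1..T}. k s S \<noteq> \<infinity>)"
    and "t \<le> T"
  shows "\<exists>G G'. (AE x in initial_law \<Xi> P t. x \<in> G) \<and> (AE y in initial_law \<Xi> P' t. y \<in> G') \<and>
    (\<forall>x\<in>G. \<bar>stage_risk T S \<kappa> Y t x\<bar> \<noteq> \<infinity>) \<and> (\<forall>y\<in>G'. \<bar>stage_risk T S \<kappa>' Y t y\<bar> \<noteq> \<infinity>) \<and>
    (\<forall>x\<in>G. \<forall>y\<in>G'. \<bar>stage_risk T S \<kappa> Y t x - stage_risk T S \<kappa>' Y t y\<bar>
      \<le> enn2ereal (ennreal L * (\<Prod>s\<in>{t+1..T}. k s S) * epowr (stage_cost r \<Xi> T d \<kappa> \<kappa>' t x y) \<beta>))"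
proof -
  interpret P: disintegrated_law \<Xi> T P \<kappa> by fact
  interpret P': disintegrated_law \<Xi> T P' \<kappa>' by fact
  have Y_meas: "Y \<in> borel_measurable (path_borel \<Xi> {1..T})"
    using Hoelder_borel_measurable[of L \<beta> d Y, OF L \<beta>(1) Y] by (simp add: d)
  show ?thesis
    using \<open>t \<le> T\<close>
  proof (induction rule: inc_induct)
    case base
    have sp: "topspace (path_topology \<Xi> {1..T}) = mspace d"
      by (metis d topspace_mtopology_of)
    have "\<bar>stage_risk T S \<kappa> Y T x - stage_risk T S \<kappa>' Y T y\<bar>
        \<le> enn2ereal (ennreal L * (\<Prod>s\<in>{T+1..T}. k s S) * epowr (stage_cost r \<Xi> T d \<kappa> \<kappa>' T x y) \<beta>)"
      if "x \<in> mspace d" "y \<in> mspace d" for x y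
    proof -
      have "stage_cost r \<Xi> T d \<kappa> \<kappa>' T x y = ennreal (mdist d x y)"
        by (subst stage_cost.simps) simp
      then show ?thesis
        using Y[OF that] L by (simp add: stage_risk_last ennreal_mult[symmetric] enn2ereal_ennreal)
    qed
    moreover have "AE x in initial_law \<Xi> P T. x \<in> mspace d" "AE x in initial_law \<Xi> P' T. x \<in> mspace d"
      by (rule AE_I2, simp only: P.space_initial_law P'.space_initial_law space_borel_of sp)+
    ultimately show ?case
      by (intro exI[of _ "mspace d"]) (simp add: stage_risk_last)
  next
    case (step t)
    from step.IH[unfolded Suc_eq_plus1] obtain G G' where G: "AE x in initial_law \<Xi> P (t+1). x \<in> G" "AE y in initial_law \<Xi> P' (t+1). y \<in> G'"
      "\<forall>x\<in>G. \<bar>stage_risk T S \<kappa> Y (t+1) x\<bar> \<noteq> \<infinity>" "\<forall>y\<in>G'. \<bar>stage_risk T S \<kappa>' Y (t+1) y\<bar> \<noteq> \<infinity>"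
      "\<forall>x\<in>G. \<forall>y\<in>G'. \<bar>stage_risk T S \<kappa> Y (t+1) x - stage_risk T S \<kappa>' Y (t+1) y\<bar>
        \<le> enn2ereal (ennreal L * (\<Prod>s\<in>{t+1+1..T}. k s S) * epowr (stage_cost r \<Xi> T d \<kappa> \<kappa>' (t+1) x y) \<beta>)"
      by (elim exE conjE) (rule that)
    have t: "t < T" "t + 1 \<le> T" "t + 1 \<in> {1..T}" using step.hyps by auto
    \<comment> \<open>The exceptional sets for the two processes stay separate, since no joint law of the two paths is given.\<close>
    define H where "H = {x \<in> space (path_borel \<Xi> {1..t}). \<bar>stage_risk T S \<kappa> Y t x\<bar> \<noteq> \<infinity> \<and> (AE u in next_law \<Xi> \<kappa> t x. x(t+1 := u) \<in> G)}"
    define H' where "H' = {y \<in> space (path_borel \<Xi> {1..t}). \<bar>stage_risk T S \<kappa>' Y t y\<bar> \<noteq> \<infinity> \<and> (AE v in next_law \<Xi> \<kappa>' t y. y(t+1 := v) \<in> G')}"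
    have "AE x in initial_law \<Xi> P t. \<bar>stage_risk T S \<kappa> Y t x\<bar> \<noteq> \<infinity>"
      using fin t by (simp add: risks_finite_def)
    then have "AE x in initial_law \<Xi> P t. x \<in> H"
      using P.AE_next_law[OF t(1) G(1)] AE_space by eventually_elim (simp add: H_def)
    moreover have "AE x in initial_law \<Xi> P' t. \<bar>stage_risk T S \<kappa>' Y t x\<bar> \<noteq> \<infinity>"
      using fin' t by (simp add: risks_finite_def)
    then have "AE x in initial_law \<Xi> P' t. x \<in> H'"
      using P'.AE_next_law[OF t(1) G(2)] AE_space by eventually_elim (simp add: H'_def)
    moreover have "\<bar>stage_risk T S \<kappa> Y t x - stage_risk T S \<kappa>' Y t y\<bar>
        \<le> enn2ereal (ennreal L * (\<Prod>s\<in>{t+1..T}. k s S) * epowr (stage_cost r \<Xi> T d \<kappa> \<kappa>' t x y) \<beta>)"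
      if "x \<in> H" "y \<in> H'" for x y
    proof -
      note hx = that(1)[unfolded H_def next_law_def mem_Collect_eq]
      note hy = that(2)[unfolded H'_def next_law_def mem_Collect_eq]
      have x: "x \<in> space (path_borel \<Xi> {1..t})" "\<bar>stage_risk T S \<kappa> Y t x\<bar> \<noteq> \<infinity>"
        "AE u in distr (\<kappa> t x) (P.coord (t+1)) (\<lambda>z. z (t+1)). u \<in> {u. x(t+1 := u) \<in> G}"
        unfolding mem_Collect_eq
        by (rule hx[THEN conjunct1] hx[THEN conjunct2, THEN conjunct1] hx[THEN conjunct2, THEN conjunct2])+
      have y: "y \<in> space (path_borel \<Xi> {1..t})" "\<bar>stage_risk T S \<kappa>' Y t y\<bar> \<noteq> \<infinity>"
        "AE v in distr (\<kappa>' t y) (P.coord (t+1)) (\<lambda>z. z (t+1)). v \<in> {v. y(t+1 := v) \<in> G'}"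
        unfolding mem_Collect_eq
        by (rule hy[THEN conjunct1] hy[THEN conjunct2, THEN conjunct1] hy[THEN conjunct2, THEN conjunct2])+
      let ?A = "ennreal L * (\<Prod>s\<in>{t+1+1..T}. k s S)"
      have A: "?A \<noteq> \<infinity>" "?A = 0 \<or> k (t+1) S \<noteq> \<infinity>"
        using k t by (auto simp: ennreal_mult_eq_top_iff ennreal_prod_eq_top)
      have cost: "stage_cost r \<Xi> T d \<kappa> \<kappa>' t x y = wasserstein r
          (distr (\<kappa> t x) (P.coord (t+1)) (\<lambda>z. z (t+1))) (distr (\<kappa>' t y) (P.coord (t+1)) (\<lambda>z. z (t+1)))
          (\<lambda>u v. stage_cost r \<Xi> T d \<kappa> \<kappa>' (t+1) (x(t+1 := u)) (y(t+1 := v)))"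
        using t by (subst stage_cost.simps) (simp add: next_law_def)
      have prod: "(\<Prod>s\<in>{t+1..T}. k s S) = k (t+1) S * (\<Prod>s\<in>{t+1+1..T}. k s S)"
        using t by (simp add: prod.atLeast_Suc_atMost)
      have "\<bar>stage_risk T S \<kappa> Y t x - stage_risk T S \<kappa>' Y t y\<bar>
          \<le> enn2ereal (k (t+1) S * ?A * epowr (stage_cost r \<Xi> T d \<kappa> \<kappa>' t x y) \<beta>)"
        unfolding cost k_def
      proof (rule one_stage_estimate[where p = "\<lambda>z. z (t+1)" and p' = "\<lambda>z. z (t+1)"
            and F = "\<lambda>u. stage_risk T S \<kappa> Y (t+1) (x(t+1 := u))" and F' = "\<lambda>v. stage_risk T S \<kappa>' Y (t+1) (y(t+1 := v))"])
        show "(\<lambda>u. stage_risk T S \<kappa> Y (t+1) (x(t+1 := u))) \<in> borel_measurable (P.coord (t+1))"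
          by (rule measurable_compose[OF P.measurable_path_update[OF t(1) x(1)] stage_risk_measurable[OF fin Y_meas t(2)]])
        show "(\<lambda>u. stage_risk T S \<kappa>' Y (t+1) (y(t+1 := u))) \<in> borel_measurable (P.coord (t+1))"
          by (rule measurable_compose[OF P.measurable_path_update[OF t(1) y(1)] stage_risk_measurable[OF fin' Y_meas t(2)]])
        show "stage_risk T S \<kappa> Y t x = (SUP \<sigma>\<in>S (t+1). risk \<sigma> (\<kappa> t x) (\<lambda>z. stage_risk T S \<kappa> Y (t+1) (x(t+1 := z (t+1)))))"
          by (rule stage_risk_step[OF t(1)])
        show "stage_risk T S \<kappa>' Y t y = (SUP \<sigma>\<in>S (t+1). risk \<sigma> (\<kappa>' t y) (\<lambda>z. stage_risk T S \<kappa>' Y (t+1) (y(t+1 := z (t+1)))))"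
          by (rule stage_risk_step[OF t(1)])
        show "ennreal L * (\<Prod>s\<in>{t+1+1..T}. SUP \<sigma>\<in>S s. Lq_norm q \<sigma>) \<noteq> \<infinity>"
          "ennreal L * (\<Prod>s\<in>{t+1+1..T}. SUP \<sigma>\<in>S s. Lq_norm q \<sigma>) = 0 \<or> (SUP \<sigma>\<in>S (t+1). Lq_norm q \<sigma>) \<noteq> \<infinity>"
          using A unfolding k_def by auto
        show "prob_space (\<kappa> t x)" "prob_space (\<kappa>' t y)"
          using P.prob_kernel(1) P'.prob_kernel(1) t x(1) y(1) by blast+
        show "(\<lambda>z. z (t+1)) \<in> \<kappa> t x \<rightarrow>\<^sub>M P.coord (t+1)" "(\<lambda>z. z (t+1)) \<in> \<kappa>' t y \<rightarrow>\<^sub>M P.coord (t+1)"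
          by (rule P.next_component_measurable[OF t(1) x(1)] P'.next_component_measurable[OF t(1) y(1)])+
        show "\<And>\<sigma>. \<sigma> \<in> S (t+1) \<Longrightarrow> distortion \<sigma>" by (rule S[OF t(3)])
        show "\<bar>stage_risk T S \<kappa> Y (t+1) (x(t+1 := u))\<bar> \<noteq> \<infinity>" if "u \<in> {u. x(t+1 := u) \<in> G}" for u
          by (rule bspec[OF G(3) that[unfolded mem_Collect_eq]])
        show "\<bar>stage_risk T S \<kappa>' Y (t+1) (y(t+1 := v))\<bar> \<noteq> \<infinity>" if "v \<in> {v. y(t+1 := v) \<in> G'}" for v
          by (rule bspec[OF G(4) that[unfolded mem_Collect_eq]])
        show "\<bar>stage_risk T S \<kappa> Y (t+1) (x(t+1 := u)) - stage_risk T S \<kappa>' Y (t+1) (y(t+1 := v))\<bar>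
          \<le> enn2ereal (ennreal L * (\<Prod>s\<in>{t+1+1..T}. SUP \<sigma>\<in>S s. Lq_norm q \<sigma>)
            * epowr (stage_cost r \<Xi> T d \<kappa> \<kappa>' (t+1) (x(t+1 := u)) (y(t+1 := v))) \<beta>)"
          if "u \<in> {u. x(t+1 := u) \<in> G}" "v \<in> {v. y(t+1 := v) \<in> G'}" for u v
          by (rule bspec[OF bspec[OF G(5) that(1)[unfolded mem_Collect_eq]] that(2)[unfolded mem_Collect_eq], unfolded k_def])
      qed (fact x y rq \<beta>)+
      then show ?thesis unfolding prod by (simp only: mult_ac)
    qed
    ultimately show ?case
      by (intro exI[of _ H] exI[of _ H']) (auto simp: H_def H'_def)
  qed
qed

lemma nested_risk_difference_le:
  fixes L \<beta> r :: real and q :: ennreal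
  assumes law: "disintegrated_law \<Xi> T P \<kappa>" and law': "disintegrated_law \<Xi> T P' \<kappa>'"
    and d: "mtopology_of d = path_topology \<Xi> {1..T}"
    and S: "\<And>t \<sigma>. t \<in> {1..T} \<Longrightarrow> \<sigma> \<in> S t \<Longrightarrow> distortion \<sigma>"
    and rq: "1 \<le> r" "1 < q" "1 / ennreal r + 1 / q = 1"
    and L: "0 \<le> L" and \<beta>: "0 < \<beta>" "\<beta> \<le> 1"
    and Y: "\<And>x y. x \<in> mspace d \<Longrightarrow> y \<in> mspace d \<Longrightarrow> \<bar>Y x - Y y\<bar> \<le> L * mdist d x y powr \<beta>"
    and fin: "risks_finite \<Xi> T S P \<kappa> Y" and fin': "risks_finite \<Xi> T S P' \<kappa>' Y"
    and k: "L = 0 \<or> (\<forall>s\<in>{1..T}. (SUP \<sigma>\<in>S s. Lq_norm q \<sigma>) \<noteq> \<infinity>)"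
  shows "\<bar>nested_risk T S \<kappa> Y - nested_risk T S \<kappa>' Y\<bar>
    \<le> enn2ereal (ennreal L * (\<Prod>s\<in>{1..T}. SUP \<sigma>\<in>S s. Lq_norm q \<sigma>) * epowr (nested_dist r \<Xi> T d \<kappa> \<kappa>') \<beta>)"
proof -
  interpret P: disintegrated_law \<Xi> T P \<kappa> by fact
  interpret P': disintegrated_law \<Xi> T P' \<kappa>' by fact
  have "\<exists>G G'. (AE x in initial_law \<Xi> P 0. x \<in> G) \<and> (AE y in initial_law \<Xi> P' 0. y \<in> G') \<and>
    (\<forall>x\<in>G. \<bar>stage_risk T S \<kappa> Y 0 x\<bar> \<noteq> \<infinity>) \<and> (\<forall>y\<in>G'. \<bar>stage_risk T S \<kappa>' Y 0 y\<bar> \<noteq> \<infinity>) \<and>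
    (\<forall>x\<in>G. \<forall>y\<in>G'. \<bar>stage_risk T S \<kappa> Y 0 x - stage_risk T S \<kappa>' Y 0 y\<bar>
      \<le> enn2ereal (ennreal L * (\<Prod>s\<in>{0+1..T}. SUP \<sigma>\<in>S s. Lq_norm q \<sigma>) * epowr (stage_cost r \<Xi> T d \<kappa> \<kappa>' 0 x y) \<beta>))"
    by (rule stage_risk_difference_le[OF law law' d _ rq L \<beta> _ fin fin' k le0]) (fact S Y)+
  then obtain G G' where G: "AE x in initial_law \<Xi> P 0. x \<in> G" "AE y in initial_law \<Xi> P' 0. y \<in> G'"
    and bound: "\<forall>x\<in>G. \<forall>y\<in>G'. \<bar>stage_risk T S \<kappa> Y 0 x - stage_risk T S \<kappa>' Y 0 y\<bar>
      \<le> enn2ereal (ennreal L * (\<Prod>s\<in>{0+1..T}. SUP \<sigma>\<in>S s. Lq_norm q \<sigma>) * epowr (stage_cost r \<Xi> T d \<kappa> \<kappa>' 0 x y) \<beta>)"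
    by (elim exE conjE) (rule that)
  show ?thesis
    unfolding nested_risk_def nested_dist_def
    using bspec[OF bspec[OF bound P.AE_initial_law_0D[OF G(1)]] P'.AE_initial_law_0D[OF G(2)]] by (simp only: add_0)
qed

section \<open>The risk-neutral functional\<close>

lemma distortion_one: "distortion (\<lambda>_. 1)"
proof -
  interpret prob_space unit_leb by (rule prob_space_unit_leb)
  show ?thesis using emeasure_space_1 by (simp add: distortion_def mono_on_def)
qed

lemma Lq_norm_one: "1 < q \<Longrightarrow> Lq_norm q (\<lambda>_. 1) = 1"
proof -
  interpret prob_space unit_leb by (rule prob_space_unit_leb)
  assume "1 < q"
  then show ?thesis
    using emeasure_space_1 esssup_const[of unit_leb "1::ennreal"]
    by (simp add: Lq_norm_def epowr_def)
qed

text \<open>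
  For the constant distortion function the stop-loss order at \<open>c = 1\<close> forces \<open>\<zeta> \<le> 1\<close>, hence
  \<open>\<zeta> = 1\<close> almost surely: the risk-neutral functional is the expectation.
\<close>

lemma risk_one:
  assumes "prob_space M"
  shows "risk (\<lambda>_. 1) M Z = expect M Z"
proof -
  interpret prob_space M by fact
  interpret U: prob_space unit_leb by (rule prob_space_unit_leb)
  have eq: "expect M (\<lambda>\<omega>. Z \<omega> * ereal (\<zeta> \<omega>)) = expect M Z" if feas: "\<zeta> \<in> feasible (\<lambda>_. 1) M" for \<zeta>
  proof -
    note \<zeta> = feasibleD[OF feas]
    have "(LINT \<omega>|M. max (\<zeta> \<omega> - 1) 0) \<le> 0"
      using feasible_stop_loss[OF assms distortion_one feas, of 1] by simp
    then have "(LINT \<omega>|M. max (\<zeta> \<omega> - 1) 0) = 0"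
      by (intro antisym) (auto intro!: integral_nonneg)
    then have "AE \<omega> in M. max (\<zeta> \<omega> - 1) 0 = 0"
      using \<zeta>(3) by (subst (asm) integral_nonneg_eq_0_iff_AE) auto
    then have le: "AE \<omega> in M. 0 \<le> 1 - \<zeta> \<omega>" by eventually_elim (auto simp: max_def split: if_splits)
    have "(LINT \<omega>|M. 1 - \<zeta> \<omega>) = 0" using \<zeta>(3,4) by (simp add: prob_space)
    then have "AE \<omega> in M. 1 - \<zeta> \<omega> = 0"
      using \<zeta>(3) le by (subst (asm) integral_nonneg_eq_0_iff_AE) auto
    then have one: "AE \<omega> in M. \<zeta> \<omega> = 1" by eventually_elim simp
    show ?thesis
      unfolding expect_def using one
      by (intro arg_cong2[where f="(-)"] arg_cong[where f=enn2ereal] nn_integral_cong_AE; eventually_elim) auto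
  qed
  have "(\<lambda>_. 1) \<in> feasible (\<lambda>_. 1) M"
  proof -
    have "AVaR \<alpha> M (\<lambda>_. 1) \<le> ereal (1 / (1 - \<alpha>) * (LBINT u:{\<alpha>..<1}. 1))" if "\<alpha> \<in> {0<..<1}" for \<alpha> :: real
    proof -
      have "AVaR \<alpha> M (\<lambda>_. 1) \<le> ereal (1 + 1 / (1 - \<alpha>) * (LINT \<omega>|M. max (1 - 1) 0))"
        unfolding AVaR_eq_INF_real[OF assms integrable_const] by (rule INF_lower) simp
      also have "\<dots> = ereal (1 / (1 - \<alpha>) * (LBINT u:{\<alpha>..<1}. 1))"
        using that by (simp add: set_lebesgue_integral_def)
      finally show ?thesis .
    qed
    moreover have "expect M (\<lambda>\<omega>. ereal 1) = 1"
      by (subst expect_integrable_nonneg) (auto simp: prob_space)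
    ultimately show ?thesis by (simp add: feasible_def)
  qed
  then show ?thesis
    unfolding risk_def using eq by (auto intro!: antisym SUP_least SUP_upper2)
qed

lemma expect_unit_interval:
  assumes "\<And>\<omega>. \<omega> \<in> space M \<Longrightarrow> 0 \<le> Z \<omega> \<and> Z \<omega> \<le> 1" "prob_space M"
  shows "0 \<le> expect M Z \<and> expect M Z \<le> 1"
proof -
  interpret prob_space M by fact
  have "(\<integral>\<^sup>+\<omega>. e2ennreal (Z \<omega>) \<partial>M) \<le> (\<integral>\<^sup>+\<omega>. 1 \<partial>M)"
    using assms by (intro nn_integral_mono) (metis e2ennreal_ereal e2ennreal_mono ennreal_1 one_ereal_def)
  then have "(\<integral>\<^sup>+\<omega>. e2ennreal (Z \<omega>) \<partial>M) \<le> 1" by (simp add: emeasure_space_1)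
  then show ?thesis
    using assms(1) by (auto simp: expect_nonneg less_eq_ennreal.rep_eq one_ennreal.rep_eq)
qed

context disintegrated_law
begin

text \<open>
  For the constant distortion function the nested functional is, by the tower property, the
  expectation.
\<close>

lemma stage_risk_expectation:
  assumes f: "f \<in> borel_measurable (path_borel \<Xi> {1..T})" "\<And>x. x \<in> space (path_borel \<Xi> {1..T}) \<Longrightarrow> 0 \<le> f x \<and> f x \<le> 1"
    and "t \<le> T"
  defines "V \<equiv> stage_risk T (\<lambda>_. {\<lambda>_. 1}) \<kappa> f"
  shows "V t \<in> borel_measurable (path_borel \<Xi> {1..t}) \<and> (\<forall>x\<in>space (path_borel \<Xi> {1..t}). 0 \<le> V t x \<and> V t x \<le> 1)
    \<and> (\<integral>\<^sup>+x. e2ennreal (V t x) \<partial>initial_law \<Xi> P t) = (\<integral>\<^sup>+x. ennreal (f x) \<partial>P)"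
  using assms(3)
proof (induction rule: inc_induct)
  case base
  have V: "V T = (\<lambda>x. ereal (f x))" by (simp add: V_def stage_risk_last fun_eq_iff)
  show ?case unfolding V initial_law_T using f by (auto simp: one_ereal_def zero_ereal_def)
next
  case (step t)
  note t = step.hyps(2)
  have meas: "V (t+1) \<in> borel_measurable (path_borel \<Xi> {1..t+1})"
    and bnd: "\<And>x. x \<in> space (path_borel \<Xi> {1..t+1}) \<Longrightarrow> 0 \<le> V (t+1) x \<and> V (t+1) x \<le> 1"
    and int: "(\<integral>\<^sup>+x. e2ennreal (V (t+1) x) \<partial>initial_law \<Xi> P (t+1)) = (\<integral>\<^sup>+x. ennreal (f x) \<partial>P)"
    using step.IH unfolding Suc_eq_plus1 by blast+
  have V: "V t x = expect (\<kappa> t x) (\<lambda>z. V (t+1) (x(t+1 := z (t+1))))" if "x \<in> space (path_borel \<Xi> {1..t})" for x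
    unfolding V_def stage_risk_step[OF t] using risk_one[OF prob_kernel(1)[OF t that]] by simp
  have sp: "x(t+1 := z (t+1)) \<in> space (path_borel \<Xi> {1..t+1})"
    if "x \<in> space (path_borel \<Xi> {1..t})" "z \<in> space (\<kappa> t x)" for x z
    by (rule measurable_space[OF measurable_path_update[OF t that(1)] measurable_space[OF next_component_measurable[OF t that(1)] that(2)]])
  have bnd_t: "0 \<le> V t x \<and> V t x \<le> 1" if x: "x \<in> space (path_borel \<Xi> {1..t})" for x
    unfolding V[OF x]
  proof (rule expect_unit_interval)
    show "0 \<le> V (t+1) (x(t+1 := z (t+1))) \<and> V (t+1) (x(t+1 := z (t+1))) \<le> 1" if "z \<in> space (\<kappa> t x)" for z
      by (rule bnd[OF sp[OF x that]])
  qed (rule prob_kernel(1)[OF t x])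
  have V': "V t x = enn2ereal (\<integral>\<^sup>+z. e2ennreal (V (t+1) (x(t+1 := z (t+1)))) \<partial>\<kappa> t x)"
    if x: "x \<in> space (path_borel \<Xi> {1..t})" for x
    unfolding V[OF x]
  proof (rule expect_nonneg)
    show "0 \<le> V (t+1) (x(t+1 := z (t+1)))" if "z \<in> space (\<kappa> t x)" for z
      using bnd[OF sp[OF x that]] by (rule conjunct1)
  qed
  have "(\<lambda>x. \<integral>\<^sup>+z. e2ennreal (V (t+1) (x(t+1 := z (t+1)))) \<partial>\<kappa> t x) \<in> borel_measurable (path_borel \<Xi> {1..t})"
  proof (rule nn_integral_measurable_subprob_algebra2)
    show "(\<lambda>(x, z). e2ennreal (V (t+1) (x(t+1 := z (t+1))))) \<in> borel_measurable (path_borel \<Xi> {1..t} \<Otimes>\<^sub>M path_borel \<Xi> {t+1..T})"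
      unfolding split_beta using t
      by (intro measurable_compose[OF _ measurable_e2ennreal] measurable_compose[OF _ meas]
          measurable_path_extend measurable_compose[OF measurable_snd measurable_path_component]) auto
  qed (intro measurable_prob_algebraD kernel t)
  then have "(\<lambda>x. enn2ereal (\<integral>\<^sup>+z. e2ennreal (V (t+1) (x(t+1 := z (t+1)))) \<partial>\<kappa> t x)) \<in> borel_measurable (path_borel \<Xi> {1..t})"
    by simp
  then have "V t \<in> borel_measurable (path_borel \<Xi> {1..t})"
    using V' by (subst measurable_cong) auto
  moreover have "(\<integral>\<^sup>+x. e2ennreal (V t x) \<partial>initial_law \<Xi> P t) = (\<integral>\<^sup>+x. e2ennreal (V (t+1) x) \<partial>initial_law \<Xi> P (t+1))"
    using V' measurable_compose[OF meas measurable_e2ennreal]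
    by (subst nn_integral_initial_law_Suc[OF t]) (auto intro!: nn_integral_cong)
  ultimately show ?case using bnd_t int by simp
qed

lemma nested_risk_expectation:
  assumes f: "f \<in> borel_measurable (path_borel \<Xi> {1..T})" "\<And>x. x \<in> space (path_borel \<Xi> {1..T}) \<Longrightarrow> 0 \<le> f x \<and> f x \<le> 1"
  shows "nested_risk T (\<lambda>_. {\<lambda>_. 1}) \<kappa> f = enn2ereal (\<integral>\<^sup>+x. ennreal (f x) \<partial>P)"
    and "risks_finite \<Xi> T (\<lambda>_. {\<lambda>_. 1}) P \<kappa> f"
proof -
  let ?V = "stage_risk T (\<lambda>_. {\<lambda>_. 1}) \<kappa> f"
  interpret I: prob_space "initial_law \<Xi> P 0" by (rule prob_initial_law) simp
  have sp: "space (path_borel \<Xi> {1..0}) = {\<lambda>_. undefined}" by (simp add: topspace_path)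
  have E: "?V t \<in> borel_measurable (path_borel \<Xi> {1..t}) \<and> (\<forall>x\<in>space (path_borel \<Xi> {1..t}). 0 \<le> ?V t x \<and> ?V t x \<le> 1)
    \<and> (\<integral>\<^sup>+x. e2ennreal (?V t x) \<partial>initial_law \<Xi> P t) = (\<integral>\<^sup>+x. ennreal (f x) \<partial>P)" if "t \<le> T" for t
    by (rule stage_risk_expectation[OF f(1) _ that]) (rule f(2))
  have "(\<integral>\<^sup>+x. ennreal (f x) \<partial>P) = (\<integral>\<^sup>+x. e2ennreal (?V 0 x) \<partial>initial_law \<Xi> P 0)"
    using E[of 0] by simp
  also have "\<dots> = (\<integral>\<^sup>+x. e2ennreal (?V 0 (\<lambda>_. undefined)) \<partial>initial_law \<Xi> P 0)"
    using sp by (intro nn_integral_cong) simp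
  also have "\<dots> = e2ennreal (?V 0 (\<lambda>_. undefined))" by (simp add: I.emeasure_space_1 del: space_initial_law)
  finally show "nested_risk T (\<lambda>_. {\<lambda>_. 1}) \<kappa> f = enn2ereal (\<integral>\<^sup>+x. ennreal (f x) \<partial>P)"
    using E[of 0] sp by (simp add: nested_risk_def enn2ereal_e2ennreal)
  show "risks_finite \<Xi> T (\<lambda>_. {\<lambda>_. 1}) P \<kappa> f"
    unfolding risks_finite_def
  proof (intro allI impI conjI AE_I2)
    fix t x assume t: "t < T"
    show "?V t \<in> borel_measurable (path_borel \<Xi> {1..t})" using E[of t] t by auto
    assume "x \<in> space (initial_law \<Xi> P t)"
    then have "0 \<le> ?V t x \<and> ?V t x \<le> 1" using E[of t] t by auto
    then show "\<bar>?V t x\<bar> \<noteq> \<infinity>" by auto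
  qed
qed

end

section \<open>Processes at nested distance zero\<close>

lemma (in Metric_space) Lipschitz_dist_to_set:
  assumes "C \<subseteq> M" "C \<noteq> {}" "x \<in> M" "y \<in> M"
  shows "\<bar>(INF a\<in>C. d x a) - (INF a\<in>C. d y a)\<bar> \<le> d x y"
proof -
  have le: "(INF a\<in>C. d u a) \<le> d u v + (INF a\<in>C. d v a)" if "u \<in> M" "v \<in> M" for u v
  proof -
    have "(INF a\<in>C. d u a) - d u v \<le> (INF a\<in>C. d v a)"
    proof (rule cINF_greatest[OF assms(2)])
      fix a assume a: "a \<in> C"
      have "(INF a\<in>C. d u a) \<le> d u a" using a by (intro cINF_lower bdd_belowI2[of _ 0]) auto
      also have "\<dots> \<le> d u v + d v a" using a assms that by (intro triangle) auto
      finally show "(INF a\<in>C. d u a) - d u v \<le> d v a" by simp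
    qed
    then show ?thesis by simp
  qed
  show ?thesis using le[OF assms(3,4)] le[OF assms(4,3)] by (simp add: commute abs_le_iff)
qed

text \<open>
  The indicator of an open set is the increasing limit of the Lipschitz functions
  \<open>x \<mapsto> min 1 (n \<cdot> dist (x, C))\<close>, where \<open>C\<close> is the complement.
\<close>

lemma measure_eq_if_Lipschitz_integrals_eq:
  assumes P: "prob_space P" "sets P = sets (borel_of (mtopology_of m))"
    and P': "prob_space P'" "sets P' = sets (borel_of (mtopology_of m))"
    and eq: "\<And>(f :: 'b \<Rightarrow> real) L. f \<in> borel_measurable (borel_of (mtopology_of m)) \<Longrightarrow> (\<And>x. 0 \<le> f x \<and> f x \<le> 1) \<Longrightarrow> 0 \<le> L \<Longrightarrow>
      (\<And>x y. x \<in> mspace m \<Longrightarrow> y \<in> mspace m \<Longrightarrow> \<bar>f x - f y\<bar> \<le> L * mdist m x y) \<Longrightarrow>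
      (\<integral>\<^sup>+x. ennreal (f x) \<partial>P) = (\<integral>\<^sup>+x. ennreal (f x) \<partial>P')"
  shows "P = P'"
proof -
  interpret P: prob_space P by fact
  interpret P': prob_space P' by fact
  interpret Metric_space "mspace m" "mdist m" by simp
  have sp: "space P = mspace m" "space P' = mspace m"
    using sets_eq_imp_space_eq[OF P(2)] sets_eq_imp_space_eq[OF P'(2)] by auto
  have sets_cong: "borel_measurable P = borel_measurable (borel_of (mtopology_of m))"
    "borel_measurable P' = borel_measurable (borel_of (mtopology_of m))"
    using P(2) P'(2) by (auto intro!: measurable_cong_sets)
  have "emeasure P U = emeasure P' U" if U: "openin (mtopology_of m) U" for U
  proof (cases "U = mspace m")
    case True
    then show ?thesis using P.emeasure_space_1 P'.emeasure_space_1 sp by simp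
  next
    case False
    have Us: "U \<subseteq> mspace m" using openin_subset[OF U] by simp
    define C where "C = mspace m - U"
    define g where "g x = (INF a\<in>C. mdist m x a)" for x
    have C: "C \<subseteq> mspace m" "C \<noteq> {}" using False Us by (auto simp: C_def)
    have g0: "0 \<le> g x" for x unfolding g_def using C by (intro cINF_greatest) auto
    have g_pos: "0 < g x" if x: "x \<in> U" for x
    proof -
      obtain e where e: "0 < e" "mball x e \<subseteq> U"
        using U x unfolding mtopology_of_def openin_mtopology by blast
      have "e \<le> g x"
        unfolding g_def
      proof (rule cINF_greatest[OF C(2)])
        fix a assume a: "a \<in> C"
        then have "a \<notin> mball x e" using e by (auto simp: C_def)
        then show "e \<le> mdist m x a" using a x Us by (auto simp: C_def)
      qed
      then show ?thesis using e by simp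
    qed
    have g_zero: "g x = 0" if "x \<in> C" for x
    proof -
      have "g x \<le> mdist m x x" unfolding g_def using that by (intro cINF_lower bdd_belowI2[of _ 0]) auto
      then show ?thesis using g0[of x] that by (simp add: C_def)
    qed
    define f where "f n x = min 1 (real n * g x)" for n :: nat and x
    have f01: "0 \<le> f n x \<and> f n x \<le> 1" for n x using g0 by (simp add: f_def)
    have f_Lip: "\<bar>f n x - f n y\<bar> \<le> real n * mdist m x y" if "x \<in> mspace m" "y \<in> mspace m" for n x y
    proof -
      have "\<bar>f n x - f n y\<bar> \<le> \<bar>real n * g x - real n * g y\<bar>" by (simp add: f_def min_def abs_if)
      also have "\<dots> = real n * \<bar>g x - g y\<bar>" by (simp add: abs_mult flip: right_diff_distrib)
      also have "\<dots> \<le> real n * mdist m x y"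
        unfolding g_def using Lipschitz_dist_to_set[OF C that] by (intro mult_left_mono) auto
      finally show ?thesis .
    qed
    have f_meas: "f n \<in> borel_measurable (borel_of (mtopology_of m))" for n
      using f_Lip by (intro Hoelder_borel_measurable[where L="real n" and \<beta>=1]) auto
    have f_eq: "(\<integral>\<^sup>+x. ennreal (f n x) \<partial>P) = (\<integral>\<^sup>+x. ennreal (f n x) \<partial>P')" for n
      by (rule eq[OF f_meas f01 _ f_Lip]) auto
    have inc: "incseq (\<lambda>n x. ennreal (f n x))"
      by (auto simp: incseq_def le_fun_def f_def intro!: ennreal_leI min.mono mult_right_mono g0)
    have sup: "(SUP n. ennreal (f n x)) = indicator U x" if "x \<in> mspace m" for x
    proof (cases "x \<in> U")
      case True
      obtain n :: nat where "1 / g x < real n" using reals_Archimedean2 by blast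
      then have "f n x = 1" using g_pos[OF True] by (simp add: f_def field_simps)
      then show ?thesis
        using True f01 by (intro antisym SUP_least) (auto intro!: SUP_upper2[of n])
    next
      case False
      then have "f n x = 0" for n using that g_zero[of x] by (simp add: f_def C_def)
      then show ?thesis using False by simp
    qed
    have "emeasure Q U = (SUP n. \<integral>\<^sup>+x. ennreal (f n x) \<partial>Q)"
      if Q: "sets Q = sets (borel_of (mtopology_of m))" for Q
    proof -
      have spQ: "space Q = mspace m" using sets_eq_imp_space_eq[OF Q] by simp
      have "emeasure Q U = (\<integral>\<^sup>+x. indicator U x \<partial>Q)" using borel_of_open[OF U] Q by simp
      also have "\<dots> = (\<integral>\<^sup>+x. (SUP n. ennreal (f n x)) \<partial>Q)"
        using spQ by (intro nn_integral_cong) (simp add: sup)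
      also have "\<dots> = (SUP n. \<integral>\<^sup>+x. ennreal (f n x) \<partial>Q)"
      proof (rule nn_integral_monotone_convergence_SUP[OF inc])
        show "(\<lambda>x. ennreal (f n x)) \<in> borel_measurable Q" for n
          using f_meas[of n] by (simp cong: measurable_cong_sets add: Q)
      qed
      finally show ?thesis .
    qed
    then show ?thesis using P(2) P'(2) f_eq by simp
  qed
  note open_eq = this
  show ?thesis
  proof (rule measure_eqI_generator_eq_countable[where \<Omega>="mspace m" and E="{U. openin (mtopology_of m) U}" and A="{mspace m}"])
    show "Int_stable {U. openin (mtopology_of m) U}" by (auto simp: Int_stable_def)
    show "{mspace m} \<subseteq> {U. openin (mtopology_of m) U}" using openin_topspace[of "mtopology_of m"] by simp
  qed (use open_eq P P' openin_subset in \<open>force simp: sets_borel_of\<close>)+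
qed

text \<open>
  Both kernels integrate over a measurable set of initial paths to the same joint probability, so
  they agree almost surely on each set of a countable generator.
\<close>

lemma kernels_AE_unique:
  assumes "disintegrated_law \<Xi> T P \<kappa>" "disintegrated_law \<Xi> T P \<kappa>'" "t < T"
  shows "AE x in initial_law \<Xi> P t. \<kappa> t x = \<kappa>' t x"
proof -
  interpret P: disintegrated_law \<Xi> T P \<kappa> by fact
  interpret P': disintegrated_law \<Xi> T P \<kappa>' by fact
  interpret I: prob_space "initial_law \<Xi> P t" using assms(3) by (intro P.prob_initial_law) simp
  let ?J = "{t+1..T}"
  have fJ: "finite ?J" and pJ: "\<And>i. i \<in> ?J \<Longrightarrow> polish_metric (\<Xi> i)" using P.polish by auto
  obtain \<G> where \<G>: "countable \<G>" "Int_stable \<G>" "\<G> \<subseteq> sets (path_borel \<Xi> ?J)"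
    "sets (path_borel \<Xi> ?J) = sigma_sets (space (path_borel \<Xi> ?J)) \<G>" "\<Union>\<G> = space (path_borel \<Xi> ?J)"
    by (rule path_borel_countable_generator[OF fJ pJ])
  have restr: "(\<lambda>x. restrict x J) \<in> P \<rightarrow>\<^sub>M path_borel \<Xi> J" if "J \<subseteq> {1..T}" for J
    using P.measurable_path_restrict[OF that] by (simp cong: measurable_cong_sets add: P.sets_P)
  have joint: "(\<integral>\<^sup>+x. emeasure (k t x) A * indicator B x \<partial>initial_law \<Xi> P t)
      = emeasure P ((\<lambda>x. restrict x ?J) -` A \<inter> (\<lambda>x. restrict x {1..t}) -` B \<inter> space P)"
    if k: "disintegrated_law \<Xi> T P k" and A: "A \<in> sets (path_borel \<Xi> ?J)" and B: "B \<in> sets (path_borel \<Xi> {1..t})" for k A B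
  proof -
    interpret k: disintegrated_law \<Xi> T P k by fact
    define E where "E = (\<lambda>x. restrict x ?J) -` A \<inter> (\<lambda>x. restrict x {1..t}) -` B \<inter> space P"
    have "E = ((\<lambda>x. restrict x ?J) -` A \<inter> space P) \<inter> ((\<lambda>x. restrict x {1..t}) -` B \<inter> space P)"
      by (auto simp: E_def)
    also have "\<dots> \<in> sets P"
      using assms(3) by (intro sets.Int measurable_sets[OF restr A] measurable_sets[OF restr B]) auto
    finally have E: "E \<in> sets (path_borel \<Xi> {1..T})" by (simp add: P.sets_P)
    have "emeasure P E = (\<integral>\<^sup>+x. emeasure (k t x) {z \<in> space (path_borel \<Xi> ?J). merge {1..t} ?J (x, z) \<in> E} \<partial>initial_law \<Xi> P t)"
      using k.disint assms(3) E unfolding disintegration_def by blast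
    also have "\<dots> = (\<integral>\<^sup>+x. emeasure (k t x) A * indicator B x \<partial>initial_law \<Xi> P t)"
    proof (rule nn_integral_cong)
      fix x assume "x \<in> space (initial_law \<Xi> P t)"
      then have x: "x \<in> space (path_borel \<Xi> {1..t})" by simp
      have "{z \<in> space (path_borel \<Xi> ?J). merge {1..t} ?J (x, z) \<in> E} = (if x \<in> B then A else {})"
        using P.path_extend_in_space[OF assms(3) x] sets.sets_into_space[OF A] sets_eq_imp_space_eq[OF P.sets_P]
        by (auto simp: E_def)
      then show "emeasure (k t x) {z \<in> space (path_borel \<Xi> ?J). merge {1..t} ?J (x, z) \<in> E} = emeasure (k t x) A * indicator B x"
        by simp
    qed
    finally show ?thesis by (simp add: E_def)
  qed
  have "AE x in initial_law \<Xi> P t. emeasure (\<kappa> t x) A = emeasure (\<kappa>' t x) A" if A: "A \<in> \<G>" for A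
  proof (rule I.density_unique_finite_measure)
    have A': "A \<in> sets (path_borel \<Xi> ?J)" using A \<G>(3) by auto
    have meas: "(\<lambda>x. emeasure (k t x) A) \<in> borel_measurable (initial_law \<Xi> P t)"
      if "k t \<in> path_borel \<Xi> {1..t} \<rightarrow>\<^sub>M prob_algebra (path_borel \<Xi> ?J)" for k
      using measurable_compose[OF measurable_prob_algebraD[OF that] measurable_emeasure_subprob_algebra[OF A']]
      by (simp cong: measurable_cong_sets)
    show "(\<lambda>x. emeasure (\<kappa> t x) A) \<in> borel_measurable (initial_law \<Xi> P t)"
      "(\<lambda>x. emeasure (\<kappa>' t x) A) \<in> borel_measurable (initial_law \<Xi> P t)"
      using meas[of \<kappa>] meas[of \<kappa>'] P.kernel[OF assms(3)] P'.kernel[OF assms(3)] by auto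
    show "(\<integral>\<^sup>+x. emeasure (\<kappa> t x) A * indicator B x \<partial>initial_law \<Xi> P t)
        = (\<integral>\<^sup>+x. emeasure (\<kappa>' t x) A * indicator B x \<partial>initial_law \<Xi> P t)"
      if "B \<in> sets (initial_law \<Xi> P t)" for B
    proof -
      have B: "B \<in> sets (path_borel \<Xi> {1..t})" using that by (simp only: P.sets_initial_law)
      show ?thesis unfolding joint[OF assms(1) A' B] joint[OF assms(2) A' B] ..
    qed
  qed simp_all
  then have "AE x in initial_law \<Xi> P t. \<forall>A\<in>\<G>. emeasure (\<kappa> t x) A = emeasure (\<kappa>' t x) A"
    using \<G>(1) by (subst AE_ball_countable) auto
  then show ?thesis
    using AE_space
  proof eventually_elim
    case (elim x)
    then have x: "x \<in> space (path_borel \<Xi> {1..t})" by (simp only: P.space_initial_law)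
    note k = P.prob_kernel[OF assms(3) x] P'.prob_kernel[OF assms(3) x]
    interpret k: prob_space "\<kappa> t x" by fact
    show "\<kappa> t x = \<kappa>' t x"
    proof (rule measure_eqI_generator_eq_countable[OF \<G>(2) _ _ _ _ subset_refl \<G>(5) \<G>(1)])
      show "\<G> \<subseteq> Pow (space (path_borel \<Xi> ?J))" using \<G>(3) sets.space_closed by blast
      show "emeasure (\<kappa> t x) A = emeasure (\<kappa>' t x) A" if "A \<in> \<G>" for A using elim(1) that by blast
      show "sets (\<kappa> t x) = sigma_sets (space (path_borel \<Xi> ?J)) \<G>" "sets (\<kappa>' t x) = sigma_sets (space (path_borel \<Xi> ?J)) \<G>"
        using k(2,4) \<G>(4) by (simp_all only:)
    qed simp
  qed
qed

lemma risk_cong_AE: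
  assumes "AE \<omega> in M. Z \<omega> = Z' \<omega>"
  shows "risk \<sigma> M Z = risk \<sigma> M Z'"
proof -
  have "expect M (\<lambda>\<omega>. Z \<omega> * ereal (\<zeta> \<omega>)) = expect M (\<lambda>\<omega>. Z' \<omega> * ereal (\<zeta> \<omega>))" for \<zeta>
    unfolding expect_def using assms
    by (intro arg_cong2[where f="(-)"] arg_cong[where f=enn2ereal] nn_integral_cong_AE; eventually_elim) auto
  then show ?thesis by (simp add: risk_def)
qed

text \<open>
  Conditional risks see the kernels and the risks to go only up to null sets.
\<close>

lemma nested_risk_version_independent:
  assumes law: "disintegrated_law \<Xi> T P \<kappa>" and law': "disintegrated_law \<Xi> T P \<kappa>'"
  shows "nested_risk T S \<kappa> Y = nested_risk T S \<kappa>' Y"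
proof -
  interpret P: disintegrated_law \<Xi> T P \<kappa> by fact
  have "AE x in initial_law \<Xi> P t. stage_risk T S \<kappa> Y t x = stage_risk T S \<kappa>' Y t x" if "t \<le> T" for t
    using that
  proof (induction rule: inc_induct)
    case base
    then show ?case by (simp add: stage_risk_last)
  next
    case (step t)
    show ?case
      using kernels_AE_unique[OF law law' step.hyps(2)] P.AE_initial_law_Suc[OF step.hyps(2) step.IH[unfolded Suc_eq_plus1]]
    proof eventually_elim
      case (elim x)
      show ?case
        unfolding stage_risk_step[OF step.hyps(2)] elim(1)
        by (rule SUP_cong[OF refl], rule risk_cong_AE, rule elim(2)[unfolded elim(1)])
    qed
  qed
  from P.AE_initial_law_0D[OF this[of 0]] show ?thesis by (simp add: nested_risk_def)
qed

text \<open>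
  The estimate for finite norms is applied to the risk-neutral functional, whose distortion function
  has norm one: expectations of bounded Lipschitz functions are Lipschitz in the nested distance,
  and they determine the law.
\<close>

lemma nested_dist_eq_0_imp_eq:
  assumes law: "disintegrated_law \<Xi> T P \<kappa>" and law': "disintegrated_law \<Xi> T P' \<kappa>'"
    and d: "mtopology_of d = path_topology \<Xi> {1..T}"
    and rq: "1 \<le> r" "1 < q" "1 / ennreal r + 1 / q = 1"
    and zero: "nested_dist r \<Xi> T d \<kappa> \<kappa>' = 0"
  shows "P = P'"
proof (rule measure_eq_if_Lipschitz_integrals_eq[where m = d])
  interpret P: disintegrated_law \<Xi> T P \<kappa> by fact
  interpret P': disintegrated_law \<Xi> T P' \<kappa>' by fact
  show "prob_space P" "prob_space P'" by (rule P.prob_P P'.prob_P)+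
  show "sets P = sets (borel_of (mtopology_of d))" "sets P' = sets (borel_of (mtopology_of d))"
    unfolding d by (rule P.sets_P P'.sets_P)+
  fix f :: "(nat \<Rightarrow> 'a) \<Rightarrow> real" and L
  assume f: "f \<in> borel_measurable (borel_of (mtopology_of d))" "\<And>x. 0 \<le> f x \<and> f x \<le> 1" and L: "0 \<le> L"
    and Lip: "\<And>x y. x \<in> mspace d \<Longrightarrow> y \<in> mspace d \<Longrightarrow> \<bar>f x - f y\<bar> \<le> L * mdist d x y"
  have f': "f \<in> borel_measurable (path_borel \<Xi> {1..T})" using f(1) by (simp only: d)
  note E = P.nested_risk_expectation[OF f' f(2)] and E' = P'.nested_risk_expectation[OF f' f(2)]
  have "\<bar>nested_risk T (\<lambda>_. {\<lambda>_. 1}) \<kappa> f - nested_risk T (\<lambda>_. {\<lambda>_. 1}) \<kappa>' f\<bar>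
    \<le> enn2ereal (ennreal L * (\<Prod>s\<in>{1..T}. SUP \<sigma>\<in>{\<lambda>_. 1}. Lq_norm q \<sigma>) * epowr (nested_dist r \<Xi> T d \<kappa> \<kappa>') 1)"
    using Lip distortion_one Lq_norm_one[OF rq(2)]
    by (intro nested_risk_difference_le[OF law law' d _ rq L _ _ _ E(2) E'(2)]) auto
  then have "\<bar>enn2ereal (\<integral>\<^sup>+x. ennreal (f x) \<partial>P) - enn2ereal (\<integral>\<^sup>+x. ennreal (f x) \<partial>P')\<bar> \<le> 0"
    by (simp add: E(1) E'(1) zero zero_ennreal.rep_eq)
  then show "(\<integral>\<^sup>+x. ennreal (f x) \<partial>P) = (\<integral>\<^sup>+x. ennreal (f x) \<partial>P')"
    by (cases "\<integral>\<^sup>+x. ennreal (f x) \<partial>P"; cases "\<integral>\<^sup>+x. ennreal (f x) \<partial>P'") (auto simp: enn2ereal_ennreal)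
qed

section \<open>Continuity of nested risk functionals\<close>

lemma prod_SUP_le_SUP_prod:
  fixes f :: "'i \<Rightarrow> 'b \<Rightarrow> ennreal"
  assumes "finite I"
  shows "(\<Prod>i\<in>I. SUP a\<in>A i. f i a) \<le> (SUP g\<in>PiE I A. \<Prod>i\<in>I. f i (g i))"
  using assms
proof induction
  case empty
  then show ?case by simp
next
  case (insert i I)
  let ?X = "SUP g\<in>PiE (insert i I) A. \<Prod>j\<in>insert i I. f j (g j)"
  have "f i a * (\<Prod>j\<in>I. f j (g j)) \<le> ?X" if "a \<in> A i" "g \<in> PiE I A" for a g
  proof -
    have "(\<Prod>j\<in>insert i I. f j ((g(i := a)) j)) = f i a * (\<Prod>j\<in>I. f j (g j))"
      using insert by (auto intro!: arg_cong2[where f="(*)"] prod.cong)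
    moreover have "g(i := a) \<in> PiE (insert i I) A" using that by (rule PiE_fun_upd)
    ultimately show ?thesis
      using SUP_upper[of "g(i := a)" "PiE (insert i I) A" "\<lambda>g. \<Prod>j\<in>insert i I. f j (g j)"] by simp
  qed
  then have "(SUP a\<in>A i. SUP g\<in>PiE I A. f i a * (\<Prod>j\<in>I. f j (g j))) \<le> ?X"
    by (intro SUP_least)
  also have "(SUP a\<in>A i. SUP g\<in>PiE I A. f i a * (\<Prod>j\<in>I. f j (g j)))
      = (SUP a\<in>A i. f i a) * (SUP g\<in>PiE I A. \<Prod>j\<in>I. f j (g j))"
    by (subst SUP_commute) (simp add: SUP_mult_left_ennreal SUP_mult_right_ennreal)
  finally have "(SUP a\<in>A i. f i a) * (SUP g\<in>PiE I A. \<Prod>j\<in>I. f j (g j)) \<le> ?X" .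
  then show ?case
    using insert by (auto intro: order_trans[OF mult_left_mono])
qed

text \<open>
  The supremum over an empty set of distortion functions would be \<open>-\<infinity>\<close>.
\<close>

lemma risks_finite_imp_nonempty:
  assumes law: "disintegrated_law \<Xi> T P \<kappa>" and fin: "risks_finite \<Xi> T S P \<kappa> Y" and s: "s \<in> {1..T}"
  shows "S s \<noteq> {}"
proof
  interpret P: disintegrated_law \<Xi> T P \<kappa> by fact
  obtain t where t: "s = t + 1" "t < T" using s by (cases s) auto
  assume "S s = {}"
  then have "stage_risk T S \<kappa> Y t x = - \<infinity>" for x
    using t by (simp add: stage_risk_step bot_ereal_def)
  moreover have "AE x in initial_law \<Xi> P t. \<bar>stage_risk T S \<kappa> Y t x\<bar> \<noteq> \<infinity>"
    using fin t by (simp add: risks_finite_def)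
  ultimately have "AE x in initial_law \<Xi> P t. False" by simp
  then show False
    using prob_space.AE_False[OF P.prob_initial_law[of t]] t by simp
qed

theorem theorem29:
  fixes T :: nat
    and \<Xi> :: "nat \<Rightarrow> 'a metric"
    and d :: "(nat \<Rightarrow> 'a) metric"
    and P P' :: "(nat \<Rightarrow> 'a) measure"
    and \<kappa> \<kappa>' :: "nat \<Rightarrow> (nat \<Rightarrow> 'a) \<Rightarrow> (nat \<Rightarrow> 'a) measure"
    and S :: "nat \<Rightarrow> (real \<Rightarrow> real) set"
    and r L \<beta> :: real
    and q :: ennreal
    and Y :: "(nat \<Rightarrow> 'a) \<Rightarrow> real"
  assumes "1 \<le> T"
    and "\<And>t. t \<in> {1..T} \<Longrightarrow> polish_metric (\<Xi> t)"
    and "polish_metric d" and "mtopology_of d = path_topology \<Xi> {1..T}"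
    and "prob_space P" and "sets P = sets (path_borel \<Xi> {1..T})"
    and "prob_space P'" and "sets P' = sets (path_borel \<Xi> {1..T})"
    and "disintegration \<Xi> T P \<kappa>" and "disintegration \<Xi> T P' \<kappa>'"
    and "\<And>t \<sigma>. t \<in> {1..T} \<Longrightarrow> \<sigma> \<in> S t \<Longrightarrow> distortion \<sigma>"
    and "1 \<le> r" and "1 < q" and "1 / ennreal r + 1 / q = 1"
    and "0 \<le> L" and "0 < \<beta>" and "\<beta> \<le> 1"
    and "\<And>x y. x \<in> mspace d \<Longrightarrow> y \<in> mspace d \<Longrightarrow> \<bar>Y x - Y y\<bar> \<le> L * mdist d x y powr \<beta>"
    and "risks_finite \<Xi> T S P \<kappa> Y" and "risks_finite \<Xi> T S P' \<kappa>' Y"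
  shows "\<bar>nested_risk T S \<kappa> Y - nested_risk T S \<kappa>' Y\<bar>
    \<le> enn2ereal ((SUP \<sigma>\<in>PiE {1..T} S. \<Prod>t\<in>{1..T}. Lq_norm q (\<sigma> t))
        * ennreal L * epowr (nested_dist r \<Xi> T d \<kappa> \<kappa>') \<beta>)"
proof -
  have law: "disintegrated_law \<Xi> T P \<kappa>" and law': "disintegrated_law \<Xi> T P' \<kappa>'"
    using assms(2,5-10) by (simp_all add: disintegrated_law_def)
  define k where "k s = (SUP \<sigma>\<in>S s. Lq_norm q \<sigma>)" for s
  define K where "K = (SUP \<sigma>\<in>PiE {1..T} S. \<Prod>t\<in>{1..T}. Lq_norm q (\<sigma> t))"
  have k_le: "(\<Prod>s\<in>{1..T}. k s) \<le> K"
    unfolding k_def K_def by (rule prod_SUP_le_SUP_prod) simp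
  have k_pos: "k s \<noteq> 0" if s: "s \<in> {1..T}" for s
  proof -
    obtain \<sigma> where \<sigma>: "\<sigma> \<in> S s" using risks_finite_imp_nonempty[OF law assms(19) s] by blast
    have "0 < Lq_norm q \<sigma>"
      by (rule Lq_norm_pos[OF assms(11)[OF s \<sigma>] order.strict_trans[OF zero_less_one assms(13)]])
    also have "\<dots> \<le> k s" unfolding k_def using \<sigma> by (rule SUP_upper)
    finally show ?thesis by simp
  qed
  let ?D = "nested_dist r \<Xi> T d \<kappa> \<kappa>'"
  \<comment> \<open>If \<open>K = \<infinity>\<close> and the distance vanishes, then the right-hand side is \<open>\<infinity> \<cdot> 0 = 0\<close> and the estimates give no information.\<close>
  consider (finite) "L = 0 \<or> K \<noteq> \<infinity>" | (infinite) "0 < L" "K = \<infinity>" "?D \<noteq> 0" | (zero) "?D = 0"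
    using assms(15) by fastforce
  then have "\<bar>nested_risk T S \<kappa> Y - nested_risk T S \<kappa>' Y\<bar> \<le> enn2ereal (K * ennreal L * epowr ?D \<beta>)"
  proof cases
    case finite
    have "k s \<noteq> \<infinity>" if "K \<noteq> \<infinity>" "s \<in> {1..T}" for s
    proof -
      have "(\<Prod>s\<in>{1..T}. k s) \<noteq> \<infinity>" using k_le that(1) by (auto simp: top_unique)
      then show ?thesis using k_pos that(2) by (auto simp: ennreal_prod_eq_top)
    qed
    then have norms: "L = 0 \<or> (\<forall>s\<in>{1..T}. (SUP \<sigma>\<in>S s. Lq_norm q \<sigma>) \<noteq> \<infinity>)"
      using finite unfolding k_def by blast
    have "\<bar>nested_risk T S \<kappa> Y - nested_risk T S \<kappa>' Y\<bar>
        \<le> enn2ereal (ennreal L * (\<Prod>s\<in>{1..T}. SUP \<sigma>\<in>S s. Lq_norm q \<sigma>) * epowr ?D \<beta>)"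
      by (intro nested_risk_difference_le[OF law law' assms(4) _ assms(12-17) _ assms(19,20) norms]) (fact assms(11,18))+
    also have "enn2ereal (ennreal L * (\<Prod>s\<in>{1..T}. SUP \<sigma>\<in>S s. Lq_norm q \<sigma>) * epowr ?D \<beta>)
        \<le> enn2ereal (K * ennreal L * epowr ?D \<beta>)"
      using k_le unfolding k_def
      by (subst mult.commute[of K]) (auto simp flip: less_eq_ennreal.rep_eq intro!: mult_right_mono mult_left_mono)
    finally show ?thesis .
  next
    case infinite
    then have "K * ennreal L * epowr ?D \<beta> = \<infinity>"
      by (auto simp: ennreal_mult_eq_top_iff epowr_eq_0_iff)
    then show ?thesis by simp
  next
    case zero
    have "P = P'"
      by (rule nested_dist_eq_0_imp_eq[OF law law' assms(4) assms(12-14) zero])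
    then have eq: "nested_risk T S \<kappa> Y = nested_risk T S \<kappa>' Y"
      using nested_risk_version_independent[OF law] law' by blast
    have "\<bar>nested_risk T S \<kappa>' Y\<bar> \<noteq> \<infinity>"
      unfolding nested_risk_def
    proof (rule disintegrated_law.AE_initial_law_0D[OF law'])
      show "AE x in initial_law \<Xi> P' 0. \<bar>stage_risk T S \<kappa>' Y 0 x\<bar> \<noteq> \<infinity>"
        using assms(1,20) unfolding risks_finite_def by simp
    qed
    then show ?thesis unfolding eq by auto
  qed
  then show ?thesis unfolding K_def .
qed

end
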